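(* Let $M$ be a space-time manifold, $SM$ a bundle of chiral spinors over $M$ and $DM=SM\oplus S^{\dagger}M$ the associated bundle of Dirac spinors. Then any metric connection $(\Gamma,\mathrm A,\bar{\mathrm A})$ of the Dirac bundle $DM$ is a unique extension of some metric connection of the chiral bundle $SM$; that is, there is a metric connection of $SM$ such that $(\Gamma,\mathrm A,\bar{\mathrm A})$ is an extension of it, and $(\Gamma,\mathrm A,\bar{\mathrm A})$ is the only metric connection of $DM$ extending that metric connection of $SM$.
   Context: **Space-time.** $M$ is a smooth oriented four-dimensional manifold with a pseudo-Euclidean metric $\mathbf g$ of signature $(+,-,-,-)$ and a polarization (a smooth choice distinguishing the future light cone from the past one at each point). A frame $(U,\Upsilon_0,\dots,\Upsilon_3)$ of $TM$ consists of smooth real vector fields on an open set $U$, linearly independent at each point. It is *positively polarized right orthonormal* if $\Upsilon_0$ lies in the interior of the future cone, the frame is right (positively oriented), and $\mathbf g(\Upsilon_i,\Upsilon_j)=\mathrm{diag}(1,-1,-1,-1)$. **Chiral spinors.** Let $\sigma_0$ be the $2\times2$ unit matrix, $\sigma_1=\begin{pmatrix}0&1\\1&0\end{pmatrix}$, $\sigma_2=\begin{pmatrix}0&-i\\i&0\end{pmatrix}$, $\sigma_3=\begin{pmatrix}1&0\\0&-1\end{pmatrix}$, and let $\varphi:\mathrm{SL}(2,\mathbb C)\to \mathrm{SO}^+(1,3,\mathbb R)$, $S=\varphi(\mathfrak S)$, be defined by $\mathfrak S\sigma_m\mathfrak S^\dagger=\sum_{k=0}^3S^k_m\sigma_k$.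 $SM$ is a smooth complex rank-2 vector bundle over $M$ with a nowhere vanishing skew-symmetric complex bilinear form (the spin-metric tensor of $SM$), denoted $\mathbf d$. A frame $(U,\Psi_1,\Psi_2)$ of $SM$ is orthonormal if $\mathbf d(\Psi_i,\Psi_j)$ has matrix $\begin{pmatrix}0&1\\-1&0\end{pmatrix}$. $SM$ is a *spinor bundle (bundle of chiral spinors)* if each orthonormal frame $(U,\Psi_1,\Psi_2)$ is associated with a positively polarized right orthonormal frame $(U,\Upsilon_0,\dots,\Upsilon_3)$ of $TM$ (canonically associated frames) so that whenever two orthonormal frames with overlapping domains are related by $\tilde\Psi_i=\sum_j\mathfrak S^j_i\Psi_j$, the associated tangent frames are related by $\tilde\Upsilon_i=\sum_jS^j_i\Upsilon_j$ with $S=\varphi(\mathfrak S)$. **Dirac bundle.** $S^\dagger M$ is the Hermitian conjugate bundle of $SM$, i.e. the complex conjugate of the dual bundle $S^*M$, and $DM=SM\oplus S^\dagger M$. If $(U,\Psi^{ch}_1,\Psi^{ch}_2)$ is an orthonormal frame of $SM$ with dual frame $\vartheta^1,\vartheta^2$, the frame $\Psi_1=\Psi^{ch}_1$, $\Psi_2=\Psi_2^{ch}$, $\Psi_3=\overline{\vartheta^1}$, $\Psi_4=\overline{\vartheta^2}$ of $DM$ is called canonically orthonormal chiral; it is associated with the frame of $TM$ associated with $(U,\Psi^{ch}_1,\Psi^{ch}_2)$. **Spin-tensorial fields.** Let $E$ be $SM$ or $DM$. A spin-tensorial field of type $(\alpha,\beta|\nu,\gamma|m,n)$ associated with $E$ is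 a smooth section of $E^{\otimes\alpha}\otimes (E^* )^{\otimes\beta}\otimes\bar E^{\otimes\nu}\otimes(\bar E^* )^{\otimes\gamma}\otimes(\mathbb C\otimes TM)^{\otimes m}\otimes(\mathbb C\otimes T^*M)^{\otimes n}$, where $\bar E$ is the complex conjugate bundle. In a frame pair ($\Upsilon$ of $TM$, $\Psi$ of $E$) with a common domain $U$ its components $X^{i_1\ldots i_\alpha\,\bar i_1\ldots\bar i_\nu\,h_1\ldots h_m}_{j_1\ldots j_\beta\,\bar j_1\ldots\bar j_\gamma\,k_1\ldots k_n}$ are taken with respect to $\Psi_i$, the dual frame, their conjugates, $\Upsilon_h$ and the dual coframe. $\tau$ is the semilinear involution of complex conjugation, from type $(\alpha,\beta|\nu,\gamma|m,n)$ to $(\nu,\gamma|\alpha,\beta|m,n)$: it conjugates components and exchanges the roles of barred and unbarred indices. **Basic fields.** For $SM$: the metric $\mathbf g$, the spin-metric tensor $\mathbf d$ of type $(0,2|0,0|0,0)$, and the Infeld-van der Waerden field $\mathbf G$ of type $(1,0|1,0|0,1)$ whose components $G^{i\bar i}_q$ in canonically associated frames are the $(i,\bar i)$ entries of $\sigma_q$. For $DM$: $\mathbf g$, the spin-metric tensor $\mathbf d$ of type $(0,2|0,0|0,0)$ and Dirac's $\gamma$-field $\boldsymbol\gamma$ of type $(1,1|0,0|0,1)$, given in each pair of a canonically orthonormal chiral frame and the associated frame of $TM$ by $$d_{ij}=\begin{pmatrix}0&1&0&0\\-1&0&0&0\\0&0&0&-1\\0&0&1&0\end{pmatrix},\qquad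 \gamma^{a}_{b\,m}=(\gamma_m)^a_b\ (a\text{ row},\ b\text{ column}),$$ $$\gamma_0=\begin{pmatrix}0&0&1&0\\0&0&0&1\\1&0&0&0\\0&1&0&0\end{pmatrix},\ \gamma_1=\begin{pmatrix}0&0&0&1\\0&0&1&0\\0&-1&0&0\\-1&0&0&0\end{pmatrix},\ \gamma_2=\begin{pmatrix}0&0&0&-i\\0&0&i&0\\0&i&0&0\\-i&0&0&0\end{pmatrix},\ \gamma_3=\begin{pmatrix}0&0&1&0\\0&0&0&-1\\-1&0&0&0\\0&1&0&0\end{pmatrix}.$$ **Spinor connections.** Let $E$ be $SM$ or $DM$ and $N=\operatorname{rank}E$ ($2$ or $4$). A spinor connection of $E$ is given in each frame pair ($\Upsilon$ of $TM$, $\Psi$ of $E$, common domain $U$) by smooth complex functions $\Gamma^k_{ij}$ ($0\le i,j,k\le3$), $\mathrm A^k_{ij}$, $\bar{\mathrm A}^k_{ij}$ ($0\le i\le3$, $1\le j,k\le N$) such that for two frame pairs with $\tilde\Upsilon_i=\sum S^j_i\Upsilon_j$, $\tilde\Psi_i=\sum\mathfrak S^j_i\Psi_j$, $T=S^{-1}$, $\mathfrak T=\mathfrak S^{-1}$: $$\Gamma^k_{ij}=\sum S^k_aT^b_jT^c_i\tilde\Gamma^a_{cb}+\theta^k_{ij},\quad \mathrm A^k_{ij}=\sum\mathfrak S^k_a\mathfrak T^b_jT^c_i\tilde{\mathrm A}^a_{cb}+\vartheta^k_{ij},\quad \bar{\mathrm A}^k_{ij}=\sum\overline{\mathfrak S^k_a}\,\overline{\mathfrak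 T^b_j}\,T^c_i\tilde{\bar{\mathrm A}}{}^a_{cb}+\overline{\vartheta^k_{ij}},$$ where $\theta^k_{ij}=\sum_aS^k_aL_{\Upsilon_i}(T^a_j)$, $\vartheta^k_{ij}=\sum_a\mathfrak S^k_aL_{\Upsilon_i}(\mathfrak T^a_j)$ and $L_{\Upsilon_i}(f)$ is the derivative of the function $f$ along $\Upsilon_i$. The covariant differential $\nabla$ sends type $(\alpha,\beta|\nu,\gamma|m,n)$ to $(\alpha,\beta|\nu,\gamma|m,n+1)$: $\nabla_rX^{\dots}_{\dots}$ equals $L_{\Upsilon_r}(X^{\dots}_{\dots})$, plus for each upper unbarred index $i$ a term $\sum_v\mathrm A^i_{rv}X^{\dots v\dots}_{\dots}$, minus for each lower unbarred index $j$ a term $\sum_w\mathrm A^w_{rj}X^{\dots}_{\dots w\dots}$, and the same with $\bar{\mathrm A}$ for barred indices and with $\Gamma$ for indices of $TM$, $T^*M$. The connection is real if $\nabla\tau(\mathbf X)=\tau(\nabla\mathbf X)$ for all spin-tensorial fields $\mathbf X$. **Metric connections.** A metric connection of $SM$ is a real spinor connection of $SM$ with $\nabla\mathbf d=0$, $\nabla\mathbf G=0$ and $\nabla\mathbf g=0$. A metric connection of $DM$ is a real spinor connection of $DM$ with $\nabla\mathbf d=0$ and $\nabla\boldsymbol\gamma=0$. **Extension.** A spinor connection of $DM$ is an extension of a spinor connection of $SM$ if both have the same $\Gamma$-components and the covariant differentiation in $DM=SM\oplus S^\dagger M$ preserves the subbundles $SM$ and $S^\dagger M$ and coincides on their sections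 with the covariant differentiation defined by the spinor connection of $SM$. *)

theory Defs
  imports "HOL-Analysis.Analysis" "HOL-Library.Function_Algebras"
begin

section \<open>Smooth functions and oriented 4-manifolds\<close>

primrec Ck_on :: "nat \<Rightarrow> 'a::real_normed_vector set \<Rightarrow> ('a \<Rightarrow> 'b::real_normed_vector) \<Rightarrow> bool" where
  "Ck_on 0 S f \<longleftrightarrow> continuous_on S f"
| "Ck_on (Suc k) S f \<longleftrightarrow> (\<forall>x\<in>S. f differentiable (at x)) \<and>
     (\<forall>v. Ck_on k S (\<lambda>x. frechet_derivative f (at x) v))"

text \<open>\<open>C\<^sup>\<infinity>\<close> on a set; only used for open sets.\<close>

definition Cinf_on :: "'a::real_normed_vector set \<Rightarrow> ('a \<Rightarrow> 'b::real_normed_vector) \<Rightarrow> bool" where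
  "Cinf_on S f \<longleftrightarrow> (\<forall>k. Ck_on k S f)"

type_synonym 'm chart = "'m set \<times> ('m \<Rightarrow> real^4)"

text \<open>The underlying topological space of the manifold is the whole type \<open>'m\<close>. The atlas need not
  be maximal. It carries the orientation: all transition maps have positive Jacobian, and its charts
  are the positively oriented ones.\<close>

definition oriented_atlas :: "'m::{t2_space,second_countable_topology} chart set \<Rightarrow> bool" where
  "oriented_atlas A \<longleftrightarrow>
     (\<forall>(U,\<phi>)\<in>A. open U \<and> open (\<phi> ` U) \<and> homeomorphism U (\<phi> ` U) \<phi> (inv_into U \<phi>)) \<and>
     (\<Union>(U,\<phi>)\<in>A. U) = UNIV \<and>
     (\<forall>(U,\<phi>)\<in>A. \<forall>(V,\<psi>)\<in>A. Cinf_on (\<phi> ` (U \<inter> V)) (\<psi> \<circ> inv_into U \<phi>) \<and>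
        (\<forall>x\<in>\<phi> ` (U \<inter> V). det (matrix (frechet_derivative (\<psi> \<circ> inv_into U \<phi>) (at x))) > 0))"

definition smooth_fun :: "'m::topological_space chart set \<Rightarrow> 'm set \<Rightarrow> ('m \<Rightarrow> 'b::real_normed_vector) \<Rightarrow> bool" where
  "smooth_fun A U f \<longleftrightarrow> (\<forall>(V,\<phi>)\<in>A. Cinf_on (\<phi> ` (U \<inter> V)) (f \<circ> inv_into V \<phi>))"


section \<open>Tangent vectors\<close>

text \<open>A tangent vector at \<open>p\<close> is a directional derivative operator at \<open>p\<close>. It acts on functions that
  need only be meaningful near \<open>p\<close>; to have a canonical representative, it is set to \<open>0\<close> on
  functions that are not differentiable at \<open>p\<close>.\<close>

type_synonym 'm tvec = "('m \<Rightarrow> real) \<Rightarrow> real"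

definition dir_deriv :: "'m chart \<Rightarrow> 'm \<Rightarrow> real^4 \<Rightarrow> 'm tvec" where
  "dir_deriv = (\<lambda>(V,\<phi>) p w f.
     if (f \<circ> inv_into V \<phi>) differentiable (at (\<phi> p))
     then frechet_derivative (f \<circ> inv_into V \<phi>) (at (\<phi> p)) w else 0)"

definition tangent :: "'m chart set \<Rightarrow> 'm \<Rightarrow> 'm tvec set" where
  "tangent A p = {dir_deriv c p w | c w. c \<in> A \<and> p \<in> fst c}"

definition lie :: "'m tvec \<Rightarrow> ('m \<Rightarrow> complex) \<Rightarrow> complex" where
  "lie v f = Complex (v (\<lambda>q. Re (f q))) (v (\<lambda>q. Im (f q)))"

text \<open>Scalar multiplication of functions; with the pointwise sum it makes tangent spaces
  and spaces of functionals into vector spaces.\<close>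

definition fscale :: "'s::times \<Rightarrow> ('x \<Rightarrow> 's) \<Rightarrow> 'x \<Rightarrow> 's" where
  "fscale c f = (\<lambda>x. c * f x)"

definition smooth_vfield :: "'m::topological_space chart set \<Rightarrow> 'm set \<Rightarrow> ('m \<Rightarrow> 'm tvec) \<Rightarrow> bool" where
  "smooth_vfield A U X \<longleftrightarrow> (\<forall>p\<in>U. X p \<in> tangent A p) \<and>
     (\<forall>(V,\<phi>)\<in>A. \<forall>k. smooth_fun A (U \<inter> V) (\<lambda>p. X p (\<lambda>q. \<phi> q $ k)))"

text \<open>Tangent indices \<open>0,1,2,3\<close> are the elements of the four-element type \<open>4\<close>.\<close>

type_synonym 'm tframe = "4 \<Rightarrow> 'm \<Rightarrow> 'm tvec"

definition tangent_frame :: "'m::topological_space chart set \<Rightarrow> 'm set \<Rightarrow> 'm tframe \<Rightarrow> bool" where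
  "tangent_frame A U \<Upsilon> \<longleftrightarrow> open U \<and> (\<forall>i. smooth_vfield A U (\<Upsilon> i)) \<and>
     (\<forall>p\<in>U. \<forall>c. (\<Sum>i\<in>UNIV. fscale (c i) (\<Upsilon> i p)) = 0 \<longrightarrow> (\<forall>i. c i = 0))"


section \<open>Space-time\<close>

record 'm spacetime =
  atlas :: "'m chart set"
  metric :: "'m \<Rightarrow> 'm tvec \<Rightarrow> 'm tvec \<Rightarrow> real"
  future :: "'m \<Rightarrow> 'm tvec set"

definition minkowski :: "4 \<Rightarrow> 4 \<Rightarrow> real" where
  "minkowski i j = (if i \<noteq> j then 0 else if i = 0 then 1 else -1)"

definition lorentz_metric :: "'m::topological_space chart set \<Rightarrow> ('m \<Rightarrow> 'm tvec \<Rightarrow> 'm tvec \<Rightarrow> real) \<Rightarrow> bool" where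
  "lorentz_metric A g \<longleftrightarrow>
     (\<forall>p. \<forall>u\<in>tangent A p. \<forall>v\<in>tangent A p. g p u v = g p v u \<and>
        (\<forall>w\<in>tangent A p. g p (u + v) w = g p u w + g p v w) \<and>
        (\<forall>c. g p (fscale c u) v = c * g p u v)) \<and>
     (\<forall>p. \<exists>b::4 \<Rightarrow> 'm tvec. (\<forall>i. b i \<in> tangent A p) \<and> (\<forall>i j. g p (b i) (b j) = minkowski i j)) \<and>
     (\<forall>U X Y. open U \<and> smooth_vfield A U X \<and> smooth_vfield A U Y \<longrightarrow>
        smooth_fun A U (\<lambda>p. g p (X p) (Y p)))"

text \<open>\<open>F p\<close> is the interior of the future light cone: one of the two components of the set of
  time-like vectors (two time-like vectors lie in the same component iff their
  product is positive), depending smoothly on \<open>p\<close>.\<close>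

definition polarization ::
  "'m::topological_space chart set \<Rightarrow> ('m \<Rightarrow> 'm tvec \<Rightarrow> 'm tvec \<Rightarrow> real) \<Rightarrow> ('m \<Rightarrow> 'm tvec set) \<Rightarrow> bool" where
  "polarization A g F \<longleftrightarrow>
     (\<forall>p. \<exists>v\<in>tangent A p. g p v v > 0 \<and> F p = {w \<in> tangent A p. g p w w > 0 \<and> g p v w > 0}) \<and>
     (\<forall>p. \<exists>U X. open U \<and> p \<in> U \<and> smooth_vfield A U X \<and> (\<forall>q\<in>U. X q \<in> F q))"

definition space_time :: "'m::{t2_space,second_countable_topology} spacetime \<Rightarrow> bool" where
  "space_time M \<longleftrightarrow> oriented_atlas (atlas M) \<and> lorentz_metric (atlas M) (metric M) \<and>
     polarization (atlas M) (metric M) (future M)"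

definition right_at :: "'m chart set \<Rightarrow> 'm \<Rightarrow> (4 \<Rightarrow> 'm tvec) \<Rightarrow> bool" where
  "right_at A p b \<longleftrightarrow> (\<forall>(V,\<phi>)\<in>A. p \<in> V \<longrightarrow> det (\<chi> k i. b i (\<lambda>q. \<phi> q $ k)) > 0)"

definition pol_right_orthonormal :: "'m::topological_space spacetime \<Rightarrow> 'm set \<Rightarrow> 'm tframe \<Rightarrow> bool" where
  "pol_right_orthonormal M U \<Upsilon> \<longleftrightarrow> tangent_frame (atlas M) U \<Upsilon> \<and>
     (\<forall>p\<in>U. \<Upsilon> 0 p \<in> future M p \<and> right_at (atlas M) p (\<lambda>i. \<Upsilon> i p) \<and>
       (\<forall>i j. metric M p (\<Upsilon> i p) (\<Upsilon> j p) = minkowski i j))"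


section \<open>Complex vector bundles\<close>

text \<open>All fibres are subspaces of one complex vector space \<open>('e, vscale)\<close>. This is no restriction:
  any bundle is isomorphic to one whose fibres sit in the direct sum of all of them. The smooth
  structure is given by local trivializations \<open>(U, \<Phi>)\<close>; the rank is the cardinality of \<open>'n\<close>.\<close>

record ('m, 'e, 'n) vbundle =
  fibre :: "'m \<Rightarrow> 'e set"
  vscale :: "complex \<Rightarrow> 'e \<Rightarrow> 'e"
  trivs :: "('m set \<times> ('m \<Rightarrow> 'e \<Rightarrow> complex^'n)) set"

definition complex_vector_bundle ::
  "'m::topological_space chart set \<Rightarrow> ('m, 'e::ab_group_add, 'n::finite) vbundle \<Rightarrow> bool" where
  "complex_vector_bundle A E \<longleftrightarrow>
     vector_space (vscale E) \<and> (\<forall>p. module.subspace (vscale E) (fibre E p)) \<and>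
     (\<forall>(U,\<Phi>)\<in>trivs E. open U \<and> (\<forall>p\<in>U. bij_betw (\<Phi> p) (fibre E p) UNIV \<and>
        (\<forall>v\<in>fibre E p. \<forall>w\<in>fibre E p. \<Phi> p (v + w) = \<Phi> p v + \<Phi> p w) \<and>
        (\<forall>c. \<forall>v\<in>fibre E p. \<Phi> p (vscale E c v) = c *s \<Phi> p v))) \<and>
     (\<Union>(U,\<Phi>)\<in>trivs E. U) = UNIV \<and>
     (\<forall>(U,\<Phi>)\<in>trivs E. \<forall>(V,\<Psi>)\<in>trivs E. \<forall>x.
        smooth_fun A (U \<inter> V) (\<lambda>p. \<Psi> p (inv_into (fibre E p) (\<Phi> p) x)))"

definition smooth_section ::
  "'m::topological_space chart set \<Rightarrow> ('m, 'e::ab_group_add, 'n::finite) vbundle \<Rightarrow> 'm set \<Rightarrow> ('m \<Rightarrow> 'e) \<Rightarrow> bool" where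
  "smooth_section A E U s \<longleftrightarrow> (\<forall>p\<in>U. s p \<in> fibre E p) \<and>
     (\<forall>(V,\<Phi>)\<in>trivs E. smooth_fun A (U \<inter> V) (\<lambda>p. \<Phi> p (s p)))"

text \<open>Spinor indices start at \<open>1\<close>; in the types \<open>2\<close> and \<open>4\<close> one has \<open>2 = 0\<close> and \<open>4 = 0\<close>
  respectively, in accordance with \<open>vector\<close> for matrix entries.\<close>

definition bundle_frame ::
  "'m::topological_space chart set \<Rightarrow> ('m, 'e::ab_group_add, 'n::finite) vbundle \<Rightarrow> 'm set \<Rightarrow> ('n \<Rightarrow> 'm \<Rightarrow> 'e) \<Rightarrow> bool" where
  "bundle_frame A E U \<Psi> \<longleftrightarrow> open U \<and> (\<forall>i. smooth_section A E U (\<Psi> i)) \<and>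
     (\<forall>p\<in>U. \<forall>c. (\<Sum>i\<in>UNIV. vscale E (c i) (\<Psi> i p)) = 0 \<longrightarrow> (\<forall>i. c i = 0))"

text \<open>Frame pairs \<open>(U, \<Upsilon>, \<Psi>)\<close> with a common domain.\<close>

type_synonym ('m, 'e, 'n) fpair = "'m set \<times> 'm tframe \<times> ('n \<Rightarrow> 'm \<Rightarrow> 'e)"

definition frame_pair ::
  "'m::topological_space chart set \<Rightarrow> ('m, 'e::ab_group_add, 'n::finite) vbundle \<Rightarrow> ('m, 'e, 'n) fpair \<Rightarrow> bool" where
  "frame_pair A E = (\<lambda>(U,\<Upsilon>,\<Psi>). tangent_frame A U \<Upsilon> \<and> bundle_frame A E U \<Psi>)"

text \<open>Functionals on a subspace \<open>V\<close> that are semilinear with respect to the scalar map \<open>h\<close>, extended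
  by \<open>0\<close>. With \<open>h\<close> the identity this is the dual space; with \<open>h = cnj\<close> it is the space of antilinear
  functionals, which is the complex conjugate of the dual space as well as the dual space of the
  complex conjugate; with \<open>h = of_real\<close> it is the complexified dual of a real space.\<close>

definition functionals ::
  "'v::ab_group_add set \<Rightarrow> ('s \<Rightarrow> 'v \<Rightarrow> 'v) \<Rightarrow> ('s \<Rightarrow> complex) \<Rightarrow> ('v \<Rightarrow> complex) set" where
  "functionals V sc h = {\<xi>. (\<forall>x\<in>V. \<forall>y\<in>V. \<xi> (x + y) = \<xi> x + \<xi> y) \<and>
     (\<forall>c. \<forall>x\<in>V. \<xi> (sc c x) = h c * \<xi> x) \<and> (\<forall>x. x \<notin> V \<longrightarrow> \<xi> x = 0)}"

definition dual_frame ::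
  "'v::ab_group_add set \<Rightarrow> ('s::zero \<Rightarrow> 'v \<Rightarrow> 'v) \<Rightarrow> ('i::finite \<Rightarrow> 'v) \<Rightarrow> 'i \<Rightarrow> 'v \<Rightarrow> 's" where
  "dual_frame V sc b i x = (if x \<in> V then (THE c. x = (\<Sum>j\<in>UNIV. sc (c j) (b j))) i else 0)"

definition spin_dual :: "('m, 'e::ab_group_add, 'n::finite) vbundle \<Rightarrow> ('n \<Rightarrow> 'm \<Rightarrow> 'e) \<Rightarrow> 'n \<Rightarrow> 'm \<Rightarrow> 'e \<Rightarrow> complex" where
  "spin_dual E \<Psi> i p = dual_frame (fibre E p) (vscale E) (\<lambda>j. \<Psi> j p) i"

definition tangent_dual :: "'m chart set \<Rightarrow> 'm tframe \<Rightarrow> 4 \<Rightarrow> 'm \<Rightarrow> 'm tvec \<Rightarrow> complex" where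
  "tangent_dual A \<Upsilon> i p v = of_real (dual_frame (tangent A p) fscale (\<lambda>j. \<Upsilon> j p) i v)"


section \<open>Spin-tensorial fields\<close>

text \<open>An element of the tensor product defining the type \<open>(\<alpha>,\<beta>|\<nu>,\<gamma>|m,n)\<close> at \<open>p\<close> is regarded as a
  multilinear form on the product of the dual spaces of the factors. In this order, it takes a list of
  \<open>\<alpha>\<close> elements of \<open>E\<^sup>*\<close>, of \<open>\<beta>\<close> elements of \<open>E\<close>, of \<open>\<nu>\<close> elements of the dual of the conjugate
  bundle (antilinear functionals on \<open>E\<close>), of \<open>\<gamma>\<close> elements of the conjugate bundle (elements of \<open>E\<close>,
  on which the form is therefore antilinear), of \<open>m\<close> complex covectors, and of \<open>n\<close> real tangent vectors
  (a complex linear form on the complexification being the same as a real linear one on \<open>TM\<close>).\<close>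

type_synonym ('m, 'e) spin_tensor =
  "'m \<Rightarrow> ('e \<Rightarrow> complex) list \<Rightarrow> 'e list \<Rightarrow> ('e \<Rightarrow> complex) list \<Rightarrow> 'e list \<Rightarrow>
   ('m tvec \<Rightarrow> complex) list \<Rightarrow> 'm tvec list \<Rightarrow> complex"

type_synonym spin_type = "nat \<times> nat \<times> nat \<times> nat \<times> nat \<times> nat"

definition tuples :: "'v set \<Rightarrow> nat \<Rightarrow> 'v list set" where
  "tuples V k = {xs. set xs \<subseteq> V \<and> length xs = k}"

definition multilinear ::
  "'v::ab_group_add set \<Rightarrow> ('s \<Rightarrow> 'v \<Rightarrow> 'v) \<Rightarrow> ('s \<Rightarrow> complex) \<Rightarrow> nat \<Rightarrow> ('v list \<Rightarrow> complex) \<Rightarrow> bool" where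
  "multilinear V sc h k F \<longleftrightarrow> (\<forall>xs\<in>tuples V k. \<forall>i<k. \<forall>x\<in>V. \<forall>y\<in>V.
     F (xs[i := x + y]) = F (xs[i := x]) + F (xs[i := y]) \<and>
     (\<forall>c. F (xs[i := sc c x]) = h c * F (xs[i := x])))"

definition spin_tensor_at ::
  "'m chart set \<Rightarrow> ('m, 'e::ab_group_add, 'n::finite) vbundle \<Rightarrow> spin_type \<Rightarrow> 'm \<Rightarrow> ('m, 'e) spin_tensor \<Rightarrow> bool" where
  "spin_tensor_at A E = (\<lambda>(\<alpha>,\<beta>,\<nu>,\<gamma>,m,n) p X.
     let V = fibre E p; T = tangent A p;
         D = functionals V (vscale E) (\<lambda>c. c);
         B = functionals V (vscale E) cnj;
         C = functionals T fscale complex_of_real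
     in \<forall>\<xi>\<in>tuples D \<alpha>. \<forall>v\<in>tuples V \<beta>. \<forall>\<eta>\<in>tuples B \<nu>. \<forall>w\<in>tuples V \<gamma>. \<forall>\<theta>\<in>tuples C m. \<forall>u\<in>tuples T n.
          multilinear D fscale (\<lambda>c. c) \<alpha> (\<lambda>x. X p x v \<eta> w \<theta> u) \<and>
          multilinear V (vscale E) (\<lambda>c. c) \<beta> (\<lambda>x. X p \<xi> x \<eta> w \<theta> u) \<and>
          multilinear B fscale (\<lambda>c. c) \<nu> (\<lambda>x. X p \<xi> v x w \<theta> u) \<and>
          multilinear V (vscale E) cnj \<gamma> (\<lambda>x. X p \<xi> v \<eta> x \<theta> u) \<and>
          multilinear C fscale (\<lambda>c. c) m (\<lambda>x. X p \<xi> v \<eta> w x u) \<and>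
          multilinear T fscale complex_of_real n (\<lambda>x. X p \<xi> v \<eta> w \<theta> x))"

text \<open>Component families, with the index lists in the same order as above.\<close>

type_synonym ('m, 'n) component_family =
  "'n list \<Rightarrow> 'n list \<Rightarrow> 'n list \<Rightarrow> 'n list \<Rightarrow> 4 list \<Rightarrow> 4 list \<Rightarrow> 'm \<Rightarrow> complex"

definition components ::
  "'m chart set \<Rightarrow> ('m, 'e::ab_group_add, 'n::finite) vbundle \<Rightarrow> ('m, 'e, 'n) fpair \<Rightarrow> ('m, 'e) spin_tensor \<Rightarrow>
   ('m, 'n) component_family" where
  "components A E = (\<lambda>(U,\<Upsilon>,\<Psi>) X i j i' j' h k p.
     X p (map (\<lambda>a. spin_dual E \<Psi> a p) i) (map (\<lambda>a. \<Psi> a p) j)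
         (map (\<lambda>a. cnj \<circ> spin_dual E \<Psi> a p) i') (map (\<lambda>a. \<Psi> a p) j')
         (map (\<lambda>a. tangent_dual A \<Upsilon> a p) h) (map (\<lambda>a. \<Upsilon> a p) k))"

definition has_type :: "spin_type \<Rightarrow> 'n list \<Rightarrow> 'n list \<Rightarrow> 'n list \<Rightarrow> 'n list \<Rightarrow> 4 list \<Rightarrow> 4 list \<Rightarrow> bool" where
  "has_type t i j i' j' h k \<longleftrightarrow> t = (length i, length j, length i', length j', length h, length k)"

definition spin_field ::
  "'m::topological_space chart set \<Rightarrow> ('m, 'e::ab_group_add, 'n::finite) vbundle \<Rightarrow> spin_type \<Rightarrow> ('m, 'e) spin_tensor \<Rightarrow> bool" where
  "spin_field A E t X \<longleftrightarrow> (\<forall>p. spin_tensor_at A E t p X) \<and>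
     (\<forall>U \<Upsilon> \<Psi>. frame_pair A E (U,\<Upsilon>,\<Psi>) \<longrightarrow>
       (\<forall>i j i' j' h k. has_type t i j i' j' h k \<longrightarrow>
         smooth_fun A U (components A E (U,\<Upsilon>,\<Psi>) X i j i' j' h k)))"

definition conj_field :: "('m, 'e) spin_tensor \<Rightarrow> ('m, 'e) spin_tensor" where
  "conj_field X = (\<lambda>p \<xi> v \<eta> w \<theta> u.
     cnj (X p (map ((\<circ>) cnj) \<eta>) w (map ((\<circ>) cnj) \<xi>) v (map ((\<circ>) cnj) \<theta>) u))"

definition conj_components :: "('m, 'n) component_family \<Rightarrow> ('m, 'n) component_family" where
  "conj_components x = (\<lambda>i j i' j' h k p. cnj (x i' j' i j h k p))"

lemma components_conj_field:
  fixes A :: "'m chart set"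
  shows "components A E F (conj_field X) = conj_components (components A E F X)"
proof -
  have 1: "cnj \<circ> (cnj \<circ> f) = f" for f :: "'e \<Rightarrow> complex" by (simp add: fun_eq_iff)
  have 2: "cnj \<circ> tangent_dual A \<Upsilon> a p = tangent_dual A \<Upsilon> a p" for \<Upsilon> :: "'m tframe" and a p
    by (simp add: fun_eq_iff tangent_dual_def)
  obtain U \<Upsilon> \<Psi> where F: "F = (U, \<Upsilon>, \<Psi>)" by (cases F)
  show ?thesis
    unfolding F by (intro ext) (simp add: components_def conj_field_def conj_components_def 1 2 comp_def[of "(\<circ>) cnj"])
qed

definition vector_field :: "('m \<Rightarrow> 'e) \<Rightarrow> ('m, 'e) spin_tensor" where
  "vector_field s = (\<lambda>p \<xi> v \<eta> w \<theta> u. (\<xi> ! 0) (s p))"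

definition conj_covector_field :: "('m \<Rightarrow> 'e \<Rightarrow> complex) \<Rightarrow> ('m, 'e) spin_tensor" where
  "conj_covector_field z = (\<lambda>p \<xi> v \<eta> w \<theta> u. z p (w ! 0))"

definition bilinear_field :: "('m \<Rightarrow> 'e \<Rightarrow> 'e \<Rightarrow> complex) \<Rightarrow> ('m, 'e) spin_tensor" where
  "bilinear_field d = (\<lambda>p \<xi> v \<eta> w \<theta> u. d p (v ! 0) (v ! 1))"

definition metric_field :: "'m spacetime \<Rightarrow> ('m, 'e) spin_tensor" where
  "metric_field M = (\<lambda>p \<xi> v \<eta> w \<theta> u. complex_of_real (metric M p (u ! 0) (u ! 1)))"


section \<open>Chiral spinors\<close>

definition pauli :: "4 \<Rightarrow> complex^2^2" where
  "pauli m =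
     (if m = 0 then vector [vector [1, 0], vector [0, 1]]
      else if m = 1 then vector [vector [0, 1], vector [1, 0]]
      else if m = 2 then vector [vector [0, -\<i>], vector [\<i>, 0]]
      else vector [vector [1, 0], vector [0, -1]])"

definition adjoint_matrix :: "complex^2^2 \<Rightarrow> complex^2^2" where
  "adjoint_matrix B = (\<chi> i j. cnj (B $ j $ i))"

text \<open>In all matrices below, the entry \<open>S\<^sup>k\<^sub>m\<close> is \<open>S $ k $ m\<close>.\<close>

definition lorentz_of :: "complex^2^2 \<Rightarrow> real^4^4" where
  "lorentz_of B = (THE S. \<forall>m. B ** pauli m ** adjoint_matrix B = (\<Sum>k\<in>UNIV. S $ k $ m *\<^sub>R pauli k))"

record ('m, 'e) chiral =
  sbundle :: "('m, 'e, 2) vbundle"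
  spin_metric :: "'m \<Rightarrow> 'e \<Rightarrow> 'e \<Rightarrow> complex"
  assoc :: "'m set \<Rightarrow> (2 \<Rightarrow> 'm \<Rightarrow> 'e) \<Rightarrow> 'm tframe"

definition chiral_orthonormal ::
  "'m::topological_space chart set \<Rightarrow> ('m, 'e::ab_group_add) chiral \<Rightarrow> 'm set \<Rightarrow> (2 \<Rightarrow> 'm \<Rightarrow> 'e) \<Rightarrow> bool" where
  "chiral_orthonormal A SM U \<Psi> \<longleftrightarrow> bundle_frame A (sbundle SM) U \<Psi> \<and>
     (\<forall>p\<in>U. \<forall>i j. spin_metric SM p (\<Psi> i p) (\<Psi> j p) =
        (vector [vector [0, 1], vector [-1, 0]] :: complex^2^2) $ i $ j)"

definition spinor_bundle ::
  "'m::{t2_space,second_countable_topology} spacetime \<Rightarrow> ('m, 'e::ab_group_add) chiral \<Rightarrow> bool" where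
  "spinor_bundle M SM \<longleftrightarrow>
     complex_vector_bundle (atlas M) (sbundle SM) \<and>
     spin_field (atlas M) (sbundle SM) (0,2,0,0,0,0) (bilinear_field (spin_metric SM)) \<and>
     (\<forall>p. \<forall>v\<in>fibre (sbundle SM) p. \<forall>w\<in>fibre (sbundle SM) p. spin_metric SM p v w = - spin_metric SM p w v) \<and>
     (\<forall>p. \<exists>v\<in>fibre (sbundle SM) p. \<exists>w\<in>fibre (sbundle SM) p. spin_metric SM p v w \<noteq> 0) \<and>
     (\<forall>U \<Psi>. chiral_orthonormal (atlas M) SM U \<Psi> \<longrightarrow> pol_right_orthonormal M U (assoc SM U \<Psi>)) \<and>
     (\<forall>U \<Psi> U' \<Psi>'. chiral_orthonormal (atlas M) SM U \<Psi> \<and> chiral_orthonormal (atlas M) SM U' \<Psi>' \<longrightarrow>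
       (\<forall>p\<in>U \<inter> U'. \<forall>B::complex^2^2.
         (\<forall>i. \<Psi>' i p = (\<Sum>j\<in>UNIV. vscale (sbundle SM) (B $ j $ i) (\<Psi> j p))) \<longrightarrow>
         (\<forall>i. assoc SM U' \<Psi>' i p = (\<Sum>j\<in>UNIV. fscale (lorentz_of B $ j $ i) (assoc SM U \<Psi> j p)))))"

text \<open>A basic field is given by its components in canonically associated frames; its value on given
  arguments is the common value of the contractions computed in any such frames around the point.\<close>

definition infeld_vdw :: "'m::topological_space chart set \<Rightarrow> ('m, 'e::ab_group_add) chiral \<Rightarrow> ('m, 'e) spin_tensor" where
  "infeld_vdw A SM = (\<lambda>p \<xi> v \<eta> w \<theta> u. THE z. \<forall>U \<Psi>. chiral_orthonormal A SM U \<Psi> \<and> p \<in> U \<longrightarrow>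
     z = (\<Sum>i\<in>UNIV. \<Sum>j\<in>UNIV. \<Sum>q\<in>UNIV. pauli q $ i $ j *
            (\<xi> ! 0) (\<Psi> i p) * (\<eta> ! 0) (\<Psi> j p) * tangent_dual A (assoc SM U \<Psi>) q p (u ! 0)))"


section \<open>The Dirac bundle\<close>

text \<open>The fibre of the Hermitian conjugate bundle consists of the antilinear functionals on the fibre
  of \<open>SM\<close>; the conjugate of a linear functional \<open>\<xi>\<close> is \<open>cnj \<circ> \<xi>\<close>. A local trivialization of
  \<open>SM\<close>, i.e. a local frame \<open>\<Phi>\<^sup>-\<^sup>1(e\<^sub>1), \<Phi>\<^sup>-\<^sup>1(e\<^sub>2)\<close>, induces one of the Dirac bundle by means of the
  conjugate dual frame: the coordinates of an antilinear functional are its values on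
  \<open>\<Phi>\<^sup>-\<^sup>1(e\<^sub>1), \<Phi>\<^sup>-\<^sup>1(e\<^sub>2)\<close>.\<close>

definition dirac_bundle ::
  "('m, 'e::ab_group_add, 2) vbundle \<Rightarrow> ('m, 'e \<times> ('e \<Rightarrow> complex), 4) vbundle" where
  "dirac_bundle S =
     \<lparr> fibre = (\<lambda>p. fibre S p \<times> functionals (fibre S p) (vscale S) cnj),
       vscale = (\<lambda>c (v, z). (vscale S c v, fscale c z)),
       trivs = {(U, \<lambda>p (v, z). vector [\<Phi> p v $ 1, \<Phi> p v $ 2,
                  z (inv_into (fibre S p) (\<Phi> p) (axis 1 1)),
                  z (inv_into (fibre S p) (\<Phi> p) (axis 2 1))]) | U \<Phi>. (U, \<Phi>) \<in> trivs S} \<rparr>"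

definition dirac_frame ::
  "('m, 'e::ab_group_add, 2) vbundle \<Rightarrow> (2 \<Rightarrow> 'm \<Rightarrow> 'e) \<Rightarrow> 4 \<Rightarrow> 'm \<Rightarrow> 'e \<times> ('e \<Rightarrow> complex)" where
  "dirac_frame S \<Psi> a p =
     (if a = 1 then (\<Psi> 1 p, 0) else if a = 2 then (\<Psi> 2 p, 0)
      else if a = 3 then (0, cnj \<circ> spin_dual S \<Psi> 1 p) else (0, cnj \<circ> spin_dual S \<Psi> 2 p))"

definition dirac_metric_matrix :: "complex^4^4" where
  "dirac_metric_matrix = vector
     [vector [ 0, 1, 0, 0],
      vector [-1, 0, 0, 0],
      vector [ 0, 0, 0,-1],
      vector [ 0, 0, 1, 0]]"

definition dirac_gamma_matrix :: "4 \<Rightarrow> complex^4^4" where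
  "dirac_gamma_matrix m =
     (if m = 0 then vector
       [vector [0, 0, 1, 0],
        vector [0, 0, 0, 1],
        vector [1, 0, 0, 0],
        vector [0, 1, 0, 0]]
      else if m = 1 then vector
       [vector [ 0, 0, 0, 1],
        vector [ 0, 0, 1, 0],
        vector [ 0,-1, 0, 0],
        vector [-1, 0, 0, 0]]
      else if m = 2 then vector
       [vector [ 0, 0, 0,-\<i>],
        vector [ 0, 0, \<i>, 0],
        vector [ 0, \<i>, 0, 0],
        vector [-\<i>, 0, 0, 0]]
      else vector
       [vector [ 0, 0, 1, 0],
        vector [ 0, 0, 0,-1],
        vector [-1, 0, 0, 0],
        vector [ 0, 1, 0, 0]])"

definition dirac_metric ::
  "'m::topological_space chart set \<Rightarrow> ('m, 'e::ab_group_add) chiral \<Rightarrow> ('m, 'e \<times> ('e \<Rightarrow> complex)) spin_tensor" where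
  "dirac_metric A SM = (let D = dirac_bundle (sbundle SM) in
     (\<lambda>p \<xi> v \<eta> w \<theta> u. THE z. \<forall>U \<Psi>. chiral_orthonormal A SM U \<Psi> \<and> p \<in> U \<longrightarrow>
       (let \<Psi>D = dirac_frame (sbundle SM) \<Psi> in
        z = (\<Sum>a\<in>UNIV. \<Sum>b\<in>UNIV. dirac_metric_matrix $ a $ b *
              spin_dual D \<Psi>D a p (v ! 0) * spin_dual D \<Psi>D b p (v ! 1)))))"

definition dirac_gamma ::
  "'m::topological_space chart set \<Rightarrow> ('m, 'e::ab_group_add) chiral \<Rightarrow> ('m, 'e \<times> ('e \<Rightarrow> complex)) spin_tensor" where
  "dirac_gamma A SM = (let D = dirac_bundle (sbundle SM) in
     (\<lambda>p \<xi> v \<eta> w \<theta> u. THE z. \<forall>U \<Psi>. chiral_orthonormal A SM U \<Psi> \<and> p \<in> U \<longrightarrow>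
       (let \<Psi>D = dirac_frame (sbundle SM) \<Psi> in
        z = (\<Sum>a\<in>UNIV. \<Sum>b\<in>UNIV. \<Sum>m\<in>UNIV. dirac_gamma_matrix m $ a $ b *
              (\<xi> ! 0) (\<Psi>D a p) * spin_dual D \<Psi>D b p (v ! 0) *
              tangent_dual A (assoc SM U \<Psi>) m p (u ! 0)))))"


section \<open>Spinor connections\<close>

text \<open>\<open>conA C F k i j\<close> is the component with upper index \<open>k\<close> and lower indices \<open>i j\<close> in the frame
  pair \<open>F\<close>, where \<open>i\<close> is the index of differentiation; similarly for the barred one \<open>conB\<close> and for
  \<open>conG\<close> (the \<open>\<Gamma>\<close>-components). Values for triples \<open>F\<close> that are not frame pairs, and at points outside
  the domain of \<open>F\<close>, are irrelevant.\<close>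

record ('m, 'e, 'n) connection =
  conG :: "('m, 'e, 'n) fpair \<Rightarrow> 4 \<Rightarrow> 4 \<Rightarrow> 4 \<Rightarrow> 'm \<Rightarrow> complex"
  conA :: "('m, 'e, 'n) fpair \<Rightarrow> 'n \<Rightarrow> 4 \<Rightarrow> 'n \<Rightarrow> 'm \<Rightarrow> complex"
  conB :: "('m, 'e, 'n) fpair \<Rightarrow> 'n \<Rightarrow> 4 \<Rightarrow> 'n \<Rightarrow> 'm \<Rightarrow> complex"

definition spinor_connection ::
  "'m::topological_space chart set \<Rightarrow> ('m, 'e::ab_group_add, 'n::finite) vbundle \<Rightarrow> ('m, 'e, 'n) connection \<Rightarrow> bool" where
  "spinor_connection A E C \<longleftrightarrow>
     (\<forall>U \<Upsilon> \<Psi>. frame_pair A E (U,\<Upsilon>,\<Psi>) \<longrightarrow>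
        (\<forall>k i j. smooth_fun A U (conG C (U,\<Upsilon>,\<Psi>) k i j)) \<and>
        (\<forall>k i j. smooth_fun A U (conA C (U,\<Upsilon>,\<Psi>) k i j)) \<and>
        (\<forall>k i j. smooth_fun A U (conB C (U,\<Upsilon>,\<Psi>) k i j))) \<and>
     (\<forall>U \<Upsilon> \<Psi> U' \<Upsilon>' \<Psi>'. frame_pair A E (U,\<Upsilon>,\<Psi>) \<and> frame_pair A E (U',\<Upsilon>',\<Psi>') \<longrightarrow>
       (\<forall>(S :: 'm \<Rightarrow> real^4^4) (Q :: 'm \<Rightarrow> complex^'n^'n) T R.
         (\<forall>p\<in>U \<inter> U'.
            (\<forall>i. \<Upsilon>' i p = (\<Sum>j\<in>UNIV. fscale (S p $ j $ i) (\<Upsilon> j p))) \<and>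
            (\<forall>i. \<Psi>' i p = (\<Sum>j\<in>UNIV. vscale E (Q p $ j $ i) (\<Psi> j p))) \<and>
            T p = matrix_inv (S p) \<and> R p = matrix_inv (Q p)) \<longrightarrow>
         (\<forall>p\<in>U \<inter> U'.
           (\<forall>k i j. conG C (U,\<Upsilon>,\<Psi>) k i j p =
              (\<Sum>a\<in>UNIV. \<Sum>b\<in>UNIV. \<Sum>c\<in>UNIV.
                 of_real (S p $ k $ a) * of_real (T p $ b $ j) * of_real (T p $ c $ i) *
                 conG C (U',\<Upsilon>',\<Psi>') a c b p) +
              (\<Sum>a\<in>UNIV. of_real (S p $ k $ a) * of_real (\<Upsilon> i p (\<lambda>q. T q $ a $ j)))) \<and>
           (\<forall>k i j. conA C (U,\<Upsilon>,\<Psi>) k i j p =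
              (\<Sum>a\<in>UNIV. \<Sum>b\<in>UNIV. \<Sum>c\<in>UNIV.
                 Q p $ k $ a * R p $ b $ j * of_real (T p $ c $ i) * conA C (U',\<Upsilon>',\<Psi>') a c b p) +
              (\<Sum>a\<in>UNIV. Q p $ k $ a * lie (\<Upsilon> i p) (\<lambda>q. R q $ a $ j))) \<and>
           (\<forall>k i j. conB C (U,\<Upsilon>,\<Psi>) k i j p =
              (\<Sum>a\<in>UNIV. \<Sum>b\<in>UNIV. \<Sum>c\<in>UNIV.
                 cnj (Q p $ k $ a) * cnj (R p $ b $ j) * of_real (T p $ c $ i) * conB C (U',\<Upsilon>',\<Psi>') a c b p) +
              cnj (\<Sum>a\<in>UNIV. Q p $ k $ a * lie (\<Upsilon> i p) (\<lambda>q. R q $ a $ j))))))"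

text \<open>The components \<open>\<nabla>\<^sub>r X\<close> in the frame pair \<open>F\<close>, in terms of the components \<open>x\<close> of \<open>X\<close>.\<close>

definition nabla ::
  "('m, 'e, 'n::finite) connection \<Rightarrow> ('m, 'e, 'n) fpair \<Rightarrow> ('m, 'n) component_family \<Rightarrow> 4 \<Rightarrow> ('m, 'n) component_family" where
  "nabla C F x r = (\<lambda>i j i' j' h k p.
     lie (fst (snd F) r p) (x i j i' j' h k)
     + (\<Sum>s<length i. \<Sum>v\<in>UNIV. conA C F (i ! s) r v p * x (i[s := v]) j i' j' h k p)
     - (\<Sum>s<length j. \<Sum>w\<in>UNIV. conA C F w r (j ! s) p * x i (j[s := w]) i' j' h k p)
     + (\<Sum>s<length i'. \<Sum>v\<in>UNIV. conB C F (i' ! s) r v p * x i j (i'[s := v]) j' h k p)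
     - (\<Sum>s<length j'. \<Sum>w\<in>UNIV. conB C F w r (j' ! s) p * x i j i' (j'[s := w]) h k p)
     + (\<Sum>s<length h. \<Sum>v\<in>UNIV. conG C F (h ! s) r v p * x i j i' j' (h[s := v]) k p)
     - (\<Sum>s<length k. \<Sum>w\<in>UNIV. conG C F w r (k ! s) p * x i j i' j' h (k[s := w]) p))"

definition parallel ::
  "'m::topological_space chart set \<Rightarrow> ('m, 'e::ab_group_add, 'n::finite) vbundle \<Rightarrow> ('m, 'e, 'n) connection \<Rightarrow>
   spin_type \<Rightarrow> ('m, 'e) spin_tensor \<Rightarrow> bool" where
  "parallel A E C t X \<longleftrightarrow> (\<forall>U \<Upsilon> \<Psi>. frame_pair A E (U,\<Upsilon>,\<Psi>) \<longrightarrow>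
     (\<forall>p\<in>U. \<forall>r i j i' j' h k. has_type t i j i' j' h k \<longrightarrow>
        nabla C (U,\<Upsilon>,\<Psi>) (components A E (U,\<Upsilon>,\<Psi>) X) r i j i' j' h k p = 0))"

text \<open>\<open>\<nabla>\<tau>(X) = \<tau>(\<nabla>X)\<close>, an identity of fields of type \<open>(\<nu>,\<gamma>|\<alpha>,\<beta>|m,n+1)\<close>, written in components.\<close>

definition real_connection ::
  "'m::topological_space chart set \<Rightarrow> ('m, 'e::ab_group_add, 'n::finite) vbundle \<Rightarrow> ('m, 'e, 'n) connection \<Rightarrow> bool" where
  "real_connection A E C \<longleftrightarrow> (\<forall>\<alpha> \<beta> \<nu> \<gamma> m n X. spin_field A E (\<alpha>,\<beta>,\<nu>,\<gamma>,m,n) X \<longrightarrow>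
     (\<forall>U \<Upsilon> \<Psi>. frame_pair A E (U,\<Upsilon>,\<Psi>) \<longrightarrow>
       (\<forall>p\<in>U. \<forall>r i j i' j' h k. has_type (\<nu>,\<gamma>,\<alpha>,\<beta>,m,n) i j i' j' h k \<longrightarrow>
          nabla C (U,\<Upsilon>,\<Psi>) (components A E (U,\<Upsilon>,\<Psi>) (conj_field X)) r i j i' j' h k p =
          conj_components (nabla C (U,\<Upsilon>,\<Psi>) (components A E (U,\<Upsilon>,\<Psi>) X) r) i j i' j' h k p)))"

definition metric_connection_SM ::
  "'m::topological_space spacetime \<Rightarrow> ('m, 'e::ab_group_add) chiral \<Rightarrow> ('m, 'e, 2) connection \<Rightarrow> bool" where
  "metric_connection_SM M SM C \<longleftrightarrow>
     spinor_connection (atlas M) (sbundle SM) C \<and> real_connection (atlas M) (sbundle SM) C \<and>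
     parallel (atlas M) (sbundle SM) C (0,2,0,0,0,0) (bilinear_field (spin_metric SM)) \<and>
     parallel (atlas M) (sbundle SM) C (1,0,1,0,0,1) (infeld_vdw (atlas M) SM) \<and>
     parallel (atlas M) (sbundle SM) C (0,0,0,0,0,2) (metric_field M)"

definition metric_connection_DM ::
  "'m::topological_space spacetime \<Rightarrow> ('m, 'e::ab_group_add) chiral \<Rightarrow>
   ('m, 'e \<times> ('e \<Rightarrow> complex), 4) connection \<Rightarrow> bool" where
  "metric_connection_DM M SM C \<longleftrightarrow> (let D = dirac_bundle (sbundle SM) in
     spinor_connection (atlas M) D C \<and> real_connection (atlas M) D C \<and>
     parallel (atlas M) D C (0,2,0,0,0,0) (dirac_metric (atlas M) SM) \<and>
     parallel (atlas M) D C (1,1,0,0,0,1) (dirac_gamma (atlas M) SM))"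


section \<open>Extensions\<close>

text \<open>Covariant derivatives along \<open>\<Upsilon>\<^sub>r\<close> of sections of \<open>E\<close>, and of sections of its Hermitian
  conjugate bundle (fields of type \<open>(0,0|0,1|0,0)\<close>), as elements of the fibre.\<close>

definition nabla_section ::
  "'m chart set \<Rightarrow> ('m, 'e::ab_group_add, 'n::finite) vbundle \<Rightarrow> ('m, 'e, 'n) connection \<Rightarrow>
   ('m, 'e, 'n) fpair \<Rightarrow> 4 \<Rightarrow> ('m \<Rightarrow> 'e) \<Rightarrow> 'm \<Rightarrow> 'e" where
  "nabla_section A E C = (\<lambda>(U,\<Upsilon>,\<Psi>) r s p. \<Sum>i\<in>UNIV. vscale E
     (nabla C (U,\<Upsilon>,\<Psi>) (components A E (U,\<Upsilon>,\<Psi>) (vector_field s)) r [i] [] [] [] [] [] p) (\<Psi> i p))"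

definition nabla_conj_cosection ::
  "'m chart set \<Rightarrow> ('m, 'e::ab_group_add, 'n::finite) vbundle \<Rightarrow> ('m, 'e, 'n) connection \<Rightarrow>
   ('m, 'e, 'n) fpair \<Rightarrow> 4 \<Rightarrow> ('m \<Rightarrow> 'e \<Rightarrow> complex) \<Rightarrow> 'm \<Rightarrow> 'e \<Rightarrow> complex" where
  "nabla_conj_cosection A E C = (\<lambda>(U,\<Upsilon>,\<Psi>) r z p. \<Sum>j\<in>UNIV. fscale
     (nabla C (U,\<Upsilon>,\<Psi>) (components A E (U,\<Upsilon>,\<Psi>) (conj_covector_field z)) r [] [] [] [j] [] [] p)
     (cnj \<circ> spin_dual E \<Psi> j p))"

text \<open>The last two conjuncts say at once that covariant differentiation in the direct sum preserves
  either summand and that it coincides there with the given one.\<close>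

definition extension ::
  "'m::topological_space chart set \<Rightarrow> ('m, 'e::ab_group_add, 2) vbundle \<Rightarrow>
   ('m, 'e, 2) connection \<Rightarrow> ('m, 'e \<times> ('e \<Rightarrow> complex), 4) connection \<Rightarrow> bool" where
  "extension A S C0 C \<longleftrightarrow> (let D = dirac_bundle S in
     \<forall>U \<Upsilon> \<Psi> \<Psi>'. frame_pair A S (U,\<Upsilon>,\<Psi>) \<and> frame_pair A D (U,\<Upsilon>,\<Psi>') \<longrightarrow> (\<forall>p\<in>U.
       (\<forall>k i j. conG C (U,\<Upsilon>,\<Psi>') k i j p = conG C0 (U,\<Upsilon>,\<Psi>) k i j p) \<and>
       (\<forall>s r. smooth_section A S UNIV s \<longrightarrow>
          nabla_section A D C (U,\<Upsilon>,\<Psi>') r (\<lambda>q. (s q, 0)) p = (nabla_section A S C0 (U,\<Upsilon>,\<Psi>) r s p, 0)) \<and>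
       (\<forall>z r. smooth_section A D UNIV (\<lambda>q. (0, z q)) \<longrightarrow>
          nabla_section A D C (U,\<Upsilon>,\<Psi>') r (\<lambda>q. (0, z q)) p = (0, nabla_conj_cosection A S C0 (U,\<Upsilon>,\<Psi>) r z p))))"

definition same_connection ::
  "'m::topological_space chart set \<Rightarrow> ('m, 'e::ab_group_add, 'n::finite) vbundle \<Rightarrow>
   ('m, 'e, 'n) connection \<Rightarrow> ('m, 'e, 'n) connection \<Rightarrow> bool" where
  "same_connection A E C C' \<longleftrightarrow> (\<forall>U \<Upsilon> \<Psi>. frame_pair A E (U,\<Upsilon>,\<Psi>) \<longrightarrow> (\<forall>p\<in>U.
     (\<forall>k i j. conG C (U,\<Upsilon>,\<Psi>) k i j p = conG C' (U,\<Upsilon>,\<Psi>) k i j p) \<and>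
     (\<forall>k i j. conA C (U,\<Upsilon>,\<Psi>) k i j p = conA C' (U,\<Upsilon>,\<Psi>) k i j p) \<and>
     (\<forall>k i j. conB C (U,\<Upsilon>,\<Psi>) k i j p = conB C' (U,\<Upsilon>,\<Psi>) k i j p)))"

end

theory Submission
  imports Defs
begin

text \<open>Every frame \<open>\<Psi>\<close> of \<open>SM\<close> yields a frame of \<open>DM\<close>, consisting of \<open>\<Psi>\<close> and its conjugate dual frame. In such
  a frame the matrices \<open>A\<^sub>r\<close> of a connection of \<open>DM\<close> consist of four \<open>2\<times>2\<close> blocks: \<open>P\<close> and \<open>N\<close> on the
  diagonal, \<open>X\<close> above and \<open>Y\<close> below. Suppose that the frame is orthonormal and paired with its associated
  tangent frame. Then \<open>d\<close> and \<open>\<gamma>\<close> have constant components and \<open>\<nabla>d = 0\<close>, \<open>\<nabla>\<gamma> = 0\<close> are linear equations for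
  these blocks. The blocks of \<open>\<gamma>\<^sub>m\<close> are \<open>\<sigma>\<^sub>m\<close> and its adjugate, and

  \<^item> the diagonal blocks of \<open>\<nabla>\<gamma> = 0\<close> say \<open>X adj(\<sigma>\<^sub>m) = \<sigma>\<^sub>m Y\<close>. For \<open>m = 0\<close> this is \<open>X = Y\<close>, and then \<open>X\<close>
    anticommutes with \<open>\<sigma>\<^sub>1, \<sigma>\<^sub>2, \<sigma>\<^sub>3\<close>, so \<open>X = Y = 0\<close>: the derivative preserves both summands;

  \<^item> the upper right block says \<open>P \<sigma>\<^sub>m - \<sigma>\<^sub>m N = \<Sum> \<Gamma>\<^sup>w\<^sub>m \<sigma>\<^sub>w\<close>. A real connection has real \<open>\<Gamma>\<close>, so the right hand side is
    Hermitian and \<open>P + N\<^sup>\<dagger>\<close> is a scalar matrix. By \<open>\<nabla>d = 0\<close> the traces of \<open>P\<close> and \<open>N\<close> vanish, so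
    \<open>N = - P\<^sup>\<dagger>\<close>: on the second summand the derivative is the one induced by \<open>P\<close>;

  \<^item> what remains, \<open>P \<sigma>\<^sub>m + \<sigma>\<^sub>m P\<^sup>\<dagger> = \<Sum> \<Gamma>\<^sup>w\<^sub>m \<sigma>\<^sub>w\<close> with \<open>tr P = 0\<close>, is \<open>\<nabla>G = 0\<close> for \<open>(\<Gamma>, P, cnj P)\<close>. It forces \<open>\<Gamma>\<close> to be
    skew with respect to the Minkowski metric, which is \<open>\<nabla>g = 0\<close>.

  This is \<open>dirac_connection_algebra\<close>. The relations \<open>X = Y = 0\<close> and \<open>N = - P\<^sup>\<dagger>\<close> are preserved by changes of the frame
  of \<open>SM\<close>, because the resulting transition matrices of \<open>DM\<close> are block diagonal with blocks \<open>Q\<close> and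
  \<open>(Q\<^sup>-\<^sup>1)\<^sup>\<dagger>\<close> (\<open>connection_blocks\<close>). Hence \<open>(\<Gamma>, P, cnj P)\<close>, computed in all frames, is a metric
  connection of \<open>SM\<close> (\<open>metric_connection_chiral_part\<close>) of which the given one is an extension
  (\<open>extension_chiral_part\<close>).

  Reality and extension are conditions on fields and sections defined on all of \<open>M\<close>, whereas the computation
  is local. Cut-off functions bridge this gap: they show that a real connection satisfies
  \<open>cnj \<Gamma> = \<Gamma>\<close> and \<open>conB = cnj A\<close> in every frame (\<open>real_connection_components\<close>), and that an extension has no
  freedom left, since the derivatives of global sections determine all spinor components
  (\<open>extension_unique\<close>). The fields \<open>d\<close>, \<open>\<gamma>\<close> and \<open>G\<close> are given by formulas in associated frames; that these define
  fields at all rests on the behaviour of Pauli matrices under \<open>SL(2,\<complex>)\<close>, \<open>lorentz_of_pauli\<close>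
  and \<open>adjugate_congruence\<close>.\<close>

section \<open>Calculus of smooth functions\<close>

lemma Ck_on_cong:
  assumes "open S" "\<And>x. x \<in> S \<Longrightarrow> f x = g x"
  shows "Ck_on k S f \<longleftrightarrow> Ck_on k S g"
proof -
  have "Ck_on k S f \<Longrightarrow> (\<forall>x\<in>S. f x = g x) \<Longrightarrow> Ck_on k S g" for f g :: "'a \<Rightarrow> 'b"
  proof (induction k arbitrary: f g)
    case 0
    then show ?case by (simp cong: continuous_on_cong)
  next
    case (Suc k)
    have d: "g differentiable at x \<and> frechet_derivative g (at x) = frechet_derivative f (at x)" if "x \<in> S" for x
    proof -
      have "f differentiable at x" using Suc.prems that by simp
      then have "(g has_derivative frechet_derivative f (at x)) (at x)"
        using Suc.prems(2) that
        by (auto simp: frechet_derivative_works intro: has_derivative_transform_within_open[OF _ \<open>open S\<close>])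
      then show ?thesis
        by (auto simp: differentiable_def dest: frechet_derivative_at)
    qed
    show ?case
      using Suc.prems(1) d by (auto intro: Suc.IH)
  qed
  then show ?thesis using assms(2) by (metis (full_types))
qed

lemma Ck_on_Suc_D: "Ck_on (Suc k) S f \<Longrightarrow> Ck_on k S f"
proof (induction k arbitrary: f)
  case 0
  then show ?case
    by (auto intro!: continuous_at_imp_continuous_on differentiable_imp_continuous_within)
qed simp

lemma Ck_on_subset: "Ck_on k S f \<Longrightarrow> T \<subseteq> S \<Longrightarrow> Ck_on k T f"
  by (induction k arbitrary: f) (auto intro: continuous_on_subset)

lemma Ck_on_local:
  assumes "\<And>x. x \<in> S \<Longrightarrow> \<exists>T. open T \<and> x \<in> T \<and> Ck_on k T f"
  shows "Ck_on k S f"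
  using assms
proof (induction k arbitrary: f)
  case 0
  have "isCont f x" if x: "x \<in> S" for x
    using 0[OF x] by (auto simp: continuous_on_eq_continuous_at)
  then show ?case by (auto intro: continuous_at_imp_continuous_on)
next
  case (Suc k)
  have "f differentiable at x" if "x \<in> S" for x
    using Suc.prems[OF that] by auto
  moreover have "Ck_on k S (\<lambda>x. frechet_derivative f (at x) v)" for v
  proof (rule Suc.IH)
    fix x assume "x \<in> S"
    then obtain T where "open T" "x \<in> T" "Ck_on (Suc k) T f" using Suc.prems by blast
    then show "\<exists>T. open T \<and> x \<in> T \<and> Ck_on k T (\<lambda>x. frechet_derivative f (at x) v)"
      by auto
  qed
  ultimately show ?case by simp
qed

lemma Ck_on_SucI:
  assumes "open S" "\<And>x. x \<in> S \<Longrightarrow> (f has_derivative f' x) (at x)" "\<And>v. Ck_on k S (\<lambda>x. f' x v)"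
  shows "Ck_on (Suc k) S f"
proof -
  have "f differentiable at x" "frechet_derivative f (at x) = f' x" if "x \<in> S" for x
    using assms(2)[OF that] by (auto simp: differentiable_def dest: frechet_derivative_at)
  moreover have "Ck_on k S (\<lambda>x. frechet_derivative f (at x) v)" for v
    using assms(3)[of v] calculation(2) by (subst Ck_on_cong[OF assms(1), where g="\<lambda>x. f' x v"]) auto
  ultimately show ?thesis by simp
qed

lemma Ck_on_has_derivative:
  "Ck_on (Suc k) S f \<Longrightarrow> x \<in> S \<Longrightarrow> (f has_derivative frechet_derivative f (at x)) (at x)"
  by (simp flip: frechet_derivative_works)

lemma Ck_on_const: "Ck_on k S (\<lambda>x. c)"
proof (induction k arbitrary: c)
  case (Suc k)
  then show ?case by (simp add: frechet_derivative_const)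
qed simp

lemma Ck_on_linear:
  assumes L: "bounded_linear L" and "open S"
  shows "Ck_on k S f \<Longrightarrow> Ck_on k S (\<lambda>x. L (f x))"
proof (induction k arbitrary: f)
  case 0
  then show ?case by (auto intro: bounded_linear.continuous_on[OF L])
next
  case (Suc k)
  show ?case
  proof (rule Ck_on_SucI[OF \<open>open S\<close>])
    show "((\<lambda>x. L (f x)) has_derivative (\<lambda>v. L (frechet_derivative f (at x) v))) (at x)" if "x \<in> S" for x
      using Ck_on_has_derivative[OF Suc.prems that] by (rule bounded_linear.has_derivative[OF L])
    show "Ck_on k S (\<lambda>x. L (frechet_derivative f (at x) v))" for v
      using Suc by simp
  qed
qed

lemma Ck_on_id: "open S \<Longrightarrow> Ck_on k S (\<lambda>x. x)"
  by (cases k) (auto intro!: Ck_on_SucI Ck_on_const has_derivative_ident)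

lemma Ck_on_add:
  assumes "open S" shows "Ck_on k S f \<Longrightarrow> Ck_on k S g \<Longrightarrow> Ck_on k S (\<lambda>x. f x + g x)"
proof (induction k arbitrary: f g)
  case 0
  then show ?case by (auto intro: continuous_on_add)
next
  case (Suc k)
  show ?case
    by (rule Ck_on_SucI[OF \<open>open S\<close> has_derivative_add[OF Ck_on_has_derivative[OF Suc.prems(1)] Ck_on_has_derivative[OF Suc.prems(2)]]])
      (use Suc in auto)
qed

lemma Ck_on_sum:
  assumes "open S" "\<And>i. i \<in> I \<Longrightarrow> Ck_on k S (f i)"
  shows "Ck_on k S (\<lambda>x. \<Sum>i\<in>I. f i x)"
proof (cases "finite I")
  case True
  then show ?thesis using assms(2)
    by (induction I rule: finite_induct) (auto intro!: Ck_on_const Ck_on_add[OF \<open>open S\<close>])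
qed (simp add: Ck_on_const)

lemma Ck_on_bilinear:
  assumes h: "bounded_bilinear h" and "open S"
  shows "Ck_on k S f \<Longrightarrow> Ck_on k S g \<Longrightarrow> Ck_on k S (\<lambda>x. h (f x) (g x))"
proof (induction k arbitrary: f g)
  case 0
  then show ?case by (auto intro: bounded_bilinear.continuous_on[OF h])
next
  case (Suc k)
  show ?case
  proof (rule Ck_on_SucI[OF \<open>open S\<close> bounded_bilinear.FDERIV[OF h Ck_on_has_derivative[OF Suc.prems(1)] Ck_on_has_derivative[OF Suc.prems(2)]]])
    show "Ck_on k S (\<lambda>x. h (f x) (frechet_derivative g (at x) v) + h (frechet_derivative f (at x) v) (g x))" for v
      using Suc.prems by (intro Ck_on_add[OF \<open>open S\<close>] Suc.IH) (auto dest: Ck_on_Suc_D simp del: Ck_on.simps, auto)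
  qed
qed

lemmas Ck_on_mult = Ck_on_bilinear[OF bounded_bilinear_mult]
lemmas Ck_on_scaleR = Ck_on_bilinear[OF bounded_bilinear_scaleR]

lemma Ck_on_inverse:
  fixes f :: "'a::real_normed_vector \<Rightarrow> 'b::real_normed_field"
  assumes "open S" and nz: "\<And>x. x \<in> S \<Longrightarrow> f x \<noteq> 0"
  shows "Ck_on k S f \<Longrightarrow> Ck_on k S (\<lambda>x. inverse (f x))"
proof (induction k)
  case 0
  then show ?case using nz by (auto intro: continuous_on_inverse)
next
  case (Suc k)
  have "Ck_on k S (\<lambda>x. (-1) * (inverse (f x) * frechet_derivative f (at x) v * inverse (f x)))" for v
    using Suc.IH Suc.prems Ck_on_Suc_D[OF Suc.prems] by (intro Ck_on_mult \<open>open S\<close> Ck_on_const) auto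
  then show ?case
    by (intro Ck_on_SucI[OF \<open>open S\<close> Deriv.has_derivative_inverse[OF nz Ck_on_has_derivative[OF Suc.prems]]]) simp_all
qed

text \<open>The chain rule expresses the derivative of a composition through the partial derivatives of the
  outer function, so that the induction only meets products and compositions of lower order.\<close>

lemma Ck_on_compose:
  fixes g :: "'a::real_normed_vector \<Rightarrow> 'b::euclidean_space" and f :: "'b \<Rightarrow> 'c::real_normed_vector"
  assumes "open S"
  shows "Ck_on k T f \<Longrightarrow> Ck_on k S g \<Longrightarrow> g ` S \<subseteq> T \<Longrightarrow> Ck_on k S (\<lambda>x. f (g x))"
proof (induction k arbitrary: f)
  case 0
  then show ?case by (auto intro: continuous_on_compose2)
next
  case (Suc k)
  let ?f' = "\<lambda>x. frechet_derivative f (at (g x))" and ?g' = "\<lambda>x. frechet_derivative g (at x)"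
  have f': "(f has_derivative ?f' x) (at (g x))" if "x \<in> S" for x
    using Ck_on_has_derivative[OF Suc.prems(1)] Suc.prems(3) that by blast
  have exp: "?f' x w = (\<Sum>b\<in>Basis. (w \<bullet> b) *\<^sub>R ?f' x b)" if "x \<in> S" for x w
  proof -
    interpret bounded_linear "?f' x" using f'[OF that] by (rule has_derivative_bounded_linear)
    have "?f' x w = ?f' x (\<Sum>b\<in>Basis. (w \<bullet> b) *\<^sub>R b)" by (simp add: euclidean_representation)
    then show ?thesis by (simp add: sum scaleR)
  qed
  show ?case
  proof (rule Ck_on_SucI[OF \<open>open S\<close>])
    show "((\<lambda>x. f (g x)) has_derivative (\<lambda>v. ?f' x (?g' x v))) (at x)" if "x \<in> S" for x
      using has_derivative_compose[OF Ck_on_has_derivative[OF Suc.prems(2) that] f'[OF that]] .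
    fix v
    have "Ck_on k S (\<lambda>x. (\<Sum>b\<in>Basis. (?g' x v \<bullet> b) *\<^sub>R ?f' x b))"
      using Suc.prems Ck_on_Suc_D[OF Suc.prems(2)]
      by (intro Ck_on_sum Ck_on_scaleR Ck_on_linear[OF bounded_linear_inner_left] Suc.IH \<open>open S\<close>) auto
    then show "Ck_on k S (\<lambda>x. ?f' x (?g' x v))"
      by (subst Ck_on_cong[OF \<open>open S\<close>]) (auto intro: exp)
  qed
qed

text \<open>The functions \<open>t\<^sup>-\<^sup>n exp (-1/t)\<close>, extended by \<open>0\<close>, span a space closed under differentiation.\<close>

definition flat :: "nat \<Rightarrow> real \<Rightarrow> real" where
  "flat n t = (if t > 0 then exp (- inverse t) * inverse t ^ n else 0)"

lemma flat_has_real_derivative: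
  "(flat n has_real_derivative flat (n + 2) t - real n * flat (n + 1) t) (at t)"
proof -
  consider "t > 0" | "t < 0" | "t = 0" by linarith
  then show ?thesis
  proof cases
    case 1
    have "((\<lambda>t. exp (- inverse t) * inverse t ^ n) has_real_derivative flat (n + 2) t - real n * flat (n + 1) t) (at t)"
      using 1 by (auto intro!: derivative_eq_intros simp: flat_def power2_eq_square algebra_simps)
        (cases n; simp add: algebra_simps)
    then show ?thesis
      by (rule has_field_derivative_transform_within_open[where S="{0<..}"]) (use 1 in \<open>auto simp: flat_def\<close>)
  next
    case 2
    have "((\<lambda>t. 0) has_real_derivative flat (n + 2) t - real n * flat (n + 1) t) (at t)"
      using 2 by (simp add: flat_def)
    then show ?thesis
      by (rule has_field_derivative_transform_within_open[where S="{..<0}"]) (use 2 in \<open>auto simp: flat_def\<close>)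
  next
    case 3
    have "((\<lambda>h. flat n h / h) \<longlongrightarrow> 0) (at_left 0)"
      by (rule tendsto_eventually) (auto simp: flat_def eventually_at_filter)
    moreover have "((\<lambda>h. flat n h / h) \<longlongrightarrow> 0) (at_right 0)"
    proof -
      have "((\<lambda>x::real. x ^ (n + 1) / exp x) \<longlongrightarrow> 0) at_top"
        by (rule tendsto_power_div_exp_0)
      then have "((\<lambda>h::real. inverse h ^ (n + 1) / exp (inverse h)) \<longlongrightarrow> 0) (at_right 0)"
        by (rule filterlim_compose[OF _ filterlim_inverse_at_top_right])
      then show ?thesis
        by (rule Lim_transform_eventually)
          (auto simp: flat_def eventually_at_filter exp_minus divide_inverse)
    qed
    ultimately have "((\<lambda>h. flat n h / h) \<longlongrightarrow> 0) (at 0)"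
      by (simp add: filterlim_split_at)
    then show ?thesis
      using 3 by (simp add: DERIV_def flat_def)
  qed
qed

lemma Ck_on_flat: "Ck_on k UNIV (flat n)"
proof (induction k arbitrary: n)
  case 0
  have "isCont (flat n) t" for t by (rule DERIV_isCont[OF flat_has_real_derivative])
  then show ?case by (simp add: continuous_at_imp_continuous_on)
next
  case (Suc k)
  have "Ck_on k UNIV (\<lambda>x. (flat (n + 2) x + (- real n) * flat (n + 1) x) * v)" for v
    by (intro Ck_on_mult Ck_on_add Suc.IH Ck_on_const open_UNIV)
  then show ?case
    by (intro Ck_on_SucI[OF open_UNIV has_field_derivative_imp_has_derivative[OF flat_has_real_derivative]]) simp_all
qed

lemma Ck_on_vec:
  assumes "open S" "\<And>i. Ck_on k S (\<lambda>x. f x $ i)"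
  shows "Ck_on k S (f :: _ \<Rightarrow> ('b::euclidean_space)^'n::finite)"
proof -
  have lin: "bounded_linear (\<lambda>c. axis i c :: 'b^'n)" for i
    by (rule linear_conv_bounded_linear[THEN iffD1], rule linearI) (auto simp: axis_def vec_eq_iff)
  have "Ck_on k S (\<lambda>x. \<Sum>i\<in>UNIV. axis i (f x $ i))"
    by (intro Ck_on_sum Ck_on_linear[OF lin] assms)
  moreover have "(\<Sum>i\<in>UNIV. axis i (f x $ i)) = f x" for x
    by (simp add: vec_eq_iff axis_def sum.delta if_distrib cong: if_cong)
  ultimately show ?thesis by simp
qed

section \<open>Smooth functions and tangent vectors on a manifold\<close>

locale smooth_manifold =
  fixes A :: "'m::{t2_space,second_countable_topology} chart set"
  assumes atlas: "oriented_atlas A"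
begin

lemma chartD:
  assumes "(V,\<phi>) \<in> A"
  shows "open V" "open (\<phi> ` V)" "continuous_on V \<phi>" "continuous_on (\<phi> ` V) (inv_into V \<phi>)"
    "q \<in> V \<Longrightarrow> inv_into V \<phi> (\<phi> q) = q" "inj_on \<phi> V"
proof -
  have h: "open V \<and> open (\<phi> ` V) \<and> homeomorphism V (\<phi> ` V) \<phi> (inv_into V \<phi>)"
    using atlas assms unfolding oriented_atlas_def by fast
  then show "open V" "open (\<phi> ` V)" "continuous_on V \<phi>" "continuous_on (\<phi> ` V) (inv_into V \<phi>)"
    "q \<in> V \<Longrightarrow> inv_into V \<phi> (\<phi> q) = q"
    by (auto simp: homeomorphism_def)
  show "inj_on \<phi> V" using h by (auto simp: homeomorphism_def intro: inj_on_inverseI)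
qed

lemma chart_at: obtains V \<phi> where "(V,\<phi>) \<in> A" "p \<in> V"
proof -
  have "p \<in> (\<Union>(U,\<phi>)\<in>A. U)" using atlas unfolding oriented_atlas_def by simp
  then show thesis using that by auto
qed

lemma open_chart_image:
  assumes "(V,\<phi>) \<in> A" "open U"
  shows "open (\<phi> ` (U \<inter> V))"
proof -
  have "\<phi> ` (U \<inter> V) = \<phi> ` V \<inter> inv_into V \<phi> -` U"
    using chartD(5)[OF assms(1)] by (force simp: image_iff)
  then show ?thesis
    using continuous_open_preimage[OF chartD(4,2)[OF assms(1)] assms(2)] by simp
qed

lemma transition_smooth:
  "(V,\<phi>) \<in> A \<Longrightarrow> (W,\<psi>) \<in> A \<Longrightarrow> Cinf_on (\<phi> ` (V \<inter> W)) (\<psi> \<circ> inv_into V \<phi>)"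
  using atlas unfolding oriented_atlas_def by fast

lemma smooth_fun_iff:
  "smooth_fun A U f \<longleftrightarrow> (\<forall>V \<phi> k. (V,\<phi>) \<in> A \<longrightarrow> Ck_on k (\<phi> ` (U \<inter> V)) (\<lambda>x. f (inv_into V \<phi> x)))"
  unfolding smooth_fun_def Cinf_on_def comp_def by auto

lemma smooth_fun_cong:
  assumes "open U" "\<And>p. p \<in> U \<Longrightarrow> f p = g p"
  shows "smooth_fun A U f \<longleftrightarrow> smooth_fun A U g"
proof -
  have "Ck_on k (\<phi> ` (U \<inter> V)) (\<lambda>x. f (inv_into V \<phi> x)) \<longleftrightarrow> Ck_on k (\<phi> ` (U \<inter> V)) (\<lambda>x. g (inv_into V \<phi> x))"
    if "(V,\<phi>) \<in> A" for V \<phi> k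
    by (rule Ck_on_cong[OF open_chart_image[OF that assms(1)]]) (use chartD(5)[OF that] assms(2) in auto)
  then show ?thesis unfolding smooth_fun_iff by blast
qed

lemma smooth_fun_subset: "smooth_fun A U f \<Longrightarrow> V \<subseteq> U \<Longrightarrow> smooth_fun A V f"
  unfolding smooth_fun_iff by (meson Ck_on_subset Int_mono image_mono order_refl)

lemma smooth_fun_local:
  assumes "\<And>p. p \<in> U \<Longrightarrow> \<exists>W. open W \<and> p \<in> W \<and> smooth_fun A W f"
  shows "smooth_fun A U f"
  unfolding smooth_fun_iff
proof (intro allI impI)
  fix V \<phi> k assume c: "(V,\<phi>) \<in> A"
  show "Ck_on k (\<phi> ` (U \<inter> V)) (\<lambda>x. f (inv_into V \<phi> x))"
  proof (rule Ck_on_local)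
    fix x assume "x \<in> \<phi> ` (U \<inter> V)"
    then obtain p where p: "p \<in> U" "p \<in> V" "x = \<phi> p" by auto
    then obtain W where "open W" "p \<in> W" "smooth_fun A W f" using assms by blast
    then show "\<exists>T. open T \<and> x \<in> T \<and> Ck_on k T (\<lambda>x. f (inv_into V \<phi> x))"
      using c p by (intro exI[of _ "\<phi> ` (W \<inter> V)"]) (auto simp: smooth_fun_iff intro: open_chart_image)
  qed
qed

lemma smooth_const: "smooth_fun A U (\<lambda>p. c)"
  by (simp add: smooth_fun_iff Ck_on_const)

lemma smooth_linear: "bounded_linear L \<Longrightarrow> open U \<Longrightarrow> smooth_fun A U f \<Longrightarrow> smooth_fun A U (\<lambda>p. L (f p))"
  unfolding smooth_fun_iff by (auto intro: Ck_on_linear[of L] open_chart_image)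

lemma smooth_mult:
  fixes f g :: "'m \<Rightarrow> 'a::real_normed_algebra"
  shows "open U \<Longrightarrow> smooth_fun A U f \<Longrightarrow> smooth_fun A U g \<Longrightarrow> smooth_fun A U (\<lambda>p. f p * g p)"
  by (simp add: smooth_fun_iff Ck_on_mult open_chart_image)

lemma smooth_inverse:
  fixes f :: "'m \<Rightarrow> 'a::real_normed_field"
  assumes "open U" "smooth_fun A U f" "\<And>p. p \<in> U \<Longrightarrow> f p \<noteq> 0"
  shows "smooth_fun A U (\<lambda>p. inverse (f p))"
  using assms unfolding smooth_fun_iff
  by (auto intro!: Ck_on_inverse open_chart_image dest: chartD(5))

lemma smooth_sum:
  "open U \<Longrightarrow> (\<And>i. i \<in> I \<Longrightarrow> smooth_fun A U (f i)) \<Longrightarrow> smooth_fun A U (\<lambda>p. \<Sum>i\<in>I. f i p)"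
  by (simp add: smooth_fun_iff Ck_on_sum open_chart_image)

lemma smooth_prod:
  fixes f :: "'i \<Rightarrow> 'm \<Rightarrow> 'a::real_normed_field"
  assumes "open U" "\<And>i. i \<in> I \<Longrightarrow> smooth_fun A U (f i)"
  shows "smooth_fun A U (\<lambda>p. \<Prod>i\<in>I. f i p)"
proof (cases "finite I")
  case True
  then show ?thesis using assms(2)
    by (induction I rule: finite_induct) (auto intro!: smooth_const smooth_mult[OF \<open>open U\<close>])
qed (simp add: smooth_const)

lemma smooth_vec:
  fixes f :: "'m \<Rightarrow> 'a::euclidean_space^'n::finite"
  shows "open U \<Longrightarrow> (\<And>i. smooth_fun A U (\<lambda>p. f p $ i)) \<Longrightarrow> smooth_fun A U f"
  by (simp add: smooth_fun_iff Ck_on_vec open_chart_image)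

lemma smooth_nth:
  fixes f :: "'m \<Rightarrow> 'a::euclidean_space^'n::finite"
  shows "open U \<Longrightarrow> smooth_fun A U f \<Longrightarrow> smooth_fun A U (\<lambda>p. f p $ i)"
  by (rule smooth_linear[OF bounded_linear_vec_nth])

lemma smooth_cnj: "open U \<Longrightarrow> smooth_fun A U f \<Longrightarrow> smooth_fun A U (\<lambda>p. cnj (f p))"
  by (rule smooth_linear[OF bounded_linear_cnj])

lemma smooth_of_real: "open U \<Longrightarrow> smooth_fun A U f \<Longrightarrow> smooth_fun A U (\<lambda>p. complex_of_real (f p))"
  by (rule smooth_linear[OF bounded_linear_of_real])

lemma smooth_det:
  fixes M :: "'m \<Rightarrow> 'a::real_normed_field^'n::finite^'n"
  shows "open U \<Longrightarrow> (\<And>i j. smooth_fun A U (\<lambda>p. M p $ i $ j)) \<Longrightarrow> smooth_fun A U (\<lambda>p. det (M p))"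
  unfolding det_def by (intro smooth_sum smooth_mult smooth_prod smooth_const) auto

text \<open>Functions given in one chart by a smooth function of the coordinates are smooth in all charts.\<close>

lemma smooth_fun_of_chart:
  assumes c: "(V,\<phi>) \<in> A" and U: "open U" "U \<subseteq> V" and G: "Cinf_on (\<phi> ` U) G"
  shows "smooth_fun A U (\<lambda>p. G (\<phi> p))"
  unfolding smooth_fun_iff
proof (intro allI impI)
  fix W \<psi> k assume d: "(W,\<psi>) \<in> A"
  show "Ck_on k (\<psi> ` (U \<inter> W)) (\<lambda>x. G (\<phi> (inv_into W \<psi> x)))"
  proof (rule Ck_on_compose[where T="\<phi> ` U"])
    show "open (\<psi> ` (U \<inter> W))" by (rule open_chart_image[OF d U(1)])
    show "Ck_on k (\<phi> ` U) G" using G by (simp add: Cinf_on_def)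
    show "Ck_on k (\<psi> ` (U \<inter> W)) (\<lambda>x. \<phi> (inv_into W \<psi> x))"
      using transition_smooth[OF d c] U(2)
      by (auto simp: Cinf_on_def comp_def intro: Ck_on_subset)
    show "(\<lambda>x. \<phi> (inv_into W \<psi> x)) ` \<psi> ` (U \<inter> W) \<subseteq> \<phi> ` U"
      using chartD(5)[OF d] by auto
  qed
qed

text \<open>A cut-off function without a plateau: it is used to test identities that are linear in a field and its
  first derivatives, and there a nonzero value at the point suffices.\<close>

lemma bump_function:
  assumes U: "open U" "p \<in> U"
  obtains b :: "'m \<Rightarrow> real" and K where
    "smooth_fun A UNIV b" "b p \<noteq> 0" "closed K" "K \<subseteq> U" "\<And>q. q \<notin> K \<Longrightarrow> b q = 0"
proof -
  obtain V \<phi> where c: "(V,\<phi>) \<in> A" "p \<in> V" using chart_at .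
  have op: "open (\<phi> ` (U \<inter> V))" by (rule open_chart_image[OF c(1) U(1)])
  moreover have "\<phi> p \<in> \<phi> ` (U \<inter> V)" using U(2) c(2) by blast
  ultimately obtain r where r: "r > 0" "cball (\<phi> p) r \<subseteq> \<phi> ` (U \<inter> V)"
    by (meson open_contains_cball)
  define u where "u x = r\<^sup>2 - (x - \<phi> p) \<bullet> (x - \<phi> p)" for x
  define b where "b q = (if q \<in> V then flat 0 (u (\<phi> q)) else 0)" for q
  define K where "K = inv_into V \<phi> ` cball (\<phi> p) r"
  have "compact K" unfolding K_def using r(2)
    by (intro compact_continuous_image continuous_on_subset[OF chartD(4)[OF c(1)]]) auto
  then have K: "closed K" by (rule compact_imp_closed)
  have KU: "K \<subseteq> U \<inter> V" unfolding K_def using r(2) chartD(5)[OF c(1)] by force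
  have b0: "b q = 0" if "q \<notin> K" for q
  proof (cases "q \<in> V")
    case True
    have "\<phi> q \<notin> cball (\<phi> p) r"
      using that True chartD(5)[OF c(1) True] unfolding K_def by (metis imageI)
    then have "r < norm (\<phi> q - \<phi> p)" by (simp add: dist_norm norm_minus_commute)
    then have "r\<^sup>2 < (norm (\<phi> q - \<phi> p))\<^sup>2" using r(1) by (intro power_strict_mono) auto
    then show ?thesis by (simp add: b_def u_def flat_def power2_norm_eq_inner)
  qed (simp add: b_def)
  have "Ck_on k UNIV (\<lambda>x. flat 0 (u x))" for k
  proof (rule Ck_on_compose[OF open_UNIV Ck_on_flat])
    have "Ck_on k UNIV (\<lambda>x. r\<^sup>2 + (-1) * ((x + (- \<phi> p)) \<bullet> (x + (- \<phi> p))))"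
      by (intro Ck_on_add Ck_on_mult Ck_on_const Ck_on_id Ck_on_bilinear[OF bounded_bilinear_inner] open_UNIV)
    then show "Ck_on k UNIV u" by (simp add: u_def[abs_def])
  qed auto
  then have "Cinf_on (\<phi> ` V) (\<lambda>x. flat 0 (u x))"
    by (auto simp: Cinf_on_def intro: Ck_on_subset)
  then have "smooth_fun A V (\<lambda>q. flat 0 (u (\<phi> q)))"
    by (intro smooth_fun_of_chart[OF c(1)] chartD(1)[OF c(1)]) auto
  then have s1: "smooth_fun A V b"
    by (subst smooth_fun_cong[OF chartD(1)[OF c(1)], where g="\<lambda>q. flat 0 (u (\<phi> q))"]) (auto simp: b_def)
  have s2: "smooth_fun A (- K) b"
    using K b0 smooth_const[of "-K" 0]
    by (subst smooth_fun_cong[where g="\<lambda>_. 0"]) auto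
  have "smooth_fun A UNIV b"
  proof (rule smooth_fun_local)
    fix q show "\<exists>W. open W \<and> q \<in> W \<and> smooth_fun A W b"
      using s1 s2 K KU chartD(1)[OF c(1)] by (cases "q \<in> V") (blast, blast)
  qed
  moreover have "b p \<noteq> 0" using c r by (simp add: b_def u_def flat_def)
  ultimately show thesis using that K KU b0 by blast
qed


subsection \<open>Differentiability at a point and derivations\<close>

text \<open>Tangent vectors give \<open>0\<close> on functions that are not differentiable at the point. Hence they are additive
  and satisfy the Leibniz rule only on functions with this property; it can be checked in a
  single chart (\<open>differentiable_at_iff\<close>).\<close>

definition differentiable_at :: "'m \<Rightarrow> ('m \<Rightarrow> 'a::real_normed_vector) \<Rightarrow> bool" where
  "differentiable_at p f \<longleftrightarrow>
     (\<forall>V \<phi>. (V,\<phi>) \<in> A \<longrightarrow> p \<in> V \<longrightarrow> (\<lambda>x. f (inv_into V \<phi> x)) differentiable (at (\<phi> p)))"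

lemma chart_change:
  assumes c: "(V,\<phi>) \<in> A" "p \<in> V" and d: "(W,\<psi>) \<in> A" "p \<in> W"
    and f: "((\<lambda>x. f (inv_into V \<phi> x)) has_derivative D) (at (\<phi> p))"
  shows "((\<lambda>x. f (inv_into W \<psi> x)) has_derivative
           (\<lambda>w. D (frechet_derivative (\<phi> \<circ> inv_into W \<psi>) (at (\<psi> p)) w))) (at (\<psi> p))"
proof -
  let ?k = "\<phi> \<circ> inv_into W \<psi>"
  have "Ck_on 1 (\<psi> ` (W \<inter> V)) ?k" using transition_smooth[OF d(1) c(1)] by (simp add: Cinf_on_def)
  then have k: "(?k has_derivative frechet_derivative ?k (at (\<psi> p))) (at (\<psi> p))"
    using c d by (simp add: frechet_derivative_works[symmetric])
  have kp: "?k (\<psi> p) = \<phi> p" using chartD(5)[OF d] by simp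
  have "((\<lambda>x. f (inv_into V \<phi> (?k x))) has_derivative (\<lambda>w. D (frechet_derivative ?k (at (\<psi> p)) w))) (at (\<psi> p))"
    by (rule has_derivative_compose[OF k]) (simp only: kp f)
  moreover have "open (\<psi> ` (V \<inter> W))" "\<psi> p \<in> \<psi> ` (V \<inter> W)"
    using c d chartD(1)[OF c(1)] by (auto intro: open_chart_image)
  ultimately show ?thesis
    by (rule has_derivative_transform_within_open) (use chartD(5)[OF c(1)] chartD(5)[OF d(1)] in auto)
qed

lemma differentiable_at_iff:
  assumes "(V,\<phi>) \<in> A" "p \<in> V"
  shows "differentiable_at p f \<longleftrightarrow> (\<lambda>x. f (inv_into V \<phi> x)) differentiable (at (\<phi> p))"
proof
  show "(\<lambda>x. f (inv_into V \<phi> x)) differentiable (at (\<phi> p))" if "differentiable_at p f"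
    using that assms unfolding differentiable_at_def by blast
  show "differentiable_at p f" if "(\<lambda>x. f (inv_into V \<phi> x)) differentiable (at (\<phi> p))"
    using that chart_change[OF assms, of _ _ f] unfolding differentiable_at_def differentiable_def by blast
qed

lemma smooth_imp_differentiable_at:
  assumes "smooth_fun A U f" "p \<in> U"
  shows "differentiable_at p f"
  unfolding differentiable_at_def
proof (intro allI impI)
  fix V \<phi> assume c: "(V,\<phi>) \<in> A" "p \<in> V"
  then have "Ck_on (Suc 0) (\<phi> ` (U \<inter> V)) (\<lambda>x. f (inv_into V \<phi> x))"
    using assms(1) unfolding smooth_fun_iff by blast
  then show "(\<lambda>x. f (inv_into V \<phi> x)) differentiable (at (\<phi> p))"
    using c assms(2) by auto
qed

lemma differentiable_at_const: "differentiable_at p (\<lambda>q. c)"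
  by (simp add: differentiable_at_def)

lemma differentiable_at_add:
  "differentiable_at p f \<Longrightarrow> differentiable_at p g \<Longrightarrow> differentiable_at p (\<lambda>q. f q + g q)"
  by (simp add: differentiable_at_def)

lemma differentiable_at_mult:
  fixes f g :: "'m \<Rightarrow> 'a::real_normed_algebra"
  shows "differentiable_at p f \<Longrightarrow> differentiable_at p g \<Longrightarrow> differentiable_at p (\<lambda>q. f q * g q)"
  by (simp add: differentiable_at_def differentiable_mult)

lemma dir_deriv_eq:
  assumes "(V,\<phi>) \<in> A" "p \<in> V"
  shows "dir_deriv (V,\<phi>) p w f = (if differentiable_at p f
     then frechet_derivative (\<lambda>x. f (inv_into V \<phi> x)) (at (\<phi> p)) w else 0)"
  unfolding dir_deriv_def differentiable_at_iff[OF assms] by (simp add: comp_def)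

lemma dir_deriv_chart_change:
  assumes "(V,\<phi>) \<in> A" "p \<in> V" "(W,\<psi>) \<in> A" "p \<in> W"
  shows "dir_deriv (W,\<psi>) p w = dir_deriv (V,\<phi>) p (frechet_derivative (\<phi> \<circ> inv_into W \<psi>) (at (\<psi> p)) w)"
proof
  fix f
  show "dir_deriv (W,\<psi>) p w f =
    dir_deriv (V,\<phi>) p (frechet_derivative (\<phi> \<circ> inv_into W \<psi>) (at (\<psi> p)) w) f"
  proof (cases "differentiable_at p f")
    case True
    then have "((\<lambda>x. f (inv_into V \<phi> x)) has_derivative
        frechet_derivative (\<lambda>x. f (inv_into V \<phi> x)) (at (\<phi> p))) (at (\<phi> p))"
      using differentiable_at_iff[OF assms(1,2)] frechet_derivative_works by blast
    from chart_change[OF assms this] show ?thesis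
      using True by (simp add: dir_deriv_eq[OF assms(1,2)] dir_deriv_eq[OF assms(3,4)] frechet_derivative_at[symmetric])
  qed (simp add: dir_deriv_eq[OF assms(1,2)] dir_deriv_eq[OF assms(3,4)])
qed

text \<open>A derivative in one chart is a derivative in any other, along the direction transformed by the
  Jacobian of the transition map.\<close>

lemma tangent_eq:
  assumes "(V,\<phi>) \<in> A" "p \<in> V"
  shows "tangent A p = range (dir_deriv (V,\<phi>) p)"
proof
  show "range (dir_deriv (V,\<phi>) p) \<subseteq> tangent A p"
    using assms unfolding tangent_def by force
  show "tangent A p \<subseteq> range (dir_deriv (V,\<phi>) p)"
    unfolding tangent_def using dir_deriv_chart_change[OF assms] by auto
qed

lemma dir_deriv_add: "(V,\<phi>) \<in> A \<Longrightarrow> p \<in> V \<Longrightarrow>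
    dir_deriv (V,\<phi>) p (w + w') = dir_deriv (V,\<phi>) p w + dir_deriv (V,\<phi>) p w'"
  and dir_deriv_scale: "(V,\<phi>) \<in> A \<Longrightarrow> p \<in> V \<Longrightarrow>
    dir_deriv (V,\<phi>) p (c *s w) = fscale c (dir_deriv (V,\<phi>) p w)"
proof -
  assume c: "(V,\<phi>) \<in> A" "p \<in> V"
  have lin: "linear (frechet_derivative (\<lambda>x. f (inv_into V \<phi> x)) (at (\<phi> p)))"
    if "differentiable_at p f" for f :: "'m \<Rightarrow> real"
    using that differentiable_at_iff[OF c] by (auto intro: linear_frechet_derivative)
  show "dir_deriv (V,\<phi>) p (w + w') = dir_deriv (V,\<phi>) p w + dir_deriv (V,\<phi>) p w'"
    by (rule ext) (auto simp: dir_deriv_eq[OF c] linear_add[OF lin])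
  have "dir_deriv (V,\<phi>) p (c *\<^sub>R w) = fscale c (dir_deriv (V,\<phi>) p w)"
    by (rule ext) (auto simp: dir_deriv_eq[OF c] linear_scale[OF lin] fscale_def)
  then show "dir_deriv (V,\<phi>) p (c *s w) = fscale c (dir_deriv (V,\<phi>) p w)"
    by (simp add: scalar_mult_eq_scaleR)
qed

lemma dir_deriv_coordinate:
  assumes c: "(V,\<phi>) \<in> A" "p \<in> V"
  shows "dir_deriv (V,\<phi>) p w (\<lambda>q. \<phi> q $ k) = w $ k"
proof -
  have "((\<lambda>x. x $ k) has_derivative (\<lambda>w. w $ k)) (at (\<phi> p))"
    by (rule bounded_linear.has_derivative[OF bounded_linear_vec_nth has_derivative_ident])
  then have "((\<lambda>x. \<phi> (inv_into V \<phi> x) $ k) has_derivative (\<lambda>w. w $ k)) (at (\<phi> p))"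
    by (rule has_derivative_transform_within_open[OF _ chartD(2)[OF c(1)]]) (use c chartD(5)[OF c(1)] in auto)
  then show ?thesis
    unfolding dir_deriv_eq[OF c] using differentiable_at_iff[OF c, of "\<lambda>q. \<phi> q $ k"]
    by (auto simp: differentiable_def frechet_derivative_at[symmetric])
qed

lemma tangent_local:
  assumes v: "v \<in> tangent A p" and U: "open U" "p \<in> U" "\<And>q. q \<in> U \<Longrightarrow> f q = g q"
  shows "v f = v g"
proof -
  obtain V \<phi> where c: "(V,\<phi>) \<in> A" "p \<in> V" using chart_at .
  obtain w where w: "v = dir_deriv (V,\<phi>) p w" using v tangent_eq[OF c] by auto
  have "((\<lambda>x. f (inv_into V \<phi> x)) has_derivative D) (at (\<phi> p)) \<longleftrightarrow>
        ((\<lambda>x. g (inv_into V \<phi> x)) has_derivative D) (at (\<phi> p))" for D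
  proof -
    have o: "open (\<phi> ` (U \<inter> V))" "\<phi> p \<in> \<phi> ` (U \<inter> V)" using open_chart_image[OF c(1) U(1)] U(2) c by auto
    show ?thesis
      by (intro iffI; erule has_derivative_transform_within_open[OF _ o]) (use U(3) chartD(5)[OF c(1)] in auto)
  qed
  then show ?thesis
    unfolding w dir_deriv_eq[OF c] differentiable_at_iff[OF c] differentiable_def frechet_derivative_def by simp
qed

lemma tangent_const: "v \<in> tangent A p \<Longrightarrow> v (\<lambda>q. c) = 0"
proof -
  assume v: "v \<in> tangent A p"
  obtain V \<phi> where c: "(V,\<phi>) \<in> A" "p \<in> V" using chart_at .
  show ?thesis using v unfolding tangent_eq[OF c] by (auto simp: dir_deriv_eq[OF c] frechet_derivative_const)
qed

text \<open>\<open>f\<close> and \<open>- f\<close> are differentiable at the same points, and where they are not both sides are \<open>0\<close>. This is what makes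
  \<open>lie\<close> commute with complex conjugation on arbitrary functions (\<open>lie_cnj\<close>).\<close>

lemma tangent_minus: "v \<in> tangent A p \<Longrightarrow> v (\<lambda>q. - f q) = - v f"
proof -
  assume v: "v \<in> tangent A p"
  obtain V \<phi> where c: "(V,\<phi>) \<in> A" "p \<in> V" using chart_at .
  obtain w where w: "v = dir_deriv (V,\<phi>) p w" using v tangent_eq[OF c] by auto
  have e: "((\<lambda>x. - h (inv_into V \<phi> x)) has_derivative (\<lambda>w. - D w)) (at (\<phi> p))"
    if "((\<lambda>x. h (inv_into V \<phi> x)) has_derivative D) (at (\<phi> p))" for h :: "'m \<Rightarrow> real" and D
    using that by (rule has_derivative_minus)
  have "differentiable_at p (\<lambda>q. - f q) \<longleftrightarrow> differentiable_at p f"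
    unfolding differentiable_at_iff[OF c] differentiable_def using e[of f] e[of "\<lambda>q. - f q"] unfolding minus_minus by blast
  moreover have "frechet_derivative (\<lambda>x. - f (inv_into V \<phi> x)) (at (\<phi> p)) =
     (\<lambda>w. - frechet_derivative (\<lambda>x. f (inv_into V \<phi> x)) (at (\<phi> p)) w)" if "differentiable_at p f"
    using that e unfolding differentiable_at_iff[OF c] frechet_derivative_works
    by (metis frechet_derivative_at)
  ultimately show ?thesis unfolding w dir_deriv_eq[OF c] by auto
qed

lemma lie_local:
  assumes "v \<in> tangent A p" "open U" "p \<in> U" "\<And>q. q \<in> U \<Longrightarrow> f q = g q"
  shows "lie v f = lie v g"
  unfolding lie_def by (intro arg_cong2[of _ _ _ _ Complex]; rule tangent_local[OF assms(1-3)]) (simp_all add: assms(4))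

lemma lie_const: "v \<in> tangent A p \<Longrightarrow> lie v (\<lambda>q. c) = 0"
  by (simp add: lie_def tangent_const complex_eq_iff)

lemma lie_of_real: "v \<in> tangent A p \<Longrightarrow> lie v (\<lambda>q. complex_of_real (f q)) = of_real (v f)"
  by (simp add: lie_def tangent_const complex_eq_iff)

lemma lie_cnj: "v \<in> tangent A p \<Longrightarrow> lie v (\<lambda>q. cnj (f q)) = cnj (lie v f)"
  by (simp add: lie_def tangent_minus[where f="\<lambda>q. Im (f q)"] complex_eq_iff)

lemma lie_has_derivative:
  assumes c: "(V,\<phi>) \<in> A" "p \<in> V" and f: "((\<lambda>x. f (inv_into V \<phi> x)) has_derivative D) (at (\<phi> p))"
  shows "lie (dir_deriv (V,\<phi>) p w) f = D w"
proof -
  have "((\<lambda>x. Re (f (inv_into V \<phi> x))) has_derivative (\<lambda>w. Re (D w))) (at (\<phi> p))"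
    "((\<lambda>x. Im (f (inv_into V \<phi> x))) has_derivative (\<lambda>w. Im (D w))) (at (\<phi> p))"
    using f by (auto intro: bounded_linear.has_derivative[OF bounded_linear_Re]
        bounded_linear.has_derivative[OF bounded_linear_Im])
  then show ?thesis
    unfolding lie_def dir_deriv_eq[OF c] differentiable_at_iff[OF c]
    by (auto simp: differentiable_def frechet_derivative_at[symmetric] complex_eq_iff)
qed

lemma lie_derivation:
  assumes v: "v \<in> tangent A p" and f: "differentiable_at p f" and g: "differentiable_at p g"
  shows lie_add: "lie v (\<lambda>q. f q + g q) = lie v f + lie v g"
    and lie_mult: "lie v (\<lambda>q. f q * g q) = lie v f * g p + f p * lie v g"
proof -
  obtain V \<phi> where c: "(V,\<phi>) \<in> A" "p \<in> V" using chart_at .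
  obtain w where w: "v = dir_deriv (V,\<phi>) p w" using v tangent_eq[OF c] by auto
  obtain F G where "((\<lambda>x. f (inv_into V \<phi> x)) has_derivative F) (at (\<phi> p))"
    "((\<lambda>x. g (inv_into V \<phi> x)) has_derivative G) (at (\<phi> p))"
    using f g unfolding differentiable_at_iff[OF c] differentiable_def by auto
  note F = this
  show "lie v (\<lambda>q. f q + g q) = lie v f + lie v g"
    unfolding w lie_has_derivative[OF c F(1)] lie_has_derivative[OF c F(2)]
    by (rule lie_has_derivative[OF c has_derivative_add[OF F]])
  show "lie v (\<lambda>q. f q * g q) = lie v f * g p + f p * lie v g"
    unfolding w lie_has_derivative[OF c F(1)] lie_has_derivative[OF c F(2)]
    using lie_has_derivative[OF c has_derivative_mult[OF F], of w] by (simp add: chartD(5)[OF c])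
qed

lemma differentiable_at_sum:
  "finite I \<Longrightarrow> (\<And>i. i \<in> I \<Longrightarrow> differentiable_at p (f i)) \<Longrightarrow> differentiable_at p (\<lambda>q. \<Sum>i\<in>I. f i q)"
  by (induction I rule: finite_induct) (auto intro: differentiable_at_const differentiable_at_add)

lemma lie_sum:
  assumes v: "v \<in> tangent A p"
  shows "finite I \<Longrightarrow> (\<And>i. i \<in> I \<Longrightarrow> differentiable_at p (f i)) \<Longrightarrow>
    lie v (\<lambda>q. \<Sum>i\<in>I. f i q) = (\<Sum>i\<in>I. lie v (f i))"
  by (induction I rule: finite_induct)
    (auto simp: lie_const[OF v] lie_add[OF v] differentiable_at_sum)

end

section \<open>Bases and Cramer's rule\<close>

text \<open>A finite-dimensional space given by linear coordinates. This covers tangent spaces, with real scalars and the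
  coordinates of a chart, as well as the fibres of a bundle, with those of a local trivialization.\<close>

locale coordinate_space = vector_space sc
  for sc :: "'k::field \<Rightarrow> 'v::ab_group_add \<Rightarrow> 'v" +
  fixes V :: "'v set" and \<Phi> :: "'v \<Rightarrow> 'k^'n::finite"
  assumes subspace: "subspace V" and bij: "bij_betw \<Phi> V UNIV"
    and \<Phi>_add: "\<And>v w. v \<in> V \<Longrightarrow> w \<in> V \<Longrightarrow> \<Phi> (v + w) = \<Phi> v + \<Phi> w"
    and \<Phi>_scale: "\<And>c v. v \<in> V \<Longrightarrow> \<Phi> (sc c v) = c *s \<Phi> v"
begin

lemma \<Phi>_sum:
  assumes "\<And>j. j \<in> J \<Longrightarrow> b j \<in> V" "finite J"
  shows "\<Phi> (\<Sum>j\<in>J. sc (c j) (b j)) = (\<Sum>j\<in>J. c j *s \<Phi> (b j))"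
  using assms(2,1)
proof (induction J rule: finite_induct)
  case empty
  have "\<Phi> (0 + 0) = \<Phi> 0 + \<Phi> 0" by (rule \<Phi>_add) (auto simp: subspace_0[OF subspace])
  then show ?case by simp
next
  case (insert j J)
  have "sc (c j) (b j) \<in> V" "(\<Sum>j\<in>J. sc (c j) (b j)) \<in> V"
    using insert.prems by (auto intro!: subspace_sum[OF subspace] subspace_scale[OF subspace])
  from \<Phi>_add[OF this] show ?case
    using insert by (simp add: \<Phi>_scale)
qed

lemma \<Phi>_inv_into [simp]: "\<Phi> (inv_into V \<Phi> x) = x"
  and inv_into_in: "inv_into V \<Phi> x \<in> V"
  using bij by (auto simp: bij_betw_def f_inv_into_f inv_into_into)

lemma \<Phi>_inj: "v \<in> V \<Longrightarrow> w \<in> V \<Longrightarrow> \<Phi> v = \<Phi> w \<Longrightarrow> v = w"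
  using bij by (auto simp: bij_betw_def inj_on_def)

definition basis :: "('n \<Rightarrow> 'v) \<Rightarrow> bool" where
  "basis b \<longleftrightarrow> (\<forall>j. b j \<in> V) \<and> (\<forall>c. (\<Sum>j\<in>UNIV. sc (c j) (b j)) = 0 \<longrightarrow> (\<forall>j. c j = 0))"

definition frame_matrix :: "('n \<Rightarrow> 'v) \<Rightarrow> 'k^'n^'n" where
  "frame_matrix b = (\<chi> k j. \<Phi> (b j) $ k)"

lemma frame_matrix_mult:
  assumes "\<And>j. b j \<in> V"
  shows "frame_matrix b *v c = \<Phi> (\<Sum>j\<in>UNIV. sc (c $ j) (b j))"
  by (simp add: \<Phi>_sum assms vec_eq_iff matrix_vector_mult_def frame_matrix_def mult.commute)

lemma det_frame_matrix:
  assumes "basis b"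
  shows "det (frame_matrix b) \<noteq> 0"
proof -
  have b: "b j \<in> V" for j using assms by (simp add: basis_def)
  have "x = 0" if "frame_matrix b *v x = 0" for x
  proof -
    have "\<Phi> (\<Sum>j\<in>UNIV. sc (x $ j) (b j)) = \<Phi> (\<Sum>j\<in>UNIV. sc ((0::'k^'n) $ j) (b j))"
      using that by (simp only: frame_matrix_mult[OF b, symmetric] matrix_vector_mult_0_right)
    moreover have "(\<Sum>j\<in>UNIV. sc (y $ j) (b j)) \<in> V" for y :: "'k^'n"
      using b by (intro subspace_sum[OF subspace] subspace_scale[OF subspace])
    ultimately have "(\<Sum>j\<in>UNIV. sc (x $ j) (b j)) = (\<Sum>j\<in>UNIV. sc ((0::'k^'n) $ j) (b j))"
      by (blast intro: \<Phi>_inj)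
    then have "(\<Sum>j\<in>UNIV. sc (x $ j) (b j)) = 0" by simp
    then have "\<forall>j. x $ j = 0" using assms unfolding basis_def by blast
    then show ?thesis by (simp add: vec_eq_iff)
  qed
  then show ?thesis
    by (metis invertible_det_nz invertible_left_inverse matrix_left_invertible_ker)
qed

lemma basis_unique:
  assumes "basis b" "(\<Sum>j\<in>UNIV. sc (c j) (b j)) = (\<Sum>j\<in>UNIV. sc (c' j) (b j))"
  shows "c = c'"
proof -
  have "(\<Sum>j\<in>UNIV. sc (c j - c' j) (b j)) = 0"
    using assms(2) by (simp add: scale_left_diff_distrib sum_subtractf)
  then have "\<forall>j. c j - c' j = 0" using assms(1) unfolding basis_def by (auto dest!: spec[of _ "\<lambda>j. c j - c' j"])
  then show ?thesis by auto
qed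

lemma basis_expand:
  assumes "basis b" "x \<in> V"
  obtains c where "x = (\<Sum>j\<in>UNIV. sc (c j) (b j))"
    "c = (\<lambda>i. det (\<chi> k j. if j = i then \<Phi> x $ k else \<Phi> (b j) $ k) / det (frame_matrix b))"
proof -
  define c where "c i = det (\<chi> k j. if j = i then \<Phi> x $ k else \<Phi> (b j) $ k) / det (frame_matrix b)" for i
  have b: "b j \<in> V" for j using assms by (simp add: basis_def)
  have "frame_matrix b *v (\<chi> i. c i) = \<Phi> x"
    by (subst cramer[OF det_frame_matrix[OF assms(1)]])
      (simp add: c_def frame_matrix_def vec_eq_iff cong: if_cong)
  then have "\<Phi> (\<Sum>j\<in>UNIV. sc (c j) (b j)) = \<Phi> x" by (simp add: frame_matrix_mult[OF b])
  then have "x = (\<Sum>j\<in>UNIV. sc (c j) (b j))"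
    using assms(2) b by (intro \<Phi>_inj) (auto intro!: subspace_sum[OF subspace] subspace_scale[OF subspace])
  then show thesis using that c_def by blast
qed

lemma dual_frame_sum:
  assumes "basis b"
  shows "dual_frame V sc b i (\<Sum>j\<in>UNIV. sc (c j) (b j)) = c i"
proof -
  have "(\<Sum>j\<in>UNIV. sc (c j) (b j)) \<in> V"
    using assms by (intro subspace_sum[OF subspace] subspace_scale[OF subspace]) (auto simp: basis_def)
  moreover have "(THE c'. (\<Sum>j\<in>UNIV. sc (c j) (b j)) = (\<Sum>j\<in>UNIV. sc (c' j) (b j))) = c"
    by (rule the_equality) (use basis_unique[OF assms] in auto)
  ultimately show ?thesis by (simp add: dual_frame_def)
qed

lemma dual_frame_expand:
  assumes "basis b" "x \<in> V"
  shows "(\<Sum>j\<in>UNIV. sc (dual_frame V sc b j x) (b j)) = x"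
proof -
  obtain c where c: "x = (\<Sum>j\<in>UNIV. sc (c j) (b j))" by (rule basis_expand[OF assms])
  have "dual_frame V sc b j x = c j" for j
    unfolding c by (rule dual_frame_sum[OF assms(1)])
  then show ?thesis using c by simp
qed

text \<open>Cramer's rule writes coordinates with respect to a basis as quotients of determinants, so they depend smoothly on
  the vector and the basis.\<close>

lemma dual_frame_cramer:
  assumes "basis b" "x \<in> V"
  shows "dual_frame V sc b i x =
    det (\<chi> k j. if j = i then \<Phi> x $ k else \<Phi> (b j) $ k) / det (frame_matrix b)"
proof -
  obtain c where c: "x = (\<Sum>j\<in>UNIV. sc (c j) (b j))"
    "c = (\<lambda>i. det (\<chi> k j. if j = i then \<Phi> x $ k else \<Phi> (b j) $ k) / det (frame_matrix b))"
    by (rule basis_expand[OF assms])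
  have "dual_frame V sc b i x = c i"
    by (subst c(1), rule dual_frame_sum[OF assms(1)])
  then show ?thesis using c(2) by simp
qed

lemma dual_frame_basis: "basis b \<Longrightarrow> dual_frame V sc b i (b j) = (if i = j then 1 else 0)"
  using dual_frame_sum[of b i "\<lambda>k. if k = j then 1 else 0"]
  by (simp add: if_distrib[of "\<lambda>c. sc c _"] cong: if_cong)

lemma dual_frame_add:
  assumes "basis b" "x \<in> V" "y \<in> V"
  shows "dual_frame V sc b i (x + y) = dual_frame V sc b i x + dual_frame V sc b i y"
proof -
  have "x + y = (\<Sum>j\<in>UNIV. sc (dual_frame V sc b j x + dual_frame V sc b j y) (b j))"
    using dual_frame_expand[OF assms(1,2)] dual_frame_expand[OF assms(1,3)]
    by (simp add: scale_left_distrib sum.distrib)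
  from arg_cong[OF this, of "dual_frame V sc b i"] show ?thesis by (simp add: dual_frame_sum[OF assms(1)])
qed

lemma dual_frame_scale:
  assumes "basis b" "x \<in> V"
  shows "dual_frame V sc b i (sc c x) = c * dual_frame V sc b i x"
proof -
  have "sc c x = (\<Sum>j\<in>UNIV. sc (c * dual_frame V sc b j x) (b j))"
    using arg_cong[OF dual_frame_expand[OF assms], of "sc c"] by (simp add: scale_sum_right)
  from arg_cong[OF this, of "dual_frame V sc b i"] show ?thesis by (simp add: dual_frame_sum[OF assms(1)])
qed

lemma transition_inverse:
  assumes "basis b" "basis b'"
  shows "(\<chi> j i. dual_frame V sc b j (b' i)) ** (\<chi> j i. dual_frame V sc b' j (b i)) = mat 1"
proof -
  have e: "dual_frame V sc b k (b l) = (\<Sum>i\<in>UNIV. dual_frame V sc b k (b' i) * dual_frame V sc b' i (b l))" for k l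
  proof -
    have m: "b l \<in> V" "\<And>i. b' i \<in> V" using assms by (auto simp: basis_def)
    have "b l = (\<Sum>i\<in>UNIV. sc (dual_frame V sc b' i (b l)) (b' i))"
      by (rule dual_frame_expand[symmetric]) (use assms m in auto)
    also have "\<dots> = (\<Sum>i\<in>UNIV. sc (dual_frame V sc b' i (b l)) (\<Sum>j\<in>UNIV. sc (dual_frame V sc b j (b' i)) (b j)))"
      by (simp add: dual_frame_expand[OF assms(1) m(2)])
    also have "\<dots> = (\<Sum>j\<in>UNIV. \<Sum>i\<in>UNIV. sc (dual_frame V sc b' i (b l) * dual_frame V sc b j (b' i)) (b j))"
      by (subst sum.swap) (simp add: scale_sum_right)
    also have "\<dots> = (\<Sum>j\<in>UNIV. sc (\<Sum>i\<in>UNIV. dual_frame V sc b j (b' i) * dual_frame V sc b' i (b l)) (b j))"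
      by (simp add: scale_sum_left mult.commute)
    finally have "dual_frame V sc b k (b l) = dual_frame V sc b k
        (\<Sum>j\<in>UNIV. sc (\<Sum>i\<in>UNIV. dual_frame V sc b j (b' i) * dual_frame V sc b' i (b l)) (b j))"
      by (rule arg_cong)
    then show ?thesis by (simp only: dual_frame_sum[OF assms(1)])
  qed
  show ?thesis
    by (simp add: vec_eq_iff matrix_matrix_mult_def mat_def e[symmetric] dual_frame_basis[OF assms(1)])
qed

end

lemma matrix_inv_eq: "A ** B = mat 1 \<Longrightarrow> matrix_inv A = (B :: 'a::field^'n^'n)"
proof -
  assume AB: "A ** B = mat 1"
  then have BA: "B ** A = mat 1" using matrix_left_right_inverse by blast
  have "A ** matrix_inv A = mat 1 \<and> matrix_inv A ** A = mat 1"
    unfolding matrix_inv_def by (rule someI[of _ B]) (use AB BA in blast)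
  then show ?thesis by (metis BA matrix_mul_assoc matrix_mul_lid matrix_mul_rid)
qed

lemma sum_fun: "(\<Sum>i\<in>I. F i) x = (\<Sum>i\<in>I. F i x)" for F :: "'i \<Rightarrow> 'x \<Rightarrow> 'y::comm_monoid_add"
  by (induction I rule: infinite_finite_induct) auto

lemma vector_space_fscale: "vector_space (fscale :: 's::field \<Rightarrow> ('x \<Rightarrow> 's) \<Rightarrow> 'x \<Rightarrow> 's)"
  by unfold_locales (auto simp: fscale_def fun_eq_iff algebra_simps)

context smooth_manifold
begin

subsection \<open>Tangent frames\<close>

lemma tangent_coordinates:
  assumes c: "(V,\<phi>) \<in> A" "p \<in> V"
  shows "coordinate_space fscale (tangent A p) (\<lambda>v. \<chi> k. v (\<lambda>q. \<phi> q $ k))"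
proof -
  interpret vector_space "fscale :: real \<Rightarrow> 'm tvec \<Rightarrow> 'm tvec" by (rule vector_space_fscale)
  note t = tangent_eq[OF c]
  note co = dir_deriv_coordinate[OF c]
  have z: "dir_deriv (V,\<phi>) p 0 = 0"
    using dir_deriv_scale[OF c, of 0 0] by (simp add: fscale_def fun_eq_iff)
  have sub: "subspace (tangent A p)"
    unfolding subspace_def t
    using z by (auto simp flip: dir_deriv_add[OF c] dir_deriv_scale[OF c] intro: rev_image_eqI[of 0])
  have "bij_betw (\<lambda>v. \<chi> k. v (\<lambda>q. \<phi> q $ k)) (tangent A p) UNIV"
    unfolding bij_betw_def t by (auto simp: inj_on_def co image_image vec_nth_inject)
  then show ?thesis
    using sub by unfold_locales (auto simp: vec_eq_iff fscale_def)
qed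

lemma tangent_frame_basis:
  assumes "tangent_frame A U \<Upsilon>" "p \<in> U"
  obtains V \<phi> where "(V,\<phi>) \<in> A" "p \<in> V"
    "coordinate_space fscale (tangent A p) (\<lambda>v. \<chi> k. v (\<lambda>q. \<phi> q $ k))"
    "coordinate_space.basis fscale (tangent A p) (\<lambda>i. \<Upsilon> i p)"
proof -
  obtain V \<phi> where c: "(V,\<phi>) \<in> A" "p \<in> V" using chart_at .
  interpret coordinate_space fscale "tangent A p" "\<lambda>v. \<chi> k. v (\<lambda>q. \<phi> q $ k)"
    by (rule tangent_coordinates[OF c])
  have "basis (\<lambda>i. \<Upsilon> i p)"
    using assms unfolding basis_def tangent_frame_def smooth_vfield_def by blast
  then show thesis using that c coordinate_space_axioms by blast
qed

abbreviation tcoord :: "'m tframe \<Rightarrow> 4 \<Rightarrow> 'm \<Rightarrow> 'm tvec \<Rightarrow> real" where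
  "tcoord \<Upsilon> i p \<equiv> dual_frame (tangent A p) fscale (\<lambda>j. \<Upsilon> j p) i"

lemma tangent_dual_eq: "tangent_dual A \<Upsilon> i p v = of_real (tcoord \<Upsilon> i p v)"
  by (simp add: tangent_dual_def)

lemma tangent_frame_tangent: "tangent_frame A U \<Upsilon> \<Longrightarrow> p \<in> U \<Longrightarrow> \<Upsilon> i p \<in> tangent A p"
  by (simp add: tangent_frame_def smooth_vfield_def)

context
  fixes U \<Upsilon> p
  assumes F: "tangent_frame A U \<Upsilon>" and p: "p \<in> U"
begin

lemma tcoord_sum: "tcoord \<Upsilon> i p (\<Sum>j\<in>UNIV. fscale (c j) (\<Upsilon> j p)) = c i"
  by (rule tangent_frame_basis[OF F p]) (erule (1) coordinate_space.dual_frame_sum)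

lemma tcoord_expand: "v \<in> tangent A p \<Longrightarrow> (\<Sum>j\<in>UNIV. fscale (tcoord \<Upsilon> j p v) (\<Upsilon> j p)) = v"
  by (rule tangent_frame_basis[OF F p]) (erule (2) coordinate_space.dual_frame_expand)

lemma tcoord_frame: "tcoord \<Upsilon> i p (\<Upsilon> j p) = (if i = j then 1 else 0)"
  by (rule tangent_frame_basis[OF F p]) (erule (1) coordinate_space.dual_frame_basis)

lemma tcoord_scale: "v \<in> tangent A p \<Longrightarrow> tcoord \<Upsilon> i p (fscale c v) = c * tcoord \<Upsilon> i p v"
  by (rule tangent_frame_basis[OF F p]) (erule (2) coordinate_space.dual_frame_scale)

end

lemma tcoord_transition:
  assumes "tangent_frame A U \<Upsilon>" "p \<in> U" "tangent_frame A U' \<Upsilon>'" "p \<in> U'"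
  shows "(\<chi> j i. tcoord \<Upsilon> j p (\<Upsilon>' i p)) ** (\<chi> j i. tcoord \<Upsilon>' j p (\<Upsilon> i p)) = mat 1"
  by (rule tangent_frame_basis[OF assms(1,2)], rule tangent_frame_basis[OF assms(3,4)])
    (erule (2) coordinate_space.transition_inverse)

lemma tangent_subspace:
  shows tangent_scale: "v \<in> tangent A p \<Longrightarrow> fscale c v \<in> tangent A p"
    and tangent_zero: "0 \<in> tangent A p"
    and tangent_sum: "(\<And>i. i \<in> I \<Longrightarrow> X i \<in> tangent A p) \<Longrightarrow> (\<Sum>i\<in>I. X i) \<in> tangent A p"
proof -
  obtain V \<phi> where c: "(V,\<phi>) \<in> A" "p \<in> V" using chart_at .
  interpret coordinate_space fscale "tangent A p" "\<lambda>v. \<chi> k. v (\<lambda>q. \<phi> q $ k)"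
    by (rule tangent_coordinates[OF c])
  show "v \<in> tangent A p \<Longrightarrow> fscale c v \<in> tangent A p" "0 \<in> tangent A p"
    "(\<And>i. i \<in> I \<Longrightarrow> X i \<in> tangent A p) \<Longrightarrow> (\<Sum>i\<in>I. X i) \<in> tangent A p"
    by (auto intro: subspace_scale[OF subspace] subspace_0[OF subspace] subspace_sum[OF subspace])
qed

lemma smooth_cramer:
  fixes x :: "'m \<Rightarrow> 'a::real_normed_field^'n::finite" and M :: "'m \<Rightarrow> 'a^'n^'n"
  assumes "open U" "\<And>k. smooth_fun A U (\<lambda>p. x p $ k)" "\<And>k j. smooth_fun A U (\<lambda>p. M p $ k $ j)"
    "\<And>p. p \<in> U \<Longrightarrow> det (M p) \<noteq> 0"
  shows "smooth_fun A U (\<lambda>p. det (\<chi> k j. if j = i then x p $ k else M p $ k $ j) / det (M p))"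
proof -
  have "smooth_fun A U (\<lambda>p. (\<chi> k j. if j = i then x p $ k else M p $ k $ j) $ k $ j)" for k j
    using assms(2,3) by (cases "j = i") simp_all
  then show ?thesis
    unfolding divide_inverse using assms by (intro smooth_mult smooth_det smooth_inverse)
qed

lemma smooth_vfield_chart:
  "smooth_vfield A W X \<Longrightarrow> (V,\<phi>) \<in> A \<Longrightarrow> smooth_fun A (W \<inter> V) (\<lambda>p. X p (\<lambda>q. \<phi> q $ k))"
  unfolding smooth_vfield_def by fast

lemma smooth_tcoord:
  assumes F: "tangent_frame A U \<Upsilon>" and W: "open W" and X: "smooth_vfield A W X"
  shows "smooth_fun A (U \<inter> W) (\<lambda>p. tcoord \<Upsilon> i p (X p))"
proof (rule smooth_fun_local)
  fix p assume "p \<in> U \<inter> W"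
  obtain V \<phi> where c: "(V,\<phi>) \<in> A" "p \<in> V" using chart_at .
  let ?O = "U \<inter> W \<inter> V"
  have O: "open ?O" using F W chartD(1)[OF c(1)] by (auto simp: tangent_frame_def)
  let ?\<Phi> = "\<lambda>v. (\<chi> k. v (\<lambda>q. \<phi> q $ k)) :: real^4"
  have cs: "coordinate_space fscale (tangent A q) ?\<Phi>"
    and b: "coordinate_space.basis fscale (tangent A q) (\<lambda>j. \<Upsilon> j q)" if "q \<in> ?O" for q
    using that c tangent_coordinates[OF c(1)] tangent_frame_basis[OF F, of q] by auto
  have XV: "X q \<in> tangent A q" if "q \<in> ?O" for q using that X by (simp add: smooth_vfield_def)
  have "smooth_fun A ?O (\<lambda>p. det (\<chi> k j. if j = i then ?\<Phi> (X p) $ k else (\<chi> k j. ?\<Phi> (\<Upsilon> j p) $ k) $ k $ j)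
      / det (\<chi> k j. ?\<Phi> (\<Upsilon> j p) $ k))"
  proof (rule smooth_cramer[OF O])
    show "smooth_fun A ?O (\<lambda>p. ?\<Phi> (X p) $ k)" for k
      using smooth_vfield_chart[OF X c(1)] by (auto intro: smooth_fun_subset)
    show "smooth_fun A ?O (\<lambda>p. (\<chi> k j. ?\<Phi> (\<Upsilon> j p) $ k) $ k $ j)" for k j
      using F smooth_vfield_chart[OF _ c(1), of U "\<Upsilon> j" k] unfolding tangent_frame_def
      by (auto intro: smooth_fun_subset)
    show "det (\<chi> k j. ?\<Phi> (\<Upsilon> j q) $ k) \<noteq> 0" if "q \<in> ?O" for q
      using coordinate_space.det_frame_matrix[OF cs[OF that] b[OF that]]
      by (simp add: coordinate_space.frame_matrix_def[OF cs[OF that]])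
  qed
  then have "smooth_fun A ?O (\<lambda>p. tcoord \<Upsilon> i p (X p))"
    by (subst smooth_fun_cong[OF O, where g="\<lambda>p. det (\<chi> k j. if j = i then ?\<Phi> (X p) $ k else (\<chi> k j. ?\<Phi> (\<Upsilon> j p) $ k) $ k $ j)
      / det (\<chi> k j. ?\<Phi> (\<Upsilon> j p) $ k)"])
      (simp_all add: coordinate_space.dual_frame_cramer[OF cs b XV] coordinate_space.frame_matrix_def[OF cs] cong: if_cong)
  then show "\<exists>W'. open W' \<and> p \<in> W' \<and> smooth_fun A W' (\<lambda>p. tcoord \<Upsilon> i p (X p))"
    using O \<open>p \<in> U \<inter> W\<close> c by (intro exI[of _ ?O]) auto
qed

lemma smooth_vfield_subset: "smooth_vfield A U X \<Longrightarrow> W \<subseteq> U \<Longrightarrow> smooth_vfield A W X"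
  unfolding smooth_vfield_def by (fastforce intro: smooth_fun_subset)

lemma tangent_frame_subset: "tangent_frame A U \<Upsilon> \<Longrightarrow> open W \<Longrightarrow> W \<subseteq> U \<Longrightarrow> tangent_frame A W \<Upsilon>"
  unfolding tangent_frame_def by (auto intro: smooth_vfield_subset)

text \<open>Smoothness of spin-tensorial fields is stated in pairs of frames. Coordinate fields provide the tangent frame that
  completes a given local frame of a bundle to such a pair.\<close>

lemma coordinate_tangent_frame:
  assumes c: "(V,\<phi>) \<in> A"
  shows "tangent_frame A V (\<lambda>i p. dir_deriv (V,\<phi>) p (axis i 1))"
  unfolding tangent_frame_def
proof (intro conjI allI ballI impI)
  show "open V" by (rule chartD(1)[OF c])
  fix i
  show "smooth_vfield A V (\<lambda>p. dir_deriv (V,\<phi>) p (axis i 1))"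
    unfolding smooth_vfield_def
  proof (intro conjI ballI allI, goal_cases)
    case (1 p)
    then show ?case using tangent_eq[OF c] by simp
  next
    case (2 d)
    obtain W \<psi> where d: "d = (W,\<psi>)" by (cases d)
    have dA: "(W,\<psi>) \<in> A" using 2 d by simp
    let ?G = "\<lambda>x. frechet_derivative (\<psi> \<circ> inv_into V \<phi>) (at x) (axis i 1)"
    have o: "open (V \<inter> W)" using chartD(1)[OF c] chartD(1)[OF dA] by auto
    have "Cinf_on (\<phi> ` (V \<inter> W)) ?G"
      using transition_smooth[OF c dA] unfolding Cinf_on_def by (metis Ck_on.simps(2))
    then have "smooth_fun A (V \<inter> W) (\<lambda>p. ?G (\<phi> p))"
      by (intro smooth_fun_of_chart[OF c o, where G="?G"]) auto
    then have s: "smooth_fun A (V \<inter> W) (\<lambda>p. ?G (\<phi> p) $ k)" for k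
      by (rule smooth_nth[OF o])
    have "dir_deriv (V,\<phi>) p (axis i 1) (\<lambda>q. \<psi> q $ k) = ?G (\<phi> p) $ k" if "p \<in> V \<inter> W" for p k
      using dir_deriv_chart_change[OF dA _ c, of p] dir_deriv_coordinate[OF dA, of p] that by auto
    then show ?case
      unfolding d using s
        smooth_fun_cong[OF o, of "\<lambda>p. dir_deriv (V,\<phi>) p (axis i 1) (\<lambda>q. \<psi> q $ _)" "\<lambda>p. ?G (\<phi> p) $ _"]
      by simp
  qed
next
  fix p k and a :: "4 \<Rightarrow> real"
  assume p: "p \<in> V" and z: "(\<Sum>i\<in>UNIV. fscale (a i) (dir_deriv (V,\<phi>) p (axis i 1))) = 0"
  have "(\<Sum>i\<in>UNIV. a i * axis i 1 $ k) = 0"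
    using fun_cong[OF z, of "\<lambda>q. \<phi> q $ k"] by (simp add: sum_fun fscale_def dir_deriv_coordinate[OF c p])
  then show "a k = 0" by (simp add: axis_def if_distrib cong: if_cong)
qed

text \<open>A field cut off by a bump function stays smooth when it is extended by \<open>0\<close>.\<close>

lemma smooth_cut_off:
  fixes f :: "'m \<Rightarrow> 'a::real_normed_algebra_1"
  assumes "open U" "open W" "closed K" "K \<subseteq> U" "smooth_fun A UNIV b" "\<And>q. q \<notin> K \<Longrightarrow> b q = (0::real)"
    and f: "smooth_fun A (U \<inter> W) f"
    and g: "\<And>q. q \<in> U \<inter> W \<Longrightarrow> g q = of_real (b q) * f q" "\<And>q. q \<in> W \<Longrightarrow> q \<notin> U \<Longrightarrow> g q = 0"
  shows "smooth_fun A W g"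
proof (rule smooth_fun_local)
  fix p assume p: "p \<in> W"
  have o: "open (U \<inter> W)" "open (W - K)" using assms by auto
  have "smooth_fun A (U \<inter> W) (\<lambda>q. of_real (b q) * f q)"
    using o f assms(5) by (intro smooth_mult smooth_linear[OF bounded_linear_of_real]) (auto intro: smooth_fun_subset)
  then have 1: "smooth_fun A (U \<inter> W) g" using smooth_fun_cong[OF o(1), of g "\<lambda>q. of_real (b q) * f q"] g(1) by simp
  have 2: "smooth_fun A (W - K) g"
    using smooth_fun_cong[OF o(2), of g "\<lambda>_. 0"] g assms(6) smooth_const by fastforce
  show "\<exists>T. open T \<and> p \<in> T \<and> smooth_fun A T g"
    using 1 2 o p assms(4) by (cases "p \<in> U") (meson IntI, blast)
qed

lemma cut_off_vfield:
  assumes U: "open U" and X: "smooth_vfield A U X" and p: "p \<in> U"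
  obtains b :: "'m \<Rightarrow> real" and Y where "b p \<noteq> 0" "smooth_vfield A UNIV Y"
    "\<And>q. q \<in> U \<Longrightarrow> Y q = fscale (b q) (X q)"
proof -
  obtain b :: "'m \<Rightarrow> real" and K where b: "smooth_fun A UNIV b" "b p \<noteq> 0" "closed K" "K \<subseteq> U" "\<And>q. q \<notin> K \<Longrightarrow> b q = 0"
    using bump_function[OF U p] by blast
  define Y where "Y q = (if q \<in> U then fscale (b q) (X q) else 0)" for q
  have "smooth_vfield A UNIV Y"
    unfolding smooth_vfield_def
  proof (intro conjI ballI allI, goal_cases)
    case (1 p)
    then show ?case using X by (simp add: Y_def tangent_zero tangent_scale smooth_vfield_def)
  next
    case (2 c)
    obtain V \<phi> where c: "c = (V,\<phi>)" by (cases c)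
    have "smooth_fun A V (\<lambda>p. Y p (\<lambda>q. \<phi> q $ k))" for k
      by (rule smooth_cut_off[OF U _ b(3,4,1,5), where f="\<lambda>p. X p (\<lambda>q. \<phi> q $ k)"])
        (use 2 c X chartD(1) in \<open>auto simp: Y_def fscale_def smooth_vfield_def\<close>)
    then show ?case by (simp add: c)
  qed
  then show thesis using that b by (simp add: Y_def)
qed

end

section \<open>Frames and sections of vector bundles\<close>

locale smooth_bundle = smooth_manifold A
  for A :: "'m::{t2_space,second_countable_topology} chart set" +
  fixes E :: "('m, 'e::ab_group_add, 'n::finite) vbundle"
  assumes vbundle: "complex_vector_bundle A E"
begin

lemma triv_at: obtains U \<Phi> where "(U,\<Phi>) \<in> trivs E" "p \<in> U"
proof -
  have "p \<in> (\<Union>(U,\<Phi>)\<in>trivs E. U)" using vbundle unfolding complex_vector_bundle_def by simp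
  then show thesis using that by auto
qed

lemma trivD:
  assumes "(U,\<Phi>) \<in> trivs E"
  shows "open U \<and> (\<forall>p\<in>U. bij_betw (\<Phi> p) (fibre E p) UNIV \<and>
        (\<forall>v\<in>fibre E p. \<forall>w\<in>fibre E p. \<Phi> p (v + w) = \<Phi> p v + \<Phi> p w) \<and>
        (\<forall>c. \<forall>v\<in>fibre E p. \<Phi> p (vscale E c v) = c *s \<Phi> p v))"
proof -
  have "\<forall>(U,\<Phi>)\<in>trivs E. open U \<and> (\<forall>p\<in>U. bij_betw (\<Phi> p) (fibre E p) UNIV \<and>
        (\<forall>v\<in>fibre E p. \<forall>w\<in>fibre E p. \<Phi> p (v + w) = \<Phi> p v + \<Phi> p w) \<and>
        (\<forall>c. \<forall>v\<in>fibre E p. \<Phi> p (vscale E c v) = c *s \<Phi> p v))"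
    using vbundle unfolding complex_vector_bundle_def by (elim conjE)
  from bspec[OF this assms] show ?thesis by simp
qed

lemma open_triv: "(U,\<Phi>) \<in> trivs E \<Longrightarrow> open U"
  using trivD by blast

lemma triv_transition:
  assumes "(U,\<Phi>) \<in> trivs E" "(V,\<Psi>) \<in> trivs E"
  shows "smooth_fun A (U \<inter> V) (\<lambda>p. \<Psi> p (inv_into (fibre E p) (\<Phi> p) x))"
proof -
  have "\<forall>(U,\<Phi>)\<in>trivs E. \<forall>(V,\<Psi>)\<in>trivs E. \<forall>x.
        smooth_fun A (U \<inter> V) (\<lambda>p. \<Psi> p (inv_into (fibre E p) (\<Phi> p) x))"
    using vbundle unfolding complex_vector_bundle_def by (elim conjE)
  from bspec[OF this assms(1)] show ?thesis using assms(2) by auto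
qed

lemma triv_coordinates:
  assumes t: "(U,\<Phi>) \<in> trivs E" "p \<in> U"
  shows "coordinate_space (vscale E) (fibre E p) (\<Phi> p)"
proof -
  have b: "vector_space (vscale E)" "\<forall>p. module.subspace (vscale E) (fibre E p)"
    using vbundle unfolding complex_vector_bundle_def by - (elim conjE, assumption)+
  interpret vector_space "vscale E" by (rule b(1))
  show ?thesis
    using b(2) trivD[OF t(1)] t(2) by unfold_locales blast+
qed

lemma vector_space_E: "vector_space (vscale E)"
  using vbundle unfolding complex_vector_bundle_def by (elim conjE)

sublocale vec: vector_space "vscale E" by (rule vector_space_E)

lemma fibre_subspace:
  shows fibre_zero: "0 \<in> fibre E p"
    and fibre_add: "v \<in> fibre E p \<Longrightarrow> w \<in> fibre E p \<Longrightarrow> v + w \<in> fibre E p"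
    and fibre_scale: "v \<in> fibre E p \<Longrightarrow> vscale E c v \<in> fibre E p"
    and fibre_sum: "(\<And>i. i \<in> I \<Longrightarrow> X i \<in> fibre E p) \<Longrightarrow> (\<Sum>i\<in>I. X i) \<in> fibre E p"
proof -
  have s: "vec.subspace (fibre E p)" using vbundle unfolding complex_vector_bundle_def by (elim conjE) (rule spec)
  show "0 \<in> fibre E p" "v \<in> fibre E p \<Longrightarrow> w \<in> fibre E p \<Longrightarrow> v + w \<in> fibre E p"
    "v \<in> fibre E p \<Longrightarrow> vscale E c v \<in> fibre E p"
    "(\<And>i. i \<in> I \<Longrightarrow> X i \<in> fibre E p) \<Longrightarrow> (\<Sum>i\<in>I. X i) \<in> fibre E p"
    using s by (auto intro: vec.subspace_0 vec.subspace_add vec.subspace_scale vec.subspace_sum)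
qed

lemma bundle_frame_basis:
  assumes "bundle_frame A E U \<Psi>" "p \<in> U"
  obtains W \<Phi> where "(W,\<Phi>) \<in> trivs E" "p \<in> W"
    "coordinate_space (vscale E) (fibre E p) (\<Phi> p)"
    "coordinate_space.basis (vscale E) (fibre E p) (\<lambda>i. \<Psi> i p)"
proof -
  obtain W \<Phi> where t: "(W,\<Phi>) \<in> trivs E" "p \<in> W" using triv_at .
  interpret coordinate_space "vscale E" "fibre E p" "\<Phi> p" by (rule triv_coordinates[OF t])
  have "basis (\<lambda>i. \<Psi> i p)"
    using assms unfolding basis_def bundle_frame_def smooth_section_def by blast
  then show thesis using that t coordinate_space_axioms by blast
qed

context
  fixes U \<Psi> p
  assumes F: "bundle_frame A E U \<Psi>" and p: "p \<in> U"
begin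

lemma frame_in_fibre: "\<Psi> i p \<in> fibre E p"
  using F p by (simp add: bundle_frame_def smooth_section_def)

lemma spin_dual_sum: "spin_dual E \<Psi> i p (\<Sum>j\<in>UNIV. vscale E (c j) (\<Psi> j p)) = c i"
  unfolding spin_dual_def by (rule bundle_frame_basis[OF F p]) (erule (1) coordinate_space.dual_frame_sum)

lemma spin_dual_expand: "v \<in> fibre E p \<Longrightarrow> (\<Sum>j\<in>UNIV. vscale E (spin_dual E \<Psi> j p v) (\<Psi> j p)) = v"
  unfolding spin_dual_def by (rule bundle_frame_basis[OF F p]) (erule (2) coordinate_space.dual_frame_expand)

lemma spin_dual_frame: "spin_dual E \<Psi> i p (\<Psi> j p) = (if i = j then 1 else 0)"
  unfolding spin_dual_def by (rule bundle_frame_basis[OF F p]) (erule (1) coordinate_space.dual_frame_basis)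

lemma spin_dual_add: "v \<in> fibre E p \<Longrightarrow> w \<in> fibre E p \<Longrightarrow>
    spin_dual E \<Psi> i p (v + w) = spin_dual E \<Psi> i p v + spin_dual E \<Psi> i p w"
  unfolding spin_dual_def by (rule bundle_frame_basis[OF F p]) (erule (3) coordinate_space.dual_frame_add)

lemma spin_dual_scale: "v \<in> fibre E p \<Longrightarrow> spin_dual E \<Psi> i p (vscale E c v) = c * spin_dual E \<Psi> i p v"
  unfolding spin_dual_def by (rule bundle_frame_basis[OF F p]) (erule (2) coordinate_space.dual_frame_scale)

lemma spin_dual_outside: "v \<notin> fibre E p \<Longrightarrow> spin_dual E \<Psi> i p v = 0"
  unfolding spin_dual_def by (simp add: dual_frame_def)

lemma spin_dual_functional: "spin_dual E \<Psi> i p \<in> functionals (fibre E p) (vscale E) (\<lambda>c. c)"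
  by (simp add: functionals_def spin_dual_add spin_dual_scale spin_dual_outside)

lemma functional_expand:
  assumes "\<xi> \<in> functionals (fibre E p) (vscale E) (\<lambda>c. c)" "v \<in> fibre E p"
  shows "\<xi> v = (\<Sum>i\<in>UNIV. \<xi> (\<Psi> i p) * spin_dual E \<Psi> i p v)"
proof -
  have z: "\<xi> 0 = 0" and a: "\<And>x y. x \<in> fibre E p \<Longrightarrow> y \<in> fibre E p \<Longrightarrow> \<xi> (x + y) = \<xi> x + \<xi> y"
    and s: "\<And>c x. x \<in> fibre E p \<Longrightarrow> \<xi> (vscale E c x) = c * \<xi> x"
    using assms fibre_zero[of p] unfolding functionals_def
    by (auto, metis add.right_neutral add_left_cancel)
  have "\<xi> (\<Sum>j\<in>J. vscale E (c j) (\<Psi> j p)) = (\<Sum>j\<in>J. \<xi> (\<Psi> j p) * c j)" if "finite J" for J c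
    using that by (induction J rule: finite_induct)
      (simp_all add: z a s fibre_scale fibre_sum frame_in_fibre mult.commute)
  from this[of UNIV "\<lambda>j. spin_dual E \<Psi> j p v"] show ?thesis
    by (simp add: spin_dual_expand[OF assms(2)])
qed

lemma antifunctional_expand:
  assumes "\<eta> \<in> functionals (fibre E p) (vscale E) cnj" "v \<in> fibre E p"
  shows "\<eta> v = (\<Sum>i\<in>UNIV. \<eta> (\<Psi> i p) * cnj (spin_dual E \<Psi> i p v))"
proof -
  have "cnj \<circ> \<eta> \<in> functionals (fibre E p) (vscale E) (\<lambda>c. c)"
    using assms by (simp add: functionals_def)
  from arg_cong[OF functional_expand[OF this assms(2)], of cnj] show ?thesis by simp
qed

end

lemma spin_dual_transition:
  assumes "bundle_frame A E U \<Psi>" "p \<in> U" "bundle_frame A E U' \<Psi>'" "p \<in> U'"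
  shows "(\<chi> j i. spin_dual E \<Psi> j p (\<Psi>' i p)) ** (\<chi> j i. spin_dual E \<Psi>' j p (\<Psi> i p)) = mat 1"
  unfolding spin_dual_def
  by (rule bundle_frame_basis[OF assms(1,2)], rule bundle_frame_basis[OF assms(3,4)])
    (erule (2) coordinate_space.transition_inverse)

lemma smooth_spin_dual:
  assumes F: "bundle_frame A E U \<Psi>" and W: "open W" and s: "smooth_section A E W s"
  shows "smooth_fun A (U \<inter> W) (\<lambda>p. spin_dual E \<Psi> i p (s p))"
proof (rule smooth_fun_local)
  fix p assume "p \<in> U \<inter> W"
  obtain V \<Phi> where t: "(V,\<Phi>) \<in> trivs E" "p \<in> V" using triv_at .
  let ?O = "U \<inter> W \<inter> V"
  have O: "open ?O" using F W open_triv[OF t(1)] by (auto simp: bundle_frame_def)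
  have cs: "coordinate_space (vscale E) (fibre E q) (\<Phi> q)"
    and b: "coordinate_space.basis (vscale E) (fibre E q) (\<lambda>j. \<Psi> j q)" if "q \<in> ?O" for q
    using that t triv_coordinates[OF t(1)] bundle_frame_basis[OF F, of q] by auto
  have sV: "s q \<in> fibre E q" if "q \<in> ?O" for q using that s by (simp add: smooth_section_def)
  have sm: "smooth_fun A ?O (\<lambda>p. \<Phi> p (r p) $ k)" if "smooth_section A E O' r" "O' = U \<or> O' = W" for r O' k
  proof (rule smooth_nth[OF O])
    have "smooth_fun A (O' \<inter> V) (\<lambda>p. \<Phi> p (r p))"
      using that t unfolding smooth_section_def by fast
    then show "smooth_fun A ?O (\<lambda>p. \<Phi> p (r p))" using that(2) by (auto intro: smooth_fun_subset)
  qed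
  have "smooth_fun A ?O (\<lambda>p. det (\<chi> k j. if j = i then \<Phi> p (s p) $ k else (\<chi> k j. \<Phi> p (\<Psi> j p) $ k) $ k $ j)
      / det (\<chi> k j. \<Phi> p (\<Psi> j p) $ k))"
  proof (rule smooth_cramer[OF O])
    show "smooth_fun A ?O (\<lambda>p. \<Phi> p (s p) $ k)" for k
      using sm[OF s] by simp
    show "smooth_fun A ?O (\<lambda>p. (\<chi> k j. \<Phi> p (\<Psi> j p) $ k) $ k $ j)" for k j
      using F sm[of U "\<Psi> j"] unfolding bundle_frame_def by simp
    show "det (\<chi> k j. \<Phi> q (\<Psi> j q) $ k) \<noteq> 0" if "q \<in> ?O" for q
      using coordinate_space.det_frame_matrix[OF cs[OF that] b[OF that]]
      by (simp add: coordinate_space.frame_matrix_def[OF cs[OF that]])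
  qed
  then have "smooth_fun A ?O (\<lambda>p. spin_dual E \<Psi> i p (s p))"
    by (subst smooth_fun_cong[OF O, where g="\<lambda>p. det (\<chi> k j. if j = i then \<Phi> p (s p) $ k else (\<chi> k j. \<Phi> p (\<Psi> j p) $ k) $ k $ j)
      / det (\<chi> k j. \<Phi> p (\<Psi> j p) $ k)"])
      (simp_all add: spin_dual_def coordinate_space.dual_frame_cramer[OF cs b sV] coordinate_space.frame_matrix_def[OF cs] cong: if_cong)
  then show "\<exists>W'. open W' \<and> p \<in> W' \<and> smooth_fun A W' (\<lambda>p. spin_dual E \<Psi> i p (s p))"
    using O \<open>p \<in> U \<inter> W\<close> t by (intro exI[of _ ?O]) auto
qed

lemma smooth_section_subset: "smooth_section A E U s \<Longrightarrow> W \<subseteq> U \<Longrightarrow> smooth_section A E W s"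
  unfolding smooth_section_def by (fastforce intro: smooth_fun_subset)

lemma bundle_frame_subset: "bundle_frame A E U \<Psi> \<Longrightarrow> open W \<Longrightarrow> W \<subseteq> U \<Longrightarrow> bundle_frame A E W \<Psi>"
  unfolding bundle_frame_def by (auto intro: smooth_section_subset)

lemma frame_pair_subset: "frame_pair A E (U,\<Upsilon>,\<Psi>) \<Longrightarrow> open W \<Longrightarrow> W \<subseteq> U \<Longrightarrow> frame_pair A E (W,\<Upsilon>,\<Psi>)"
  by (auto simp: frame_pair_def intro: tangent_frame_subset bundle_frame_subset)

lemma smooth_section_triv:
  "smooth_section A E U s \<Longrightarrow> (V,\<Phi>) \<in> trivs E \<Longrightarrow> smooth_fun A (U \<inter> V) (\<lambda>p. \<Phi> p (s p))"
  unfolding smooth_section_def by fast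

text \<open>This lets local frames be used as test fields where only global sections are admitted.\<close>

lemma cut_off_section:
  assumes U: "open U" and t: "smooth_section A E U t" and p: "p \<in> U"
  obtains b :: "'m \<Rightarrow> real" and s where "b p \<noteq> 0" "smooth_section A E UNIV s"
    "\<And>q. q \<in> U \<Longrightarrow> s q = vscale E (of_real (b q)) (t q)"
proof -
  obtain b :: "'m \<Rightarrow> real" and K where b: "smooth_fun A UNIV b" "b p \<noteq> 0" "closed K" "K \<subseteq> U" "\<And>q. q \<notin> K \<Longrightarrow> b q = 0"
    using bump_function[OF U p] by blast
  define s where "s q = (if q \<in> U then vscale E (of_real (b q)) (t q) else 0)" for q
  have tU: "t q \<in> fibre E q" if "q \<in> U" for q using t that by (simp add: smooth_section_def)
  have "smooth_section A E UNIV s"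
    unfolding smooth_section_def
  proof (intro conjI ballI, goal_cases)
    case (1 p)
    then show ?case using tU by (simp add: s_def fibre_zero fibre_scale)
  next
    case (2 c)
    obtain V \<Phi> where c: "c = (V,\<Phi>)" by (cases c)
    then have V: "(V,\<Phi>) \<in> trivs E" "open V" using 2 open_triv by auto
    have z: "\<Phi> q 0 = 0" if "q \<in> V" for q
      using coordinate_space.\<Phi>_sum[OF triv_coordinates[OF V(1) that], of "{}" "\<lambda>_. 0" "\<lambda>_. 0"] by simp
    have "smooth_fun A V (\<lambda>p. \<Phi> p (s p) $ k)" for k
    proof (rule smooth_cut_off[OF U V(2) b(3,4,1,5)])
      show "smooth_fun A (U \<inter> V) (\<lambda>p. \<Phi> p (t p) $ k)"
        using smooth_section_triv[OF t V(1)] U V by (intro smooth_nth) auto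
      show "\<Phi> q (s q) $ k = of_real (b q) * \<Phi> q (t q) $ k" if "q \<in> U \<inter> V" for q
        using that tU coordinate_space.\<Phi>_scale[OF triv_coordinates[OF V(1)]] by (simp add: s_def)
      show "\<Phi> q (s q) $ k = 0" if "q \<in> V" "q \<notin> U" for q using that z by (simp add: s_def)
    qed
    then show ?case using V by (simp add: c smooth_vec)
  qed
  then show thesis using that b by (simp add: s_def)
qed

lemma triv_frame:
  assumes t: "(U,\<Phi>) \<in> trivs E"
  shows "bundle_frame A E U (\<lambda>i p. inv_into (fibre E p) (\<Phi> p) (axis i 1))"
  unfolding bundle_frame_def
proof (intro conjI allI ballI impI)
  show "open U" by (rule open_triv[OF t])
  note cs = triv_coordinates[OF t]
  fix i
  show "smooth_section A E U (\<lambda>p. inv_into (fibre E p) (\<Phi> p) (axis i 1))"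
    unfolding smooth_section_def using triv_transition[OF t] coordinate_space.inv_into_in[OF cs] by auto
next
  fix p k and c :: "'n \<Rightarrow> complex"
  assume p: "p \<in> U" and z: "(\<Sum>i\<in>UNIV. vscale E (c i) (inv_into (fibre E p) (\<Phi> p) (axis i 1))) = 0"
  interpret coordinate_space "vscale E" "fibre E p" "\<Phi> p" by (rule triv_coordinates[OF t p])
  have "(\<Sum>i\<in>UNIV. c i *s axis i 1) = \<Phi> p 0"
    by (subst z[symmetric], subst \<Phi>_sum) (simp_all add: inv_into_in)
  moreover have "\<Phi> p 0 = 0" using \<Phi>_sum[of "{}" "\<lambda>_. 0" "\<lambda>_. 0"] by simp
  ultimately have "(\<Sum>i\<in>UNIV. c i *s axis i 1) $ k = 0" by simp
  then show "c k = 0" by (simp add: axis_def if_distrib cong: if_cong)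
qed


subsection \<open>Test fields and reality\<close>

text \<open>Sections and tangent fields as the fields on which reality is tested. Being evaluations
  at a functional, they are multilinear for trivial reasons.\<close>

lemma spin_field_vector:
  assumes s: "smooth_section A E UNIV s"
  shows "spin_field A E (1,0,0,0,0,0) (vector_field s)"
  unfolding spin_field_def
proof (intro conjI allI impI)
  fix p
  show "spin_tensor_at A E (1,0,0,0,0,0) p (vector_field s)"
    by (auto simp: spin_tensor_at_def Let_def multilinear_def tuples_def vector_field_def fscale_def)
next
  fix U \<Upsilon> \<Psi> and i j i' j' :: "'n list" and h k :: "4 list"
  assume F: "frame_pair A E (U,\<Upsilon>,\<Psi>)" and "has_type (1,0,0,0,0,0) i j i' j' h k"
  then obtain a where i: "i = [a]" by (auto simp: has_type_def Suc_length_conv)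
  have "smooth_fun A (U \<inter> UNIV) (\<lambda>p. spin_dual E \<Psi> a p (s p))"
    using F s by (intro smooth_spin_dual) (auto simp: frame_pair_def)
  then show "smooth_fun A U (components A E (U,\<Upsilon>,\<Psi>) (vector_field s) i j i' j' h k)"
    by (simp add: components_def vector_field_def i)
qed

lemma spin_field_tangent:
  assumes Y: "smooth_vfield A UNIV Y"
  shows "spin_field A E (0,0,0,0,1,0) (\<lambda>p \<xi> v \<eta> w \<theta> u. (\<theta> ! 0) (Y p))"
  unfolding spin_field_def
proof (intro conjI allI impI)
  fix p
  show "spin_tensor_at A E (0,0,0,0,1,0) p (\<lambda>p \<xi> v \<eta> w \<theta> u. (\<theta> ! 0) (Y p))"
    by (auto simp: spin_tensor_at_def Let_def multilinear_def tuples_def fscale_def)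
next
  fix U \<Upsilon> \<Psi> and i j i' j' :: "'n list" and h k :: "4 list"
  assume F: "frame_pair A E (U,\<Upsilon>,\<Psi>)" and "has_type (0,0,0,0,1,0) i j i' j' h k"
  then obtain a where h: "h = [a]" by (auto simp: has_type_def Suc_length_conv)
  have "smooth_fun A (U \<inter> UNIV) (\<lambda>p. tcoord \<Upsilon> a p (Y p))"
    using F Y by (intro smooth_tcoord) (auto simp: frame_pair_def)
  then have "smooth_fun A U (\<lambda>p. complex_of_real (tcoord \<Upsilon> a p (Y p)))"
    using F by (intro smooth_of_real) (auto simp: frame_pair_def tangent_frame_def)
  then show "smooth_fun A U (components A E (U,\<Upsilon>,\<Psi>) (\<lambda>p \<xi> v \<eta> w \<theta> u. (\<theta> ! 0) (Y p)) i j i' j' h k)"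
    by (simp add: components_def h tangent_dual_eq)
qed

text \<open>Reality, a condition on global fields, is a pointwise condition on the components of the connection:
  one tests it on a frame field multiplied by a cut-off function \<open>b\<close>. The derivative of \<open>b\<close>, a real
  function, contributes the same term to both sides, which leaves \<open>b p\<close> times the asserted equality.\<close>

lemma real_connection_components:
  assumes R: "real_connection A E C" and F: "frame_pair A E (U,\<Upsilon>,\<Psi>)" and p: "p \<in> U"
  shows "conB C (U,\<Upsilon>,\<Psi>) k i j p = cnj (conA C (U,\<Upsilon>,\<Psi>) k i j p)" (is ?g1)
    and "cnj (conG C (U,\<Upsilon>,\<Psi>) k' i j' p) = conG C (U,\<Upsilon>,\<Psi>) k' i j' p" (is ?g2)
proof -
  have T: "tangent_frame A U \<Upsilon>" and B: "bundle_frame A E U \<Psi>" and U: "open U"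
    using F by (auto simp: frame_pair_def bundle_frame_def)
  have \<Upsilon>p: "\<Upsilon> i p \<in> tangent A p" by (rule tangent_frame_tangent[OF T p])
  show ?g1
  proof -
    obtain b :: "'m \<Rightarrow> real" and s where s: "b p \<noteq> 0" "smooth_section A E UNIV s"
      "\<And>q. q \<in> U \<Longrightarrow> s q = vscale E (of_real (b q)) (\<Psi> j q)"
      using cut_off_section[OF U _ p] B unfolding bundle_frame_def by metis
    define f where "f a q = spin_dual E \<Psi> a q (s q)" for a q
    have f: "f a q = (if a = j then of_real (b q) else 0)" if "q \<in> U" for a q
      using that by (simp add: f_def s(3) spin_dual_scale[OF B that] frame_in_fibre[OF B that] spin_dual_frame[OF B that])
    have "nabla C (U,\<Upsilon>,\<Psi>) (components A E (U,\<Upsilon>,\<Psi>) (conj_field (vector_field s))) i [] [] [k] [] [] [] p =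
          conj_components (nabla C (U,\<Upsilon>,\<Psi>) (components A E (U,\<Upsilon>,\<Psi>) (vector_field s)) i) [] [] [k] [] [] [] p"
      using R spin_field_vector[OF s(2)] F p unfolding real_connection_def by (fastforce simp: has_type_def)
    then have "lie (\<Upsilon> i p) (\<lambda>q. cnj (f k q)) + (\<Sum>v\<in>UNIV. conB C (U,\<Upsilon>,\<Psi>) k i v p * cnj (f v p)) =
      cnj (lie (\<Upsilon> i p) (f k) + (\<Sum>v\<in>UNIV. conA C (U,\<Upsilon>,\<Psi>) k i v p * f v p))"
      unfolding components_conj_field
      by (simp add: nabla_def conj_components_def components_def vector_field_def f_def[abs_def])
    then show ?thesis
      using s(1) by (simp add: lie_cnj[OF \<Upsilon>p] f[OF p] if_distrib cong: if_cong)
  qed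
  show ?g2
  proof -
    obtain b :: "'m \<Rightarrow> real" and Y where Y: "b p \<noteq> 0" "smooth_vfield A UNIV Y"
      "\<And>q. q \<in> U \<Longrightarrow> Y q = fscale (b q) (\<Upsilon> j' q)"
      using cut_off_vfield[OF U _ p] T unfolding tangent_frame_def by metis
    let ?X = "(\<lambda>p \<xi> v \<eta> w \<theta> u. (\<theta> ! 0) (Y p)) :: ('m, 'e) spin_tensor"
    define f where "f a q = tangent_dual A \<Upsilon> a q (Y q)" for a q
    have f: "f a p = (if a = j' then of_real (b p) else 0)" for a
      using p by (simp add: f_def Y(3) tangent_dual_eq tcoord_scale[OF T p] tangent_frame_tangent[OF T p] tcoord_frame[OF T p])
    have fr: "cnj (f a q) = f a q" for a q by (simp add: f_def tangent_dual_eq)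
    have "nabla C (U,\<Upsilon>,\<Psi>) (components A E (U,\<Upsilon>,\<Psi>) (conj_field ?X)) i [] [] [] [] [k'] [] p =
          conj_components (nabla C (U,\<Upsilon>,\<Psi>) (components A E (U,\<Upsilon>,\<Psi>) ?X) i) [] [] [] [] [k'] [] p"
      using R spin_field_tangent[OF Y(2)] F p unfolding real_connection_def by (fastforce simp: has_type_def)
    then have "lie (\<Upsilon> i p) (\<lambda>q. cnj (f k' q)) + (\<Sum>v\<in>UNIV. conG C (U,\<Upsilon>,\<Psi>) k' i v p * cnj (f v p)) =
      cnj (lie (\<Upsilon> i p) (f k') + (\<Sum>v\<in>UNIV. conG C (U,\<Upsilon>,\<Psi>) k' i v p * f v p))"
      unfolding components_conj_field
      by (simp add: nabla_def conj_components_def components_def f_def[abs_def])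
    then show ?thesis
      using Y(1) by (simp add: lie_cnj[OF \<Upsilon>p, symmetric] fr f if_distrib cong: if_cong)
  qed
qed

text \<open>Conversely, the pointwise conditions suffice for fields of every type, as conjugation of
  components exchanges the two kinds of spinor indices.\<close>

lemma real_connectionI:
  assumes "\<And>U \<Upsilon> \<Psi> p k i j. frame_pair A E (U,\<Upsilon>,\<Psi>) \<Longrightarrow> p \<in> U \<Longrightarrow>
      conB C (U,\<Upsilon>,\<Psi>) k i j p = cnj (conA C (U,\<Upsilon>,\<Psi>) k i j p)"
    and "\<And>U \<Upsilon> \<Psi> p k i j. frame_pair A E (U,\<Upsilon>,\<Psi>) \<Longrightarrow> p \<in> U \<Longrightarrow>
      cnj (conG C (U,\<Upsilon>,\<Psi>) k i j p) = conG C (U,\<Upsilon>,\<Psi>) k i j p"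
  shows "real_connection A E C"
  unfolding real_connection_def
proof (intro allI impI ballI)
  fix \<alpha> \<beta> \<nu> \<gamma> m n X U \<Upsilon> \<Psi> p r i j i' j' h k
  assume F: "frame_pair A E (U,\<Upsilon>,\<Psi>)" and p: "p \<in> U"
  have T: "\<Upsilon> r p \<in> tangent A p"
    using F p tangent_frame_tangent by (auto simp: frame_pair_def)
  show "nabla C (U, \<Upsilon>, \<Psi>) (components A E (U, \<Upsilon>, \<Psi>) (conj_field X)) r i j i' j' h k p =
       conj_components (nabla C (U, \<Upsilon>, \<Psi>) (components A E (U, \<Upsilon>, \<Psi>) X) r) i j i' j' h k p"
    unfolding components_conj_field
    by (simp add: nabla_def conj_components_def lie_cnj[OF T, of "components A E (U, \<Upsilon>, \<Psi>) X i' j' i j h k"]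
      assms[OF F p])
qed


subsection \<open>The transformation law between frames\<close>

definition spin_transition :: "('n \<Rightarrow> 'm \<Rightarrow> 'e) \<Rightarrow> ('n \<Rightarrow> 'm \<Rightarrow> 'e) \<Rightarrow> 'm \<Rightarrow> complex^'n^'n" where
  "spin_transition \<Psi> \<Psi>' p = (\<chi> j i. spin_dual E \<Psi> j p (\<Psi>' i p))"

definition tangent_transition :: "'m tframe \<Rightarrow> 'm tframe \<Rightarrow> 'm \<Rightarrow> real^4^4" where
  "tangent_transition \<Upsilon> \<Upsilon>' p = (\<chi> j i. tcoord \<Upsilon> j p (\<Upsilon>' i p))"

text \<open>The transformation law at a point for given transition functions \<open>S\<close>, \<open>Q\<close> and their
  inverses \<open>T\<close>, \<open>R\<close>.\<close>

definition connection_law ::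
  "('m, 'e, 'n) connection \<Rightarrow> 'm tframe \<Rightarrow> ('m, 'e, 'n) fpair \<Rightarrow> ('m, 'e, 'n) fpair \<Rightarrow>
   ('m \<Rightarrow> real^4^4) \<Rightarrow> ('m \<Rightarrow> real^4^4) \<Rightarrow> ('m \<Rightarrow> complex^'n^'n) \<Rightarrow> ('m \<Rightarrow> complex^'n^'n) \<Rightarrow> 'm \<Rightarrow> bool" where
  "connection_law C \<Upsilon> F F' S T Q R p \<longleftrightarrow>
           (\<forall>k i j. conG C F k i j p =
              (\<Sum>a\<in>UNIV. \<Sum>b\<in>UNIV. \<Sum>c\<in>UNIV.
                 of_real (S p $ k $ a) * of_real (T p $ b $ j) * of_real (T p $ c $ i) *
                 conG C F' a c b p) +
              (\<Sum>a\<in>UNIV. of_real (S p $ k $ a) * of_real (\<Upsilon> i p (\<lambda>q. T q $ a $ j)))) \<and>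
           (\<forall>k i j. conA C F k i j p =
              (\<Sum>a\<in>UNIV. \<Sum>b\<in>UNIV. \<Sum>c\<in>UNIV.
                 Q p $ k $ a * R p $ b $ j * of_real (T p $ c $ i) * conA C F' a c b p) +
              (\<Sum>a\<in>UNIV. Q p $ k $ a * lie (\<Upsilon> i p) (\<lambda>q. R q $ a $ j))) \<and>
           (\<forall>k i j. conB C F k i j p =
              (\<Sum>a\<in>UNIV. \<Sum>b\<in>UNIV. \<Sum>c\<in>UNIV.
                 cnj (Q p $ k $ a) * cnj (R p $ b $ j) * of_real (T p $ c $ i) * conB C F' a c b p) +
              cnj (\<Sum>a\<in>UNIV. Q p $ k $ a * lie (\<Upsilon> i p) (\<lambda>q. R q $ a $ j)))"

text \<open>The law only depends on the transition functions near the point, where they are determined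
  by the frames.\<close>

lemma spinor_connection_iff:
  "spinor_connection A E C \<longleftrightarrow>
     (\<forall>U \<Upsilon> \<Psi>. frame_pair A E (U,\<Upsilon>,\<Psi>) \<longrightarrow>
        (\<forall>k i j. smooth_fun A U (conG C (U,\<Upsilon>,\<Psi>) k i j)) \<and>
        (\<forall>k i j. smooth_fun A U (conA C (U,\<Upsilon>,\<Psi>) k i j)) \<and>
        (\<forall>k i j. smooth_fun A U (conB C (U,\<Upsilon>,\<Psi>) k i j))) \<and>
     (\<forall>U \<Upsilon> \<Psi> U' \<Upsilon>' \<Psi>'. frame_pair A E (U,\<Upsilon>,\<Psi>) \<and> frame_pair A E (U',\<Upsilon>',\<Psi>') \<longrightarrow> (\<forall>p\<in>U \<inter> U'.
        connection_law C \<Upsilon> (U,\<Upsilon>,\<Psi>) (U',\<Upsilon>',\<Psi>') (tangent_transition \<Upsilon> \<Upsilon>') (tangent_transition \<Upsilon>' \<Upsilon>)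
          (spin_transition \<Psi> \<Psi>') (spin_transition \<Psi>' \<Psi>) p))"
proof -
  have law: "(\<forall>S Q T R. (\<forall>p\<in>U \<inter> U'.
            (\<forall>i. \<Upsilon>' i p = (\<Sum>j\<in>UNIV. fscale (S p $ j $ i) (\<Upsilon> j p))) \<and>
            (\<forall>i. \<Psi>' i p = (\<Sum>j\<in>UNIV. vscale E (Q p $ j $ i) (\<Psi> j p))) \<and>
            T p = matrix_inv (S p) \<and> R p = matrix_inv (Q p)) \<longrightarrow>
         (\<forall>p\<in>U \<inter> U'. connection_law C \<Upsilon> (U,\<Upsilon>,\<Psi>) (U',\<Upsilon>',\<Psi>') S T Q R p)) \<longleftrightarrow>
      (\<forall>p\<in>U \<inter> U'. connection_law C \<Upsilon> (U,\<Upsilon>,\<Psi>) (U',\<Upsilon>',\<Psi>') (tangent_transition \<Upsilon> \<Upsilon>') (tangent_transition \<Upsilon>' \<Upsilon>)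
          (spin_transition \<Psi> \<Psi>') (spin_transition \<Psi>' \<Psi>) p)" (is "(\<forall>S Q T R. ?pre S Q T R \<longrightarrow> ?law S Q T R) \<longleftrightarrow> ?rhs")
    if F: "frame_pair A E (U,\<Upsilon>,\<Psi>)" and F': "frame_pair A E (U',\<Upsilon>',\<Psi>')" for U \<Upsilon> \<Psi> U' \<Upsilon>' \<Psi>'
  proof -
    have T: "tangent_frame A U \<Upsilon>" "tangent_frame A U' \<Upsilon>'" and B: "bundle_frame A E U \<Psi>" "bundle_frame A E U' \<Psi>'"
      using F F' by (auto simp: frame_pair_def)
    have o: "open (U \<inter> U')" using T by (auto simp: tangent_frame_def)
    let ?S = "tangent_transition \<Upsilon> \<Upsilon>'" and ?T = "tangent_transition \<Upsilon>' \<Upsilon>"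
      and ?Q = "spin_transition \<Psi> \<Psi>'" and ?R = "spin_transition \<Psi>' \<Psi>"
    have inv: "?T q = matrix_inv (?S q)" "?R q = matrix_inv (?Q q)" if "q \<in> U \<inter> U'" for q
      using tcoord_transition[OF T(1) _ T(2), of q] spin_dual_transition[OF B(1) _ B(2), of q] that
      by (auto simp: tangent_transition_def spin_transition_def matrix_inv_eq)
    have pre: "?pre ?S ?Q ?T ?R"
      using inv tcoord_expand[OF T(1)] tangent_frame_tangent[OF T(2)] spin_dual_expand[OF B(1)] frame_in_fibre[OF B(2)]
      by (auto simp: tangent_transition_def spin_transition_def)
    have "connection_law C \<Upsilon> (U,\<Upsilon>,\<Psi>) (U',\<Upsilon>',\<Psi>') S T' Q R p \<longleftrightarrow>
        connection_law C \<Upsilon> (U,\<Upsilon>,\<Psi>) (U',\<Upsilon>',\<Psi>') ?S ?T ?Q ?R p"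
      if P: "?pre S Q T' R" and p: "p \<in> U \<inter> U'" for S Q T' R p
    proof -
      have S: "S q = ?S q" "Q q = ?Q q" if "q \<in> U \<inter> U'" for q
        using P that tcoord_sum[OF T(1), of q] spin_dual_sum[OF B(1), of q]
        by (auto simp: tangent_transition_def spin_transition_def vec_eq_iff)
      then have T': "T' q = ?T q" "R q = ?R q" if "q \<in> U \<inter> U'" for q
        using P that inv[OF that] by auto
      have t: "\<Upsilon> i p \<in> tangent A p" for i using tangent_frame_tangent[OF T(1)] p by simp
      have "\<Upsilon> i p (\<lambda>q. T' q $ a $ j) = \<Upsilon> i p (\<lambda>q. ?T q $ a $ j)" for i a j
        by (rule tangent_local[OF t o p]) (simp add: T')
      moreover have "lie (\<Upsilon> i p) (\<lambda>q. R q $ a $ j) = lie (\<Upsilon> i p) (\<lambda>q. ?R q $ a $ j)" for i a j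
        by (rule lie_local[OF t o p]) (simp add: T')
      ultimately show ?thesis
        unfolding connection_law_def S[OF p] T'[OF p] by simp
    qed
    then show ?thesis using pre by blast
  qed
  show ?thesis
    unfolding spinor_connection_def connection_law_def[symmetric] by (simp only: law cong: imp_cong)
qed

end

lemma sum_if: "(\<Sum>i\<in>I. if P then f i else 0) = (if P then \<Sum>i\<in>I. f i else 0)"
  by simp

context smooth_bundle
begin

lemma frame_pairD:
  assumes "frame_pair A E (U,\<Upsilon>,\<Psi>)"
  shows "tangent_frame A U \<Upsilon>" "bundle_frame A E U \<Psi>" "open U"
  using assms by (auto simp: frame_pair_def bundle_frame_def)

lemma smooth_spin_transition:
  assumes "bundle_frame A E U \<Psi>" "bundle_frame A E U' \<Psi>'"
  shows "smooth_fun A (U \<inter> U') (\<lambda>p. spin_transition \<Psi> \<Psi>' p $ j $ i)"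
  using smooth_spin_dual[OF assms(1), of U' "\<Psi>' i" j] assms(2)
  by (simp add: spin_transition_def bundle_frame_def)

lemma spin_transition_inverse:
  assumes "bundle_frame A E U \<Psi>" "p \<in> U" "bundle_frame A E U' \<Psi>'" "p \<in> U'"
  shows "spin_transition \<Psi> \<Psi>' p ** spin_transition \<Psi>' \<Psi> p = mat 1"
  using spin_dual_transition[OF assms] by (simp add: spin_transition_def)

lemma tangent_transition_inverse:
  assumes "tangent_frame A U \<Upsilon>" "p \<in> U" "tangent_frame A U' \<Upsilon>'" "p \<in> U'"
  shows "tangent_transition \<Upsilon> \<Upsilon>' p ** tangent_transition \<Upsilon>' \<Upsilon> p = mat 1"
  using tcoord_transition[OF assms] by (simp add: tangent_transition_def)

lemma connection_lawD:
  assumes "spinor_connection A E C" "frame_pair A E (U,\<Upsilon>,\<Psi>)" "frame_pair A E (U',\<Upsilon>',\<Psi>')" "p \<in> U" "p \<in> U'"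
  shows "connection_law C \<Upsilon> (U,\<Upsilon>,\<Psi>) (U',\<Upsilon>',\<Psi>') (tangent_transition \<Upsilon> \<Upsilon>') (tangent_transition \<Upsilon>' \<Upsilon>)
          (spin_transition \<Psi> \<Psi>') (spin_transition \<Psi>' \<Psi>) p"
  using assms unfolding spinor_connection_iff by blast

lemma tangent_transition_self:
  "tangent_frame A U \<Upsilon> \<Longrightarrow> p \<in> U \<Longrightarrow> tangent_transition \<Upsilon> \<Upsilon> p = mat 1"
  by (simp add: tangent_transition_def tcoord_frame mat_def vec_eq_iff)

lemma spin_transition_self:
  "bundle_frame A E U \<Psi> \<Longrightarrow> p \<in> U \<Longrightarrow> spin_transition \<Psi> \<Psi> p = mat 1"
  by (simp add: spin_transition_def spin_dual_frame mat_def vec_eq_iff)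

context
  fixes C U \<Upsilon> \<Psi> U' \<Psi>' p
  assumes C: "spinor_connection A E C" and F: "frame_pair A E (U,\<Upsilon>,\<Psi>)" and F': "frame_pair A E (U',\<Upsilon>,\<Psi>')"
    and p: "p \<in> U" "p \<in> U'"
begin

text \<open>For a fixed tangent frame, \<open>\<Gamma>\<close> does not see the spinor frame nor the domain, and the law for \<open>A\<close> loses the
  tangent transition matrices.\<close>

lemma conG_spin_frame_change: "conG C (U,\<Upsilon>,\<Psi>) k i j p = conG C (U',\<Upsilon>,\<Psi>') k i j p"
proof -
  note T = frame_pairD(1)[OF F]
  have "\<Upsilon> i p (\<lambda>q. tangent_transition \<Upsilon> \<Upsilon> q $ a $ j) = 0" for i a j
    using tangent_local[OF tangent_frame_tangent[OF T p(1)] frame_pairD(3)[OF F] p(1),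
        of "\<lambda>q. tangent_transition \<Upsilon> \<Upsilon> q $ a $ j" "\<lambda>q. mat 1 $ a $ j"]
      tangent_transition_self[OF T] tangent_const[OF tangent_frame_tangent[OF T p(1)]]
    by simp
  then show ?thesis
    using connection_lawD[OF C F F' p] unfolding connection_law_def
    by (simp add: tangent_transition_self[OF T p(1)] mat_def if_distrib[of complex_of_real]
        if_distrib[of "\<lambda>x. x * _"] sum_if cong: if_cong)
qed

lemma conA_spin_frame_change:
  "conA C (U,\<Upsilon>,\<Psi>) k i j p =
     (\<Sum>a\<in>UNIV. \<Sum>b\<in>UNIV. spin_transition \<Psi> \<Psi>' p $ k $ a * spin_transition \<Psi>' \<Psi> p $ b $ j *
        conA C (U',\<Upsilon>,\<Psi>') a i b p) +
     (\<Sum>a\<in>UNIV. spin_transition \<Psi> \<Psi>' p $ k $ a * lie (\<Upsilon> i p) (\<lambda>q. spin_transition \<Psi>' \<Psi> q $ a $ j))"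
  using connection_lawD[OF C F F' p] unfolding connection_law_def
  by (simp add: tangent_transition_self[OF frame_pairD(1)[OF F] p(1)] mat_def if_distrib[of complex_of_real]
        if_distrib[of "\<lambda>x. x * _"] if_distrib[of "\<lambda>x. _ * x"] cong: if_cong)

end

lemma conA_restrict:
  assumes C: "spinor_connection A E C" and F: "frame_pair A E (U,\<Upsilon>,\<Psi>)" and W: "open W" "W \<subseteq> U" "p \<in> W"
  shows "conA C (U,\<Upsilon>,\<Psi>) k i j p = conA C (W,\<Upsilon>,\<Psi>) k i j p"
proof -
  note B = frame_pairD(2)[OF F] and F' = frame_pair_subset[OF F W(1,2)]
  have p: "p \<in> U" using W by auto
  have t: "\<Upsilon> i p \<in> tangent A p" for i by (rule tangent_frame_tangent[OF frame_pairD(1)[OF F] p])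
  have "lie (\<Upsilon> i p) (\<lambda>q. spin_transition \<Psi> \<Psi> q $ a $ j) = 0" for i a j
    using lie_local[OF t W(1,3), of "\<lambda>q. spin_transition \<Psi> \<Psi> q $ a $ j" "\<lambda>q. mat 1 $ a $ j"]
      spin_transition_self[OF B] lie_const[OF t] W(2) by (simp add: subset_iff)
  then show ?thesis
    unfolding conA_spin_frame_change[OF C F F' p W(3)]
    by (simp add: spin_transition_self[OF B p] mat_def if_distrib[of "\<lambda>x. x * _"] sum_if cong: if_cong)
qed

lemma nabla_vector_component:
  "nabla C (U,\<Upsilon>,\<Psi>) (components A E (U,\<Upsilon>,\<Psi>) (vector_field s)) r [k] [] [] [] [] [] p =
     lie (\<Upsilon> r p) (\<lambda>q. spin_dual E \<Psi> k q (s q)) + (\<Sum>v\<in>UNIV. conA C (U,\<Upsilon>,\<Psi>) k r v p * spin_dual E \<Psi> v p (s p))"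
  by (simp add: nabla_def components_def vector_field_def)

text \<open>The inhomogeneous term of the transformation law is what makes the covariant derivative of a section
  independent of the frame.\<close>

lemma nabla_section_frame_change:
  assumes C: "spinor_connection A E C" and F: "frame_pair A E (U,\<Upsilon>,\<Psi>)" and F': "frame_pair A E (U',\<Upsilon>,\<Psi>')"
    and p: "p \<in> U" "p \<in> U'" and s: "smooth_section A E W s" "open W" "p \<in> W"
  shows "nabla_section A E C (U,\<Upsilon>,\<Psi>) r s p = nabla_section A E C (U',\<Upsilon>,\<Psi>') r s p"
proof -
  note B = frame_pairD(2)[OF F] and B' = frame_pairD(2)[OF F']
  let ?Q = "spin_transition \<Psi> \<Psi>'" and ?R = "spin_transition \<Psi>' \<Psi>"
  let ?A = "\<lambda>k j. conA C (U,\<Upsilon>,\<Psi>) k r j p" and ?A' = "\<lambda>k j. conA C (U',\<Upsilon>,\<Psi>') k r j p"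
  define x where "x k q = spin_dual E \<Psi> k q (s q)" for k q
  define x' where "x' k q = spin_dual E \<Psi>' k q (s q)" for k q
  have o: "open (U \<inter> U' \<inter> W)" "p \<in> U \<inter> U' \<inter> W" using frame_pairD(3)[OF F] frame_pairD(3)[OF F'] s p by auto
  have t: "\<Upsilon> r p \<in> tangent A p" by (rule tangent_frame_tangent[OF frame_pairD(1)[OF F] p(1)])
  have x': "x' a q = (\<Sum>j\<in>UNIV. ?R q $ a $ j * x j q)" if q: "q \<in> U \<inter> U' \<inter> W" for a q
  proof -
    have sq: "s q \<in> fibre E q" using s q by (simp add: smooth_section_def)
    have "spin_dual E \<Psi>' a q (s q) = (\<Sum>j\<in>UNIV. spin_dual E \<Psi>' a q (\<Psi> j q) * spin_dual E \<Psi> j q (s q))"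
      using functional_expand[OF B _ spin_dual_functional[OF B'] sq] q by simp
    then show ?thesis by (simp add: x'_def x_def spin_transition_def)
  qed
  have dx: "differentiable_at p (x j)" for j
    unfolding x_def using smooth_spin_dual[OF B s(2,1)] p s(3) by (auto intro: smooth_imp_differentiable_at)
  have dR: "differentiable_at p (\<lambda>q. ?R q $ a $ j)" for a j
    by (rule smooth_imp_differentiable_at[OF smooth_spin_transition[OF B' B]]) (use p in auto)
  have lx': "lie (\<Upsilon> r p) (x' a) = (\<Sum>j\<in>UNIV. lie (\<Upsilon> r p) (\<lambda>q. ?R q $ a $ j) * x j p + ?R p $ a $ j * lie (\<Upsilon> r p) (x j))" for a
  proof -
    have "lie (\<Upsilon> r p) (x' a) = lie (\<Upsilon> r p) (\<lambda>q. \<Sum>j\<in>UNIV. ?R q $ a $ j * x j q)"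
      by (rule lie_local[OF t o]) (rule x')
    also have "\<dots> = (\<Sum>j\<in>UNIV. lie (\<Upsilon> r p) (\<lambda>q. ?R q $ a $ j * x j q))"
      by (rule lie_sum[OF t]) (auto intro: differentiable_at_mult dx dR)
    finally show ?thesis by (simp add: lie_mult[OF t dR dx])
  qed
  define y where "y a = lie (\<Upsilon> r p) (x' a) + (\<Sum>v\<in>UNIV. ?A' a v * x' v p)" for a
  have QR: "(\<Sum>a\<in>UNIV. ?Q p $ k $ a * ?R p $ a $ j) = (if k = j then 1 else 0)" for k j
    using spin_transition_inverse[OF B p(1) B' p(2)] by (simp add: matrix_matrix_mult_def mat_def vec_eq_iff)
  have Ay: "lie (\<Upsilon> r p) (x k) + (\<Sum>j\<in>UNIV. ?A k j * x j p) = (\<Sum>a\<in>UNIV. ?Q p $ k $ a * y a)" for k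
  proof -
    have 1: "(\<Sum>j\<in>UNIV. ?A k j * x j p) =
        (\<Sum>a\<in>UNIV. \<Sum>b\<in>UNIV. \<Sum>j\<in>UNIV. ?Q p $ k $ a * (?A' a b * (?R p $ b $ j * x j p))) +
        (\<Sum>a\<in>UNIV. \<Sum>j\<in>UNIV. ?Q p $ k $ a * (lie (\<Upsilon> r p) (\<lambda>q. ?R q $ a $ j) * x j p))"
    proof -
      have "(\<Sum>j\<in>UNIV. ?A k j * x j p) =
        (\<Sum>j\<in>UNIV. \<Sum>a\<in>UNIV. \<Sum>b\<in>UNIV. ?Q p $ k $ a * (?A' a b * (?R p $ b $ j * x j p))) +
        (\<Sum>j\<in>UNIV. \<Sum>a\<in>UNIV. ?Q p $ k $ a * (lie (\<Upsilon> r p) (\<lambda>q. ?R q $ a $ j) * x j p))"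
        unfolding conA_spin_frame_change[OF C F F' p]
        by (simp add: distrib_left distrib_right sum.distrib sum_distrib_left sum_distrib_right mult_ac)
      also have "(\<Sum>j\<in>UNIV. \<Sum>a\<in>UNIV. \<Sum>b\<in>UNIV. ?Q p $ k $ a * (?A' a b * (?R p $ b $ j * x j p))) =
         (\<Sum>a\<in>UNIV. \<Sum>j\<in>UNIV. \<Sum>b\<in>UNIV. ?Q p $ k $ a * (?A' a b * (?R p $ b $ j * x j p)))"
        by (rule sum.swap)
      also have "\<dots> = (\<Sum>a\<in>UNIV. \<Sum>b\<in>UNIV. \<Sum>j\<in>UNIV. ?Q p $ k $ a * (?A' a b * (?R p $ b $ j * x j p)))"
        by (rule sum.cong[OF refl], rule sum.swap)
      also have "(\<Sum>j\<in>UNIV. \<Sum>a\<in>UNIV. ?Q p $ k $ a * (lie (\<Upsilon> r p) (\<lambda>q. ?R q $ a $ j) * x j p)) =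
         (\<Sum>a\<in>UNIV. \<Sum>j\<in>UNIV. ?Q p $ k $ a * (lie (\<Upsilon> r p) (\<lambda>q. ?R q $ a $ j) * x j p))"
        by (rule sum.swap)
      finally show ?thesis .
    qed
    have "(\<Sum>a\<in>UNIV. \<Sum>j\<in>UNIV. ?Q p $ k $ a * (?R p $ a $ j * lie (\<Upsilon> r p) (x j))) = lie (\<Upsilon> r p) (x k)"
    proof -
      have "(\<Sum>a\<in>UNIV. \<Sum>j\<in>UNIV. ?Q p $ k $ a * (?R p $ a $ j * lie (\<Upsilon> r p) (x j))) =
        (\<Sum>j\<in>UNIV. (\<Sum>a\<in>UNIV. ?Q p $ k $ a * ?R p $ a $ j) * lie (\<Upsilon> r p) (x j))"
        by (subst sum.swap) (simp add: sum_distrib_left mult_ac)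
      then show ?thesis by (simp add: QR if_distrib[of "\<lambda>x. x * _"] cong: if_cong)
    qed
    then show ?thesis
      unfolding 1 y_def lx' x'[OF o(2)]
      by (simp add: distrib_left sum.distrib sum_distrib_left mult_ac)
  qed
  have "nabla_section A E C (U',\<Upsilon>,\<Psi>') r s p = (\<Sum>a\<in>UNIV. vscale E (y a) (\<Psi>' a p))"
    by (simp add: nabla_section_def nabla_vector_component y_def x'_def[abs_def])
  also have "\<dots> = (\<Sum>a\<in>UNIV. vscale E (y a) (\<Sum>k\<in>UNIV. vscale E (?Q p $ k $ a) (\<Psi> k p)))"
    using spin_dual_expand[OF B p(1) frame_in_fibre[OF B' p(2)]] by (simp add: spin_transition_def)
  also have "\<dots> = (\<Sum>k\<in>UNIV. \<Sum>a\<in>UNIV. vscale E (?Q p $ k $ a * y a) (\<Psi> k p))"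
    by (subst sum.swap) (simp add: vec.scale_sum_right mult.commute)
  also have "\<dots> = (\<Sum>k\<in>UNIV. vscale E (lie (\<Upsilon> r p) (x k) + (\<Sum>j\<in>UNIV. ?A k j * x j p)) (\<Psi> k p))"
    unfolding Ay by (simp add: vec.scale_sum_left)
  also have "\<dots> = nabla_section A E C (U,\<Upsilon>,\<Psi>) r s p"
    by (simp add: nabla_section_def nabla_vector_component x_def[abs_def])
  finally show ?thesis by simp
qed

end

section \<open>The Dirac bundle\<close>

text \<open>Block notation: Dirac indices are written as \<open>upper k\<close>, for the components in \<open>SM\<close>, or \<open>lower k\<close>, for those in
  the Hermitian conjugate bundle.\<close>

definition upper :: "2 \<Rightarrow> 4" where "upper k = (if k = 1 then 1 else 2)"
definition lower :: "2 \<Rightarrow> 4" where "lower k = (if k = 1 then 3 else 4)"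

lemma upper_simps [simp]: "upper 1 = 1" "upper 2 = 2" "lower 1 = 3" "lower 2 = 4"
  by (simp_all add: upper_def lower_def)

lemma upper_lower_neq [simp]: "upper k \<noteq> lower l" "lower l \<noteq> upper k"
  by (auto simp: upper_def lower_def)

lemma upper_inj [simp]: "upper k = upper l \<longleftrightarrow> k = l" and lower_inj [simp]: "lower k = lower l \<longleftrightarrow> k = l"
  using exhaust_2[of k] exhaust_2[of l] by auto

lemma upper_lower_cases:
  obtains k where "a = upper k" | k where "a = lower k"
  using exhaust_4[of a] by (metis upper_simps)

lemma all_blocks: "(\<forall>a. P a) \<longleftrightarrow> (\<forall>k. P (upper k)) \<and> (\<forall>k. P (lower k))"
  by (metis upper_lower_cases)

lemma sum_blocks: "(\<Sum>a\<in>UNIV. f a) = (\<Sum>k\<in>UNIV. f (upper k)) + (\<Sum>k\<in>UNIV. f (lower k))"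
  for f :: "4 \<Rightarrow> 'a::comm_monoid_add"
  by (simp add: sum_4 sum_2 add.assoc)

lemma vector_4:
  "(vector [x,y,z,w] :: 'a::zero^4) $ 1 = x" "(vector [x,y,z,w] :: 'a^4) $ 2 = y"
  "(vector [x,y,z,w] :: 'a^4) $ 3 = z" "(vector [x,y,z,w] :: 'a^4) $ 4 = w" "(vector [x,y,z,w] :: 'a^4) $ 0 = w"
  unfolding vector_def by simp_all

locale rank_two_bundle = smooth_bundle A S
  for A :: "'m::{t2_space,second_countable_topology} chart set"
    and S :: "('m, 'e::ab_group_add, 2) vbundle"
begin

abbreviation D where "D \<equiv> dirac_bundle S"
abbreviation antifunctionals where "antifunctionals p \<equiv> functionals (fibre S p) (vscale S) cnj"

lemma fibre_D: "fibre D p = fibre S p \<times> antifunctionals p"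
  and vscale_D: "vscale D c (v, z) = (vscale S c v, fscale c z)"
  by (simp_all add: dirac_bundle_def)

lemma dirac_frame_simps [simp]:
  "dirac_frame S \<Psi> (upper k) p = (\<Psi> k p, 0)"
  "dirac_frame S \<Psi> (lower k) p = (0, cnj \<circ> spin_dual S \<Psi> k p)"
  using exhaust_2[of k] by (auto simp: dirac_frame_def)

lemma vector_space_D: "vector_space (vscale D)"
proof -
  interpret f: vector_space "fscale :: complex \<Rightarrow> ('e \<Rightarrow> complex) \<Rightarrow> _" by (rule vector_space_fscale)
  show ?thesis
    by unfold_locales (auto simp: vscale_D vec.scale_left_distrib vec.scale_right_distrib
      f.scale_left_distrib f.scale_right_distrib split: prod.splits)
qed

sublocale Dvec: vector_space "vscale D" by (rule vector_space_D)

lemma subspace_D: "Dvec.subspace (fibre D p)"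
proof -
  have [simp]: "vscale D c w = (vscale S c (fst w), fscale c (snd w))" for c w
    by (cases w) (simp add: vscale_D)
  show ?thesis
    unfolding Dvec.subspace_def fibre_D
    by (auto simp: fibre_zero fibre_add fibre_scale functionals_def fscale_def algebra_simps zero_prod_def)
qed

lemma conj_spin_dual_antifunctional:
  "bundle_frame A S U \<Psi> \<Longrightarrow> p \<in> U \<Longrightarrow> cnj \<circ> spin_dual S \<Psi> k p \<in> antifunctionals p"
  using spin_dual_functional[of U \<Psi> p k] by (simp add: functionals_def)

lemma dirac_frame_in_fibre:
  "bundle_frame A S U \<Psi> \<Longrightarrow> p \<in> U \<Longrightarrow> dirac_frame S \<Psi> a p \<in> fibre D p"
  by (cases a rule: upper_lower_cases)
    (auto simp: fibre_D frame_in_fibre conj_spin_dual_antifunctional fibre_zero, simp add: functionals_def)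

lemma dirac_frame_sum:
  "(\<Sum>a\<in>UNIV. vscale D (c a) (dirac_frame S \<Psi> a p)) =
     ((\<Sum>k\<in>UNIV. vscale S (c (upper k)) (\<Psi> k p)),
      (\<Sum>k\<in>UNIV. fscale (c (lower k)) (cnj \<circ> spin_dual S \<Psi> k p)))"
  unfolding sum_blocks by (simp add: vscale_D sum_prod fscale_def zero_fun_def[symmetric])

text \<open>An antilinear functional is expanded in the conjugate dual frame by its values on the frame; off the fibre
  both sides vanish by convention.\<close>

lemma dirac_frame_expand:
  assumes B: "bundle_frame A S U \<Psi>" "p \<in> U" and w: "(v, z) \<in> fibre D p"
    and c: "\<And>k. c (upper k) = spin_dual S \<Psi> k p v" "\<And>k. c (lower k) = z (\<Psi> k p)"
  shows "(\<Sum>a\<in>UNIV. vscale D (c a) (dirac_frame S \<Psi> a p)) = (v, z)"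
proof -
  have v: "v \<in> fibre S p" and z: "z \<in> antifunctionals p" using w by (auto simp: fibre_D)
  have "(\<Sum>k\<in>UNIV. fscale (z (\<Psi> k p)) (cnj \<circ> spin_dual S \<Psi> k p)) x = z x" for x
  proof (cases "x \<in> fibre S p")
    case True
    then show ?thesis using antifunctional_expand[OF B z True] by (simp add: sum_fun fscale_def)
  next
    case False
    then show ?thesis using z by (simp add: sum_fun fscale_def spin_dual_outside[OF B] functionals_def)
  qed
  then show ?thesis
    unfolding dirac_frame_sum c using spin_dual_expand[OF B v] by auto
qed

lemma dirac_frame_coefficients:
  assumes B: "bundle_frame A S U \<Psi>" "p \<in> U"
    and w: "(\<Sum>a\<in>UNIV. vscale D (c a) (dirac_frame S \<Psi> a p)) = (v, z)"
  shows "c (upper k) = spin_dual S \<Psi> k p v" "c (lower k) = z (\<Psi> k p)"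
proof -
  have v: "v = (\<Sum>k\<in>UNIV. vscale S (c (upper k)) (\<Psi> k p))"
    and z: "z = (\<Sum>k\<in>UNIV. fscale (c (lower k)) (cnj \<circ> spin_dual S \<Psi> k p))"
    using w unfolding dirac_frame_sum by auto
  show "c (upper k) = spin_dual S \<Psi> k p v" unfolding v by (simp add: spin_dual_sum[OF B])
  show "c (lower k) = z (\<Psi> k p)"
    unfolding z by (simp add: sum_fun fscale_def spin_dual_frame[OF B] if_distrib cong: if_cong)
qed

definition dirac_triv :: "('m \<Rightarrow> 'e \<Rightarrow> complex^2) \<Rightarrow> 'm \<Rightarrow> 'e \<times> ('e \<Rightarrow> complex) \<Rightarrow> complex^4" where
  "dirac_triv \<Phi> p = (\<lambda>(v, z). vector [\<Phi> p v $ 1, \<Phi> p v $ 2,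
                  z (inv_into (fibre S p) (\<Phi> p) (axis 1 1)),
                  z (inv_into (fibre S p) (\<Phi> p) (axis 2 1))])"

lemma trivs_D: "trivs D = {(U, dirac_triv \<Phi>) | U \<Phi>. (U, \<Phi>) \<in> trivs S}"
  unfolding dirac_bundle_def dirac_triv_def by simp

lemma ball_trivs_D:
  "(\<forall>(V,\<Phi>)\<in>trivs D. P V \<Phi>) \<longleftrightarrow> (\<forall>V \<Phi>. (V,\<Phi>) \<in> trivs S \<longrightarrow> P V (dirac_triv \<Phi>))"
  unfolding trivs_D by auto

lemma dirac_triv_nth:
  "dirac_triv \<Phi> p (v, z) $ upper k = \<Phi> p v $ k"
  "dirac_triv \<Phi> p (v, z) $ lower k = z (inv_into (fibre S p) (\<Phi> p) (axis k 1))"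
  using exhaust_2[of k] by (auto simp: dirac_triv_def vector_4)

lemma spin_dual_triv_frame:
  assumes t: "(U,\<Phi>) \<in> trivs S" "p \<in> U" and v: "v \<in> fibre S p"
  shows "spin_dual S (\<lambda>i p. inv_into (fibre S p) (\<Phi> p) (axis i 1)) k p v = \<Phi> p v $ k"
proof -
  interpret coordinate_space "vscale S" "fibre S p" "\<Phi> p" by (rule triv_coordinates[OF t])
  have "(\<Sum>i\<in>UNIV. vscale S (\<Phi> p v $ i) (inv_into (fibre S p) (\<Phi> p) (axis i 1))) = v"
    by (rule \<Phi>_inj)
      (auto simp: \<Phi>_sum inv_into_in v fibre_sum fibre_scale vec_eq_iff axis_def if_distrib cong: if_cong)
  then show ?thesis
    using spin_dual_sum[OF triv_frame[OF t(1)] t(2), of k "\<lambda>i. \<Phi> p v $ i"] by simp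
qed

lemma smooth_section_D_iff:
  "smooth_section A D U w \<longleftrightarrow> (\<forall>p\<in>U. w p \<in> fibre D p) \<and>
     (\<forall>V \<Phi> a. (V,\<Phi>) \<in> trivs S \<longrightarrow> smooth_fun A (U \<inter> V) (\<lambda>p. dirac_triv \<Phi> p (w p) $ a))" if "open U"
proof -
  have "smooth_fun A (U \<inter> V) (\<lambda>p. dirac_triv \<Phi> p (w p)) \<longleftrightarrow>
      (\<forall>a. smooth_fun A (U \<inter> V) (\<lambda>p. dirac_triv \<Phi> p (w p) $ a))" if "(V,\<Phi>) \<in> trivs S" for V \<Phi>
  proof -
    have o: "open (U \<inter> V)" using open_triv[OF that] \<open>open U\<close> by blast
    show ?thesis
    proof
      show "\<forall>a. smooth_fun A (U \<inter> V) (\<lambda>p. dirac_triv \<Phi> p (w p) $ a)"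
        if "smooth_fun A (U \<inter> V) (\<lambda>p. dirac_triv \<Phi> p (w p))"
        using smooth_nth[OF o that] by simp
      show "smooth_fun A (U \<inter> V) (\<lambda>p. dirac_triv \<Phi> p (w p))"
        if "\<forall>a. smooth_fun A (U \<inter> V) (\<lambda>p. dirac_triv \<Phi> p (w p) $ a)"
        by (rule smooth_vec[OF o]) (use that in blast)
    qed
  qed
  then show ?thesis unfolding smooth_section_def ball_trivs_D by blast
qed

text \<open>The components of the conjugate dual frame in a trivialization are the conjugates of the coordinates of the
  frame of the trivialization with respect to \<open>\<Psi>\<close>; so smoothness comes from \<open>smooth_spin_dual\<close>.\<close>

lemma smooth_dirac_frame:
  assumes B: "bundle_frame A S U \<Psi>"
  shows "smooth_section A D U (dirac_frame S \<Psi> a)"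
proof -
  have U: "open U" using B by (simp add: bundle_frame_def)
  show ?thesis
    unfolding smooth_section_D_iff[OF U]
  proof (intro conjI ballI allI impI)
    show "dirac_frame S \<Psi> a p \<in> fibre D p" if "p \<in> U" for p by (rule dirac_frame_in_fibre[OF B that])
    fix V \<Phi> b assume t: "(V,\<Phi>) \<in> trivs S"
    have o: "open (U \<inter> V)" using U open_triv[OF t] by auto
    note e = triv_frame[OF t]
    have z: "\<Phi> p 0 = 0" if "p \<in> V" for p
      using coordinate_space.\<Phi>_sum[OF triv_coordinates[OF t that], of "{}" "\<lambda>_. 0" "\<lambda>_. 0"] by simp
    have s1: "smooth_fun A (U \<inter> V) (\<lambda>p. \<Phi> p (\<Psi> k p) $ l)" for k l
      using B smooth_section_triv[OF _ t, of U "\<Psi> k"] by (intro smooth_nth[OF o]) (simp add: bundle_frame_def)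
    have s2: "smooth_fun A (U \<inter> V) (\<lambda>p. cnj (spin_dual S \<Psi> k p (inv_into (fibre S p) (\<Phi> p) (axis l 1))))" for k l
      using smooth_spin_dual[OF B, of V _ k] e by (intro smooth_cnj[OF o]) (simp add: bundle_frame_def)
    have s3: "smooth_fun A (U \<inter> V) (\<lambda>p. \<Phi> p 0 $ l)" for l
      using smooth_fun_cong[OF o, of "\<lambda>p. \<Phi> p 0 $ l" "\<lambda>p. 0"] z smooth_const[of "U \<inter> V" 0] by simp
    show "smooth_fun A (U \<inter> V) (\<lambda>p. dirac_triv \<Phi> p (dirac_frame S \<Psi> a p) $ b)"
      by (cases a rule: upper_lower_cases; cases b rule: upper_lower_cases)
        (simp_all add: dirac_triv_nth s1 s2 s3 smooth_const)
  qed
qed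

text \<open>The trivialization of the Dirac bundle takes coordinates with respect to the Dirac frame of
  the frame that belongs to the trivialization of \<open>SM\<close>.\<close>

lemma dirac_triv_expand:
  assumes t: "(U,\<Phi>) \<in> trivs S" "p \<in> U"
  defines "e \<equiv> dirac_frame S (\<lambda>i p. inv_into (fibre S p) (\<Phi> p) (axis i 1))"
  shows "w \<in> fibre D p \<Longrightarrow> (\<Sum>a\<in>UNIV. vscale D (dirac_triv \<Phi> p w $ a) (e a p)) = w"
    and "dirac_triv \<Phi> p (\<Sum>a\<in>UNIV. vscale D (x $ a) (e a p)) = x"
    and "(\<Sum>a\<in>UNIV. vscale D (x $ a) (e a p)) \<in> fibre D p"
proof -
  note B = triv_frame[OF t(1)] t(2)
  show i: "(\<Sum>a\<in>UNIV. vscale D (x $ a) (e a p)) \<in> fibre D p" for x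
    unfolding e_def by (intro Dvec.subspace_sum[OF subspace_D] Dvec.subspace_scale[OF subspace_D] dirac_frame_in_fibre[OF B])
  show "(\<Sum>a\<in>UNIV. vscale D (dirac_triv \<Phi> p w $ a) (e a p)) = w" if w: "w \<in> fibre D p"
  proof -
    obtain v z where vz: "w = (v, z)" by (cases w)
    then have v: "v \<in> fibre S p" using w by (simp add: fibre_D)
    show ?thesis
      unfolding vz e_def by (rule dirac_frame_expand[OF B])
        (use w vz in \<open>simp_all add: dirac_triv_nth spin_dual_triv_frame[OF t v]\<close>)
  qed
  show "dirac_triv \<Phi> p (\<Sum>a\<in>UNIV. vscale D (x $ a) (e a p)) = x"
  proof -
    obtain v z where vz: "(\<Sum>a\<in>UNIV. vscale D (x $ a) (e a p)) = (v, z)" by (cases "\<Sum>a\<in>UNIV. vscale D (x $ a) (e a p)")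
    then have v: "v \<in> fibre S p" using i[of x] by (simp add: fibre_D)
    show ?thesis
      unfolding vz vec_eq_iff all_blocks dirac_triv_nth
      using dirac_frame_coefficients[OF B, of "\<lambda>a. x $ a" v z] vz[unfolded e_def] spin_dual_triv_frame[OF t v] by simp
  qed
qed

lemma dirac_triv_linear:
  assumes t: "(U,\<Phi>) \<in> trivs S" "p \<in> U" and w: "w \<in> fibre D p" "w' \<in> fibre D p"
  shows "dirac_triv \<Phi> p (w + w') = dirac_triv \<Phi> p w + dirac_triv \<Phi> p w'" (is ?g1)
    and "dirac_triv \<Phi> p (vscale D c w) = c *s dirac_triv \<Phi> p w" (is ?g2)
proof -
  interpret coordinate_space "vscale S" "fibre S p" "\<Phi> p" by (rule triv_coordinates[OF t])
  obtain v z v' z' where vz: "w = (v, z)" "w' = (v', z')" by (cases w, cases w')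
  have m: "v \<in> fibre S p" "v' \<in> fibre S p" using w by (auto simp: vz fibre_D)
  show ?g1
    unfolding vz vec_eq_iff all_blocks by (simp add: dirac_triv_nth \<Phi>_add m)
  show ?g2
    unfolding vz vec_eq_iff all_blocks vscale_D by (simp add: dirac_triv_nth \<Phi>_scale m fscale_def)
qed

lemma dirac_triv_coordinates:
  assumes t: "(U,\<Phi>) \<in> trivs S" "p \<in> U"
  shows "coordinate_space (vscale D) (fibre D p) (dirac_triv \<Phi> p)"
proof unfold_locales
  show "Dvec.subspace (fibre D p)" by (rule subspace_D)
  show "bij_betw (dirac_triv \<Phi> p) (fibre D p) UNIV"
    by (rule bij_betw_byWitness[where f'="\<lambda>x. \<Sum>a\<in>UNIV. vscale D (x $ a)
          (dirac_frame S (\<lambda>i p. inv_into (fibre S p) (\<Phi> p) (axis i 1)) a p)"])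
      (use dirac_triv_expand[OF t] in auto)
qed (use dirac_triv_linear[OF t] in auto)

lemma complex_vector_bundle_D: "complex_vector_bundle A D"
proof -
  have tr: "smooth_fun A (U \<inter> V) (\<lambda>p. dirac_triv \<Theta> p (inv_into (fibre D p) (dirac_triv \<Phi> p) x))"
    if t: "(U,\<Phi>) \<in> trivs S" and t': "(V,\<Theta>) \<in> trivs S" for U \<Phi> V \<Theta> x
  proof -
    let ?e = "dirac_frame S (\<lambda>i p. inv_into (fibre S p) (\<Phi> p) (axis i 1))"
    have o: "open (U \<inter> V)" "open U" using open_triv[OF t] open_triv[OF t'] by auto
    have "dirac_triv \<Theta> p (inv_into (fibre D p) (dirac_triv \<Phi> p) x) = (\<Sum>a\<in>UNIV. x $ a *s dirac_triv \<Theta> p (?e a p))"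
      if p: "p \<in> U \<inter> V" for p
    proof -
      interpret c: coordinate_space "vscale D" "fibre D p" "dirac_triv \<Phi> p"
        by (rule dirac_triv_coordinates[OF t]) (use p in simp)
      interpret c': coordinate_space "vscale D" "fibre D p" "dirac_triv \<Theta> p"
        by (rule dirac_triv_coordinates[OF t']) (use p in simp)
      have pU: "p \<in> U" using p by simp
      have "inv_into (fibre D p) (dirac_triv \<Phi> p) x = (\<Sum>a\<in>UNIV. vscale D (x $ a) (?e a p))"
        by (rule c.\<Phi>_inj[OF c.inv_into_in dirac_triv_expand(3)[OF t pU]])
          (simp add: dirac_triv_expand(2)[OF t pU])
      then show ?thesis
        by (simp add: c'.\<Phi>_sum dirac_frame_in_fibre[OF triv_frame[OF t] pU])
    qed
    moreover have "smooth_fun A (U \<inter> V) (\<lambda>p. \<Sum>a\<in>UNIV. x $ a *s dirac_triv \<Theta> p (?e a p))"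
    proof (rule smooth_vec[OF o(1)])
      fix b
      have "smooth_fun A (U \<inter> V) (\<lambda>p. dirac_triv \<Theta> p (?e a p) $ b)" for a
        using smooth_dirac_frame[OF triv_frame[OF t], of a] t' unfolding smooth_section_D_iff[OF o(2)] by blast
      then have "smooth_fun A (U \<inter> V) (\<lambda>p. \<Sum>a\<in>UNIV. x $ a * dirac_triv \<Theta> p (?e a p) $ b)"
        by (intro smooth_sum smooth_mult smooth_const o)
      then show "smooth_fun A (U \<inter> V) (\<lambda>p. (\<Sum>a\<in>UNIV. x $ a *s dirac_triv \<Theta> p (?e a p)) $ b)"
        by simp
    qed
    ultimately show ?thesis by (subst smooth_fun_cong[OF o(1)]) auto
  qed
  have cover: "(\<Union>(U,\<Phi>)\<in>trivs D. U) = UNIV"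
  proof -
    have "p \<in> (\<Union>(U,\<Phi>)\<in>trivs D. U)" for p
      by (rule triv_at[of p]) (auto simp: trivs_D)
    then show ?thesis by blast
  qed
  show ?thesis
    unfolding complex_vector_bundle_def
  proof (intro conjI cover)
    show "vector_space (vscale D)" "\<forall>p. Dvec.subspace (fibre D p)"
      using vector_space_D subspace_D by auto
    show "\<forall>(U, \<Phi>)\<in>trivs D. open U \<and> (\<forall>p\<in>U. bij_betw (\<Phi> p) (fibre D p) UNIV \<and>
        (\<forall>v\<in>fibre D p. \<forall>w\<in>fibre D p. \<Phi> p (v + w) = \<Phi> p v + \<Phi> p w) \<and>
        (\<forall>c. \<forall>v\<in>fibre D p. \<Phi> p (vscale D c v) = c *s \<Phi> p v))"
      using open_triv coordinate_space.bij[OF dirac_triv_coordinates] dirac_triv_linear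
      unfolding ball_trivs_D by blast
    show "\<forall>(U, \<Phi>)\<in>trivs D. \<forall>(V, \<Psi>)\<in>trivs D. \<forall>x.
       smooth_fun A (U \<inter> V) (\<lambda>p. \<Psi> p (inv_into (fibre D p) (\<Phi> p) x))"
      using tr unfolding ball_trivs_D by blast
  qed
qed

sublocale D: smooth_bundle A D
  by unfold_locales (rule complex_vector_bundle_D)

lemma dirac_frame_is_frame:
  assumes B: "bundle_frame A S U \<Psi>"
  shows "bundle_frame A D U (dirac_frame S \<Psi>)"
  unfolding bundle_frame_def
proof (intro conjI allI ballI impI)
  show "open U" using B by (simp add: bundle_frame_def)
  show "smooth_section A D U (dirac_frame S \<Psi> a)" for a by (rule smooth_dirac_frame[OF B])
  fix p a and c :: "4 \<Rightarrow> complex"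
  assume p: "p \<in> U" and c: "(\<Sum>a\<in>UNIV. vscale D (c a) (dirac_frame S \<Psi> a p)) = 0"
  from dirac_frame_coefficients[OF B p c[unfolded zero_prod_def]] spin_dual_sum[OF B p, of _ "\<lambda>_. 0"]
  show "c a = 0" by (cases a rule: upper_lower_cases) simp_all
qed

lemma spin_dual_D:
  assumes B: "bundle_frame A S U \<Psi>" "p \<in> U" and w: "(v, z) \<in> fibre D p"
  shows "spin_dual D (dirac_frame S \<Psi>) (upper k) p (v, z) = spin_dual S \<Psi> k p v"
    and "spin_dual D (dirac_frame S \<Psi>) (lower k) p (v, z) = z (\<Psi> k p)"
  using dirac_frame_coefficients[OF B D.spin_dual_expand[OF dirac_frame_is_frame[OF B(1)] B(2) w]] by simp_all

lemma zero_antifunctional: "0 \<in> antifunctionals p"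
  by (simp add: functionals_def)

lemma dirac_frame_pair: "frame_pair A S (U,\<Upsilon>,\<Psi>) \<Longrightarrow> frame_pair A D (U,\<Upsilon>,dirac_frame S \<Psi>)"
  by (simp add: frame_pair_def dirac_frame_is_frame)

text \<open>In the lower block the transition matrix is contragredient and conjugate, as the second half of a Dirac frame is
  the conjugate dual frame.\<close>

lemma dirac_spin_transition:
  assumes B: "bundle_frame A S U \<Psi>" "p \<in> U" and B': "bundle_frame A S U' \<Psi>'" "p \<in> U'"
  shows "D.spin_transition (dirac_frame S \<Psi>) (dirac_frame S \<Psi>') p $ upper k $ upper l = spin_transition \<Psi> \<Psi>' p $ k $ l" (is ?g1)
    "D.spin_transition (dirac_frame S \<Psi>) (dirac_frame S \<Psi>') p $ lower k $ lower l = cnj (spin_transition \<Psi>' \<Psi> p $ l $ k)" (is ?g2)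
    "D.spin_transition (dirac_frame S \<Psi>) (dirac_frame S \<Psi>') p $ upper k $ lower l = 0" (is ?g3)
    "D.spin_transition (dirac_frame S \<Psi>) (dirac_frame S \<Psi>') p $ lower k $ upper l = 0" (is ?g4)
proof -
  have z: "spin_dual S \<Psi> k p 0 = 0" using spin_dual_sum[OF B, of k "\<lambda>_. 0"] by simp
  note m = dirac_frame_in_fibre[OF B', of "upper l"] dirac_frame_in_fibre[OF B', of "lower l"]
  show ?g1 ?g2 ?g3 ?g4
    using m by (simp_all add: D.spin_transition_def spin_transition_def spin_dual_D[OF B] z)
qed

end

section \<open>Pauli matrices and Lorentz transformations\<close>

lemma four_eq_zero: "(4::4) = 0"
  by simp

lemma sum_0123: "(\<Sum>m\<in>UNIV. f m) = f 0 + f 1 + f 2 + f (3::4)"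
  by (simp add: sum_4 four_eq_zero add.commute add.left_commute)

lemma all_0123: "(\<forall>m. P m) \<longleftrightarrow> P 0 \<and> P 1 \<and> P 2 \<and> P (3::4)"
  unfolding forall_4 four_eq_zero by blast

lemma pauli_nth:
  "pauli 0 $ 1 $ 1 = 1" "pauli 0 $ 1 $ 2 = 0" "pauli 0 $ 2 $ 1 = 0" "pauli 0 $ 2 $ 2 = 1"
  "pauli 1 $ 1 $ 1 = 0" "pauli 1 $ 1 $ 2 = 1" "pauli 1 $ 2 $ 1 = 1" "pauli 1 $ 2 $ 2 = 0"
  "pauli 2 $ 1 $ 1 = 0" "pauli 2 $ 1 $ 2 = -\<i>" "pauli 2 $ 2 $ 1 = \<i>" "pauli 2 $ 2 $ 2 = 0"
  "pauli 3 $ 1 $ 1 = 1" "pauli 3 $ 1 $ 2 = 0" "pauli 3 $ 2 $ 1 = 0" "pauli 3 $ 2 $ 2 = -1"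
  by (simp_all add: pauli_def)

lemma pauli_hermitian: "cnj (pauli m $ j $ i) = pauli m $ i $ j"
proof -
  have "\<forall>m i j. cnj (pauli m $ j $ i) = pauli m $ i $ j"
    unfolding all_0123 forall_2 by (simp add: pauli_nth)
  then show ?thesis by blast
qed

lemma pauli_independent:
  assumes "(\<Sum>k\<in>UNIV. s k *\<^sub>R pauli k) = (\<Sum>k\<in>UNIV. t k *\<^sub>R pauli k)"
  shows "s k = t k"
proof -
  have "\<forall>i j. (\<Sum>k\<in>UNIV. s k *\<^sub>R pauli k) $ i $ j = (\<Sum>k\<in>UNIV. t k *\<^sub>R pauli k) $ i $ j"
    using assms by simp
  then have "\<forall>k. s k = t k"
    unfolding forall_2 all_0123 by (simp add: sum_0123 pauli_nth complex_eq_iff)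
  then show ?thesis by blast
qed

lemma hermitian_pauli_expansion:
  fixes H :: "complex^2^2"
  assumes "\<And>i j. cnj (H $ j $ i) = H $ i $ j"
  shows "\<exists>s. H = (\<Sum>k\<in>UNIV. s k *\<^sub>R pauli k)"
proof -
  define s where "s k = (if k = 0 then (Re (H $ 1 $ 1) + Re (H $ 2 $ 2)) / 2 else if k = 1 then Re (H $ 1 $ 2)
    else if k = 2 then - Im (H $ 1 $ 2) else (Re (H $ 1 $ 1) - Re (H $ 2 $ 2)) / 2)" for k :: 4
  have "H $ i $ j = (\<Sum>k\<in>UNIV. s k *\<^sub>R pauli k) $ i $ j" for i j
  proof -
    have "\<forall>i j. H $ i $ j = (\<Sum>k\<in>UNIV. s k *\<^sub>R pauli k) $ i $ j"
      unfolding forall_2 using assms[of 1 1] assms[of 1 2] assms[of 2 2]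
      by (simp add: sum_0123 pauli_nth complex_eq_iff s_def field_simps)
    then show ?thesis by blast
  qed
  then show ?thesis by (auto simp: vec_eq_iff)
qed

text \<open>Conjugation preserves Hermitian matrices, which are the real combinations of Pauli matrices.\<close>

lemma lorentz_of_pauli:
  "B ** pauli m ** adjoint_matrix B = (\<Sum>k\<in>UNIV. lorentz_of B $ k $ m *\<^sub>R pauli k)"
proof -
  have "\<exists>s. B ** pauli m ** adjoint_matrix B = (\<Sum>k\<in>UNIV. s k *\<^sub>R pauli k)" for m
  proof (rule hermitian_pauli_expansion)
    show "cnj ((B ** pauli m ** adjoint_matrix B) $ j $ i) = (B ** pauli m ** adjoint_matrix B) $ i $ j" for i j
      by (simp add: matrix_matrix_mult_def adjoint_matrix_def sum_2 pauli_hermitian algebra_simps)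
  qed
  then obtain s where s: "\<And>m. B ** pauli m ** adjoint_matrix B = (\<Sum>k\<in>UNIV. s m k *\<^sub>R pauli k)" by metis
  have "\<exists>!S. \<forall>m. B ** pauli m ** adjoint_matrix B = (\<Sum>k\<in>UNIV. S $ k $ m *\<^sub>R pauli k)"
  proof (rule ex1I[of _ "\<chi> k m. s m k"])
    show "\<forall>m. B ** pauli m ** adjoint_matrix B = (\<Sum>k\<in>UNIV. (\<chi> k m. s m k) $ k $ m *\<^sub>R pauli k)"
      using s by simp
    show "S = (\<chi> k m. s m k)" if "\<forall>m. B ** pauli m ** adjoint_matrix B = (\<Sum>k\<in>UNIV. S $ k $ m *\<^sub>R pauli k)" for S
    proof -
      have "(\<Sum>k\<in>UNIV. S $ k $ m *\<^sub>R pauli k) = (\<Sum>k\<in>UNIV. s m k *\<^sub>R pauli k)" for m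
        using that s by metis
      from pauli_independent[OF this] show ?thesis by (simp add: vec_eq_iff)
    qed
  qed
  from theI'[OF this] show ?thesis unfolding lorentz_of_def by blast
qed

text \<open>The adjugates of the Pauli matrices are \<open>\<sigma>\<^sub>0, -\<sigma>\<^sub>1, -\<sigma>\<^sub>2, -\<sigma>\<^sub>3\<close>, the lower left blocks of Dirac's matrices.\<close>

definition adjugate :: "complex^2^2 \<Rightarrow> complex^2^2" where
  "adjugate X = vector [vector [X $ 2 $ 2, - X $ 1 $ 2], vector [- X $ 2 $ 1, X $ 1 $ 1]]"

lemma adjugate_nth:
  "adjugate X $ 1 $ 1 = X $ 2 $ 2" "adjugate X $ 1 $ 2 = - X $ 1 $ 2"
  "adjugate X $ 2 $ 1 = - X $ 2 $ 1" "adjugate X $ 2 $ 2 = X $ 1 $ 1"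
  by (simp_all add: adjugate_def)

lemma adjugate_sum: "adjugate (\<Sum>k\<in>K. c k *\<^sub>R X k) $ i $ j = (\<Sum>k\<in>K. c k *\<^sub>R adjugate (X k) $ i $ j)"
proof -
  have "\<forall>i j. adjugate (\<Sum>k\<in>K. c k *\<^sub>R X k) $ i $ j = (\<Sum>k\<in>K. c k *\<^sub>R adjugate (X k) $ i $ j)"
    unfolding forall_2 by (simp add: adjugate_nth sum_negf)
  then show ?thesis by blast
qed

text \<open>The adjugate is antimultiplicative and \<open>adj(B) = B\<^sup>-\<^sup>1\<close> when \<open>det B = 1\<close>. Hence \<open>B\<^sup>\<dagger> adj(B X B\<^sup>\<dagger>) B = adj X\<close>: the
  adjugates of the Pauli matrices transform by the same Lorentz matrix as the Pauli matrices, with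
  \<open>B\<close> replaced by \<open>(B\<^sup>\<dagger>)\<^sup>-\<^sup>1\<close>.\<close>

lemma adjugate_congruence:
  assumes "det B = 1"
  shows "(\<Sum>k\<in>UNIV. \<Sum>l\<in>UNIV. adjugate (B ** X ** adjoint_matrix B) $ k $ l * cnj (B $ k $ i) * B $ l $ j) = adjugate X $ i $ j"
proof -
  have d: "B $ 1 $ 1 * B $ 2 $ 2 - B $ 1 $ 2 * B $ 2 $ 1 = 1" using assms by (simp add: det_2)
  then have d': "cnj (B $ 1 $ 1) * cnj (B $ 2 $ 2) - cnj (B $ 1 $ 2) * cnj (B $ 2 $ 1) = 1"
    by (metis complex_cnj_diff complex_cnj_mult complex_cnj_one)
  have "\<forall>i j. (\<Sum>k\<in>UNIV. \<Sum>l\<in>UNIV. adjugate (B ** X ** adjoint_matrix B) $ k $ l * cnj (B $ k $ i) * B $ l $ j) =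
     adjugate X $ i $ j * ((B $ 1 $ 1 * B $ 2 $ 2 - B $ 1 $ 2 * B $ 2 $ 1) *
       (cnj (B $ 1 $ 1) * cnj (B $ 2 $ 2) - cnj (B $ 1 $ 2) * cnj (B $ 2 $ 1)))"
    unfolding forall_2
    by (simp add: sum_2 adjugate_nth matrix_matrix_mult_def adjoint_matrix_def; intro conjI; algebra)
  then show ?thesis by (simp add: d d')
qed

lemma gamma_blocks:
  "dirac_gamma_matrix m $ upper k $ upper l = 0" (is ?g1) "dirac_gamma_matrix m $ lower k $ lower l = 0" (is ?g2)
  "dirac_gamma_matrix m $ upper k $ lower l = pauli m $ k $ l" (is ?g3)
  "dirac_gamma_matrix m $ lower k $ upper l = adjugate (pauli m) $ k $ l" (is ?g4)
proof -
  have "\<forall>m k l. dirac_gamma_matrix m $ upper k $ upper l = 0 \<and> dirac_gamma_matrix m $ lower k $ lower l = 0 \<and>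
    dirac_gamma_matrix m $ upper k $ lower l = pauli m $ k $ l \<and>
    dirac_gamma_matrix m $ lower k $ upper l = adjugate (pauli m) $ k $ l"
    unfolding all_0123 forall_2 by (simp add: dirac_gamma_matrix_def vector_4 pauli_nth adjugate_nth)
  then show ?g1 ?g2 ?g3 ?g4 by blast+
qed

definition symplectic :: "2 \<Rightarrow> 2 \<Rightarrow> complex" where
  "symplectic k l = (vector [vector [0, 1], vector [-1, 0]] :: complex^2^2) $ k $ l"

lemma symplectic_simps [simp]:
  "symplectic 1 1 = 0" "symplectic 1 2 = 1" "symplectic 2 1 = -1" "symplectic 2 2 = 0"
  by (simp_all add: symplectic_def)

lemma metric_blocks:
  "dirac_metric_matrix $ upper k $ upper l = symplectic k l" (is ?g1) "dirac_metric_matrix $ lower k $ lower l = - symplectic k l" (is ?g2)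
  "dirac_metric_matrix $ upper k $ lower l = 0" (is ?g3) "dirac_metric_matrix $ lower k $ upper l = 0" (is ?g4)
proof -
  have "\<forall>k l. dirac_metric_matrix $ upper k $ upper l = symplectic k l \<and> dirac_metric_matrix $ lower k $ lower l = - symplectic k l \<and>
    dirac_metric_matrix $ upper k $ lower l = 0 \<and> dirac_metric_matrix $ lower k $ upper l = 0"
    unfolding forall_2 by (simp add: dirac_metric_matrix_def vector_4)
  then show ?g1 ?g2 ?g3 ?g4 by blast+
qed


section \<open>Chiral frames and the basic fields\<close>

locale spin_manifold =
  fixes M :: "'m::{t2_space,second_countable_topology} spacetime"
    and SM :: "('m, 'e::ab_group_add) chiral"
  assumes space_time: "space_time M" and spinor_bundle: "spinor_bundle M SM"
begin

sublocale rank_two_bundle "atlas M" "sbundle SM"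
proof unfold_locales
  show "oriented_atlas (atlas M)" using space_time unfolding space_time_def by blast
  show "complex_vector_bundle (atlas M) (sbundle SM)" using spinor_bundle unfolding spinor_bundle_def by (elim conjE)
qed

abbreviation A where "A \<equiv> atlas M"
abbreviation S where "S \<equiv> sbundle SM"
abbreviation d where "d \<equiv> spin_metric SM"
abbreviation chiral where "chiral \<equiv> chiral_orthonormal A SM"

lemma d_spin_field: "spin_field A S (0,2,0,0,0,0) (bilinear_field d)"
  and d_skew: "v \<in> fibre S p \<Longrightarrow> w \<in> fibre S p \<Longrightarrow> d p v w = - d p w v"
  and d_nonzero: "\<exists>v\<in>fibre S p. \<exists>w\<in>fibre S p. d p v w \<noteq> 0"
proof -
  show "spin_field A S (0,2,0,0,0,0) (bilinear_field d)"
    using spinor_bundle unfolding spinor_bundle_def by (elim conjE)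
  have "\<forall>p. \<forall>v\<in>fibre S p. \<forall>w\<in>fibre S p. d p v w = - d p w v"
    "\<forall>p. \<exists>v\<in>fibre S p. \<exists>w\<in>fibre S p. d p v w \<noteq> 0"
    using spinor_bundle unfolding spinor_bundle_def by - (elim conjE, assumption)+
  then show "v \<in> fibre S p \<Longrightarrow> w \<in> fibre S p \<Longrightarrow> d p v w = - d p w v"
    "\<exists>v\<in>fibre S p. \<exists>w\<in>fibre S p. d p v w \<noteq> 0" by blast+
qed

lemma d_bilinear:
  assumes v: "v \<in> fibre S p" and w: "w \<in> fibre S p"
  shows d_add_left: "u \<in> fibre S p \<Longrightarrow> d p (u + v) w = d p u w + d p v w"
    and d_scale_left: "d p (vscale S c v) w = c * d p v w"
    and d_add_right: "u \<in> fibre S p \<Longrightarrow> d p w (u + v) = d p w u + d p w v"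
    and d_scale_right: "d p w (vscale S c v) = c * d p w v"
proof -
  have "spin_tensor_at A S (0,2,0,0,0,0) p (bilinear_field d)"
    using d_spin_field unfolding spin_field_def by blast
  then have m: "multilinear (fibre S p) (vscale S) (\<lambda>c. c) 2 (\<lambda>x. d p (x ! 0) (x ! 1))"
    using v unfolding spin_tensor_at_def bilinear_field_def
    by (auto simp: tuples_def Let_def dest: spec[of _ "[v, v]"])
  have t: "[v, w] \<in> tuples (fibre S p) 2" using assms by (simp add: tuples_def)
  show 1: "d p (u + v) w = d p u w + d p v w" if "u \<in> fibre S p"
    using m t v that unfolding multilinear_def by force
  show 2: "d p (vscale S c v) w = c * d p v w"
    using m t v unfolding multilinear_def by force
  show "d p w (u + v) = d p w u + d p w v" if "u \<in> fibre S p"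
    using 1[OF that] d_skew[OF w, of "u + v"] d_skew[OF w that] d_skew[OF w v] fibre_add[OF that v] by simp
  show "d p w (vscale S c v) = c * d p w v"
    using 2 d_skew[OF w, of "vscale S c v"] d_skew[OF w v] fibre_scale[OF v] by simp
qed

lemma d_frame:
  assumes B: "bundle_frame A S U \<Psi>" "p \<in> U" and v: "v \<in> fibre S p" "w \<in> fibre S p"
  shows "d p v w = d p (\<Psi> 1 p) (\<Psi> 2 p) *
     (spin_dual S \<Psi> 1 p v * spin_dual S \<Psi> 2 p w - spin_dual S \<Psi> 2 p v * spin_dual S \<Psi> 1 p w)"
proof -
  note f = frame_in_fibre[OF B]
  have e: "x = vscale S (spin_dual S \<Psi> 1 p x) (\<Psi> 1 p) + vscale S (spin_dual S \<Psi> 2 p x) (\<Psi> 2 p)" if "x \<in> fibre S p" for x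
    using spin_dual_expand[OF B that] by (simp add: sum_2)
  have z: "d p x x = 0" if "x \<in> fibre S p" for x using d_skew[OF that that] by simp
  have s: "d p (\<Psi> 2 p) (\<Psi> 1 p) = - d p (\<Psi> 1 p) (\<Psi> 2 p)" by (rule d_skew[OF f f])
  show ?thesis
    by (subst (1) e[OF v(1)], subst (1) e[OF v(2)])
      (simp add: d_bilinear f fibre_add fibre_scale z s algebra_simps)
qed

lemma chiral_frame:
  assumes "chiral U \<Psi>"
  shows "bundle_frame A S U \<Psi>" "p \<in> U \<Longrightarrow> d p (\<Psi> i p) (\<Psi> j p) = symplectic i j"
    "tangent_frame A U (assoc SM U \<Psi>)"
    "p \<in> U \<Longrightarrow> metric M p (assoc SM U \<Psi> a p) (assoc SM U \<Psi> b p) = minkowski a b"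
proof -
  show "bundle_frame A S U \<Psi>" "p \<in> U \<Longrightarrow> d p (\<Psi> i p) (\<Psi> j p) = symplectic i j"
    using assms by (auto simp: chiral_orthonormal_def symplectic_def)
  have "\<forall>U \<Psi>. chiral U \<Psi> \<longrightarrow> pol_right_orthonormal M U (assoc SM U \<Psi>)"
    using spinor_bundle unfolding spinor_bundle_def by (elim conjE)
  then have "pol_right_orthonormal M U (assoc SM U \<Psi>)" using assms by blast
  then show "tangent_frame A U (assoc SM U \<Psi>)"
    "p \<in> U \<Longrightarrow> metric M p (assoc SM U \<Psi> a p) (assoc SM U \<Psi> b p) = minkowski a b"
    by (auto simp: pol_right_orthonormal_def)
qed

text \<open>Rescaling one vector of any local frame makes it orthonormal.\<close>

lemma chiral_at: obtains U \<Psi> where "chiral U \<Psi>" "p \<in> U"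
proof -
  obtain V \<Phi> where t: "(V,\<Phi>) \<in> trivs S" "p \<in> V" using triv_at .
  obtain W \<phi> where c: "(W,\<phi>) \<in> A" "p \<in> W" using chart_at .
  define U where "U = V \<inter> W"
  define e where "e = (\<lambda>i p. inv_into (fibre S p) (\<Phi> p) (axis i 1))"
  have U: "open U" using open_triv[OF t(1)] chartD(1)[OF c(1)] by (auto simp: U_def)
  have eU: "bundle_frame A S U e"
    unfolding e_def by (rule bundle_frame_subset[OF triv_frame[OF t(1)] U]) (auto simp: U_def)
  have "frame_pair A S (U, \<lambda>i p. dir_deriv (W,\<phi>) p (axis i 1), e)"
    using eU tangent_frame_subset[OF coordinate_tangent_frame[OF c(1)] U] by (auto simp: frame_pair_def U_def)
  then have "smooth_fun A U (components A S (U, \<lambda>i p. dir_deriv (W,\<phi>) p (axis i 1), e) (bilinear_field d) [] [1,2] [] [] [] [])"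
    using d_spin_field unfolding spin_field_def by (auto simp: has_type_def)
  then have sd: "smooth_fun A U (\<lambda>q. d q (e 1 q) (e 2 q))"
    by (simp add: components_def bilinear_field_def)
  have nz: "d q (e 1 q) (e 2 q) \<noteq> 0" if "q \<in> U" for q
    using d_nonzero[of q] d_frame[OF eU that] by fastforce
  define f where "f q = inverse (d q (e 1 q) (e 2 q))" for q
  have sf: "smooth_fun A U f" unfolding f_def by (rule smooth_inverse[OF U sd nz])
  define \<Psi> where "\<Psi> i q = (if i = 1 then vscale S (f q) (e 1 q) else e 2 q)" for i :: 2 and q
  note ef = frame_in_fibre[OF eU]
  have "smooth_section A S U (\<Psi> i)" for i
  proof (cases "i = 1")
    case True
    show ?thesis
      unfolding smooth_section_def
    proof (intro conjI ballI, goal_cases)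
      case (1 q) then show ?case by (simp add: \<Psi>_def True fibre_scale ef)
    next
      case (2 x)
      obtain V' \<Theta> where x: "x = (V', \<Theta>)" by (cases x)
      then have t': "(V', \<Theta>) \<in> trivs S" using 2 by simp
      have o: "open (U \<inter> V')" using U open_triv[OF t'] by auto
      have s: "smooth_fun A (U \<inter> V') (\<lambda>q. f q * \<Theta> q (e 1 q) $ k)" for k
        using smooth_section_triv[OF _ t', of U "e 1"] eU sf
        by (intro smooth_mult o smooth_nth) (auto simp: bundle_frame_def intro: smooth_fun_subset)
      have "smooth_fun A (U \<inter> V') (\<lambda>q. \<Theta> q (\<Psi> i q) $ k)" for k
        by (subst smooth_fun_cong[OF o, where g="\<lambda>q. f q * \<Theta> q (e 1 q) $ k"])
          (use s in \<open>auto simp: \<Psi>_def True coordinate_space.\<Phi>_scale[OF triv_coordinates[OF t']] ef\<close>)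
      then show ?case unfolding x by (simp add: smooth_vec o)
    qed
  next
    case False
    then show ?thesis using eU by (simp add: \<Psi>_def[abs_def] bundle_frame_def)
  qed
  moreover have "c i = 0" if q: "q \<in> U" and c: "(\<Sum>i\<in>UNIV. vscale S (c i) (\<Psi> i q)) = 0" for q and c :: "2 \<Rightarrow> complex" and i :: 2
  proof -
    have "(\<Sum>i\<in>UNIV. vscale S (if i = 1 then c 1 * f q else c 2) (e i q)) = 0"
      using c by (simp add: sum_2 \<Psi>_def)
    then have "(if i = 1 then c 1 * f q else c 2) = 0" for i :: 2
      using spin_dual_sum[OF eU q, of i "\<lambda>i. if i = 1 then c 1 * f q else c 2"] spin_dual_sum[OF eU q, of i "\<lambda>_. 0"] by simp
    from this[of 1] this[of 2] show ?thesis using nz[OF q] exhaust_2[of i] by (auto simp: f_def)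
  qed
  ultimately have B: "bundle_frame A S U \<Psi>" using U by (simp add: bundle_frame_def)
  have "d q (\<Psi> i q) (\<Psi> j q) = symplectic i j" if q: "q \<in> U" for q i j
  proof -
    have z: "d q x x = 0" if "x \<in> fibre S q" for x using d_skew[OF that that] by simp
    have s: "d q (e 2 q) (e 1 q) = - d q (e 1 q) (e 2 q)" by (rule d_skew[OF ef[OF q] ef[OF q]])
    have "\<forall>i j. d q (\<Psi> i q) (\<Psi> j q) = symplectic i j"
      unfolding forall_2 using nz[OF q] by (simp add: \<Psi>_def z ef[OF q] fibre_scale d_bilinear s f_def)
    then show ?thesis by blast
  qed
  then have "chiral U \<Psi>" using B by (auto simp: chiral_orthonormal_def symplectic_def)
  then show thesis using that t c by (auto simp: U_def)
qed

text \<open>The determinant is the value of \<open>d\<close> on the new frame. By the definition of a spinor bundle the same matrix governs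
  the associated tangent frames.\<close>

lemma chiral_change:
  assumes c: "chiral U \<Psi>" "p \<in> U" and c': "chiral U' \<Psi>'" "p \<in> U'"
  shows "det (spin_transition \<Psi> \<Psi>' p) = 1"
    and "v \<in> fibre S p \<Longrightarrow>
      spin_dual S \<Psi> j p v = (\<Sum>i\<in>UNIV. spin_transition \<Psi> \<Psi>' p $ j $ i * spin_dual S \<Psi>' i p v)"
    and "u \<in> tangent A p \<Longrightarrow> tangent_dual A (assoc SM U \<Psi>) k p u =
      (\<Sum>q\<in>UNIV. of_real (lorentz_of (spin_transition \<Psi> \<Psi>' p) $ k $ q) * tangent_dual A (assoc SM U' \<Psi>') q p u)"
proof -
  note B = chiral_frame(1)[OF c(1)] c(2) and B' = chiral_frame(1)[OF c'(1)] c'(2)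
  note T = chiral_frame(3)[OF c(1)] c(2) and T' = chiral_frame(3)[OF c'(1)] c'(2)
  let ?B = "spin_transition \<Psi> \<Psi>' p" let ?L = "lorentz_of ?B"
  have 1: "\<Psi>' i p = (\<Sum>j\<in>UNIV. vscale S (?B $ j $ i) (\<Psi> j p))" for i
    using spin_dual_expand[OF B frame_in_fibre[OF B'], of i] by (simp add: spin_transition_def)
  show "spin_dual S \<Psi> j p v = (\<Sum>i\<in>UNIV. ?B $ j $ i * spin_dual S \<Psi>' i p v)" if "v \<in> fibre S p"
    using functional_expand[OF B' spin_dual_functional[OF B] that, of j] by (simp add: spin_transition_def)
  have "d p (\<Psi>' 1 p) (\<Psi>' 2 p) = 1" using chiral_frame(2)[OF c', of 1 2] by simp
  then show "det ?B = 1"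
    unfolding d_frame[OF B frame_in_fibre[OF B'] frame_in_fibre[OF B'], of 1 2] chiral_frame(2)[OF c]
    by (simp add: det_2 spin_transition_def algebra_simps)
  have "\<forall>U \<Psi> U' \<Psi>'. chiral U \<Psi> \<and> chiral U' \<Psi>' \<longrightarrow>
       (\<forall>p\<in>U \<inter> U'. \<forall>B::complex^2^2.
         (\<forall>i. \<Psi>' i p = (\<Sum>j\<in>UNIV. vscale S (B $ j $ i) (\<Psi> j p))) \<longrightarrow>
         (\<forall>i. assoc SM U' \<Psi>' i p = (\<Sum>j\<in>UNIV. fscale (lorentz_of B $ j $ i) (assoc SM U \<Psi> j p))))"
    using spinor_bundle unfolding spinor_bundle_def by (elim conjE)
  then have L: "assoc SM U' \<Psi>' i p = (\<Sum>j\<in>UNIV. fscale (?L $ j $ i) (assoc SM U \<Psi> j p))" for i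
    using c c' 1 by blast
  show "tangent_dual A (assoc SM U \<Psi>) k p u =
        (\<Sum>q\<in>UNIV. of_real (?L $ k $ q) * tangent_dual A (assoc SM U' \<Psi>') q p u)" if u: "u \<in> tangent A p"
  proof -
    interpret fs: vector_space "fscale :: real \<Rightarrow> 'm tvec \<Rightarrow> 'm tvec" by (rule vector_space_fscale)
    let ?t = "\<lambda>q. tcoord (assoc SM U' \<Psi>') q p u"
    have "u = (\<Sum>q\<in>UNIV. fscale (?t q) (\<Sum>j\<in>UNIV. fscale (?L $ j $ q) (assoc SM U \<Psi> j p)))"
      using tcoord_expand[OF T' u] by (simp add: L)
    also have "\<dots> = (\<Sum>j\<in>UNIV. fscale (\<Sum>q\<in>UNIV. ?L $ j $ q * ?t q) (assoc SM U \<Psi> j p))"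
      by (simp add: fs.scale_sum_right, subst sum.swap, simp add: fs.scale_sum_left mult.commute)
    finally have "tcoord (assoc SM U \<Psi>) k p u = (\<Sum>q\<in>UNIV. ?L $ k $ q * ?t q)"
      using tcoord_sum[OF T, of k "\<lambda>j. \<Sum>q\<in>UNIV. ?L $ j $ q * ?t q"] by simp
    then show ?thesis by (simp add: tangent_dual_eq)
  qed
qed

end

section \<open>Constant components of \<open>d\<close> and \<open>\<gamma>\<close>\<close>

text \<open>Here \<open>a\<close> is the matrix \<open>A\<^sub>r\<close> and \<open>g\<close> the matrix \<open>\<Gamma>\<^sub>r\<close> in an orthonormal frame and the associated tangent frame; the
  first two hypotheses are \<open>\<nabla>\<^sub>r d = 0\<close> and \<open>\<nabla>\<^sub>r \<gamma> = 0\<close> there. The equations are linear over the reals.\<close>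

lemma dirac_connection_algebra:
  fixes a :: "4 \<Rightarrow> 4 \<Rightarrow> complex" and g :: "4 \<Rightarrow> 4 \<Rightarrow> complex"
  assumes d: "\<And>i j. (\<Sum>w\<in>UNIV. a w i * dirac_metric_matrix $ w $ j) + (\<Sum>w\<in>UNIV. a w j * dirac_metric_matrix $ i $ w) = 0"
    and gamma: "\<And>i j m. (\<Sum>v\<in>UNIV. a i v * dirac_gamma_matrix m $ v $ j) - (\<Sum>w\<in>UNIV. a w j * dirac_gamma_matrix m $ i $ w)
        - (\<Sum>w\<in>UNIV. g w m * dirac_gamma_matrix w $ i $ j) = 0"
    and real: "\<And>w m. cnj (g w m) = g w m"
  shows "a (upper k) (lower l) = 0" (is ?g1) "a (lower k) (upper l) = 0" (is ?g2)
    "a (lower k) (lower l) = - cnj (a (upper l) (upper k))" (is ?g3)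
    "(\<Sum>w\<in>UNIV. g w m * of_real (minkowski w n)) + (\<Sum>w\<in>UNIV. g w n * of_real (minkowski m w)) = 0" (is ?g4)
proof -
  define r where "r w m = Re (g w m)" for w m
  have gr: "g w m = of_real (r w m)" for w m using real[of w m] by (simp add: complex_eq_iff r_def)
  define P where "P k l = a (upper k) (upper l)" for k l
  define X where "X k l = a (upper k) (lower l)" for k l
  define Y where "Y k l = a (lower k) (upper l)" for k l
  define N where "N k l = a (lower k) (lower l)" for k l
  have "(\<Sum>v\<in>UNIV. X k v * adjugate (pauli m) $ v $ l) - (\<Sum>w\<in>UNIV. Y w l * pauli m $ k $ w) = 0" for k l m
    using gamma[of "upper k" m "upper l"] by (simp add: sum_blocks gamma_blocks X_def Y_def)
  then have "\<forall>m k l. (\<Sum>v\<in>UNIV. X k v * adjugate (pauli m) $ v $ l) - (\<Sum>w\<in>UNIV. Y w l * pauli m $ k $ w) = 0"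
    by blast
  note E = this[unfolded all_0123 forall_2 sum_2 adjugate_nth pauli_nth, simplified]
  have "\<forall>k l. X k l = 0 \<and> Y k l = 0"
    unfolding forall_2 using E by (simp add: complex_eq_iff)
  then show ?g1 ?g2 by (auto simp: X_def Y_def)
  \<comment> \<open>the equation for \<open>d\<close> in its two diagonal blocks: \<open>P\<close> and \<open>N\<close> are traceless\<close>
  have tP: "P 2 2 = - P 1 1" using d[of "upper 1" "upper 2"]
    by (simp only: sum_blocks metric_blocks sum_2 symplectic_simps P_def[symmetric]) (simp add: add_eq_0_iff)
  have tN: "N 2 2 = - N 1 1" using d[of "lower 1" "lower 2"]
    by (simp only: sum_blocks metric_blocks sum_2 symplectic_simps N_def[symmetric]) (simp add: add_eq_0_iff)
  have "(\<Sum>v\<in>UNIV. P k v * pauli m $ v $ l) - (\<Sum>w\<in>UNIV. N w l * pauli m $ k $ w) - (\<Sum>w\<in>UNIV. g w m * pauli w $ k $ l) = 0" for k l m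
    using gamma[of "upper k" m "lower l"] by (simp add: sum_blocks[where 'a=complex and f="\<lambda>v. a _ v * _ v"] gamma_blocks P_def N_def sum_blocks[where f="\<lambda>w. a w _ * _ w"])
  note F = this
  \<comment> \<open>all sixteen entries, split into real and imaginary parts\<close>
  note re = arg_cong[OF F, of Re, unfolded sum_2 sum_0123]
  note im = arg_cong[OF F, of Im, unfolded sum_2 sum_0123]
  note Re = re[of 1 0 1] re[of 1 0 2] re[of 2 0 1] re[of 2 0 2]
    re[of 1 1 1] re[of 1 1 2] re[of 2 1 1] re[of 2 1 2]
    re[of 1 2 1] re[of 1 2 2] re[of 2 2 1] re[of 2 2 2]
    re[of 1 3 1] re[of 1 3 2] re[of 2 3 1] re[of 2 3 2]
  note Im = im[of 1 0 1] im[of 1 0 2] im[of 2 0 1] im[of 2 0 2]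
    im[of 1 1 1] im[of 1 1 2] im[of 2 1 1] im[of 2 1 2]
    im[of 1 2 1] im[of 1 2 2] im[of 2 2 1] im[of 2 2 2]
    im[of 1 3 1] im[of 1 3 2] im[of 2 3 1] im[of 2 3 2]
  note F' = Re[unfolded pauli_nth tP tN gr, simplified] Im[unfolded pauli_nth tP tN gr, simplified]
  have "\<forall>k l. N k l = - cnj (P l k)"
    unfolding forall_2 complex_eq_iff by (simp add: tP tN) (intro conjI; use F' in linarith)
  then show ?g3 by (simp add: P_def N_def)
  have "\<forall>m n. (\<Sum>w\<in>UNIV. g w m * of_real (minkowski w n)) + (\<Sum>w\<in>UNIV. g w n * of_real (minkowski m w)) = 0"
    unfolding all_0123 by (simp add: sum_0123 minkowski_def complex_eq_iff gr) (intro conjI; use F' in linarith)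
  then show ?g4 by blast
qed

lemma sum_blocks2:
  fixes f :: "4 \<Rightarrow> 4 \<Rightarrow> 'a::comm_monoid_add"
  shows "(\<Sum>a\<in>UNIV. \<Sum>b\<in>UNIV. f a b) =
    (\<Sum>k\<in>UNIV. \<Sum>l\<in>UNIV. f (upper k) (upper l)) + (\<Sum>k\<in>UNIV. \<Sum>l\<in>UNIV. f (upper k) (lower l)) +
    ((\<Sum>k\<in>UNIV. \<Sum>l\<in>UNIV. f (lower k) (upper l)) + (\<Sum>k\<in>UNIV. \<Sum>l\<in>UNIV. f (lower k) (lower l)))"
  by (simp only: sum_blocks sum.distrib add_ac)

lemma fscale_zero: "fscale c (0 :: 'x \<Rightarrow> 's::mult_zero) = 0"
  by (simp add: fscale_def fun_eq_iff)

lemma the_common_value: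
  assumes "P a b" "\<And>a' b'. P a' b' \<Longrightarrow> f a' b' = f a b"
  shows "(THE z. \<forall>a b. P a b \<longrightarrow> z = f a b) = f a b"
  by (rule the_equality) (use assms in metis)+

lemma sum_form_swap:
  fixes c :: "'i::finite \<Rightarrow> complex" and M :: "'i \<Rightarrow> 2 \<Rightarrow> 2 \<Rightarrow> complex"
  shows "(\<Sum>m\<in>UNIV. c m * (\<Sum>k\<in>UNIV. \<Sum>l\<in>UNIV. M m k l * X k * Z l)) =
    (\<Sum>k\<in>UNIV. \<Sum>l\<in>UNIV. (\<Sum>m\<in>UNIV. c m * M m k l) * X k * Z l)"
  by (simp add: sum_2 distrib_left distrib_right sum.distrib sum_distrib_left sum_distrib_right mult_ac)

text \<open>Bilinear forms built from Pauli matrices (from their adjugates in the next lemma), with spinor arguments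
  transformed by \<open>B\<close>, are combined by the Lorentz matrix of \<open>B\<close>. Contracted with tangent coordinates, which
  transform by the same Lorentz matrix, they give invariant expressions.\<close>

lemma pauli_form_change:
  "(\<Sum>i\<in>UNIV. \<Sum>j\<in>UNIV. pauli q $ i $ j * (\<Sum>k\<in>UNIV. B $ k $ i * X k) * (\<Sum>l\<in>UNIV. cnj (B $ l $ j) * Z l)) =
   (\<Sum>m\<in>UNIV. of_real (lorentz_of B $ m $ q) * (\<Sum>k\<in>UNIV. \<Sum>l\<in>UNIV. pauli m $ k $ l * X k * Z l))"
proof -
  have e: "(\<Sum>m\<in>UNIV. of_real (lorentz_of B $ m $ q) * pauli m $ k $ l) = (B ** pauli q ** adjoint_matrix B) $ k $ l" for k l
    unfolding lorentz_of_pauli by (simp flip: scaleR_conv_of_real)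
  show ?thesis
    unfolding sum_form_swap e by (simp add: sum_2 matrix_matrix_mult_def adjoint_matrix_def algebra_simps)
qed

lemma adjugate_form_change:
  assumes "det B = 1"
  shows "(\<Sum>k\<in>UNIV. \<Sum>l\<in>UNIV. adjugate (pauli q) $ k $ l * X k * Y l) =
   (\<Sum>m\<in>UNIV. of_real (lorentz_of B $ m $ q) *
      (\<Sum>i\<in>UNIV. \<Sum>j\<in>UNIV. adjugate (pauli m) $ i $ j * (\<Sum>k\<in>UNIV. cnj (B $ i $ k) * X k) * (\<Sum>l\<in>UNIV. B $ j $ l * Y l)))"
proof -
  have e: "(\<Sum>m\<in>UNIV. of_real (lorentz_of B $ m $ q) * adjugate (pauli m) $ k $ l) =
      adjugate (B ** pauli q ** adjoint_matrix B) $ k $ l" for k l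
    unfolding lorentz_of_pauli adjugate_sum by (simp flip: scaleR_conv_of_real)
  have "(\<Sum>m\<in>UNIV. of_real (lorentz_of B $ m $ q) *
      (\<Sum>i\<in>UNIV. \<Sum>j\<in>UNIV. adjugate (pauli m) $ i $ j * (\<Sum>k\<in>UNIV. cnj (B $ i $ k) * X k) * (\<Sum>l\<in>UNIV. B $ j $ l * Y l))) =
    (\<Sum>i\<in>UNIV. \<Sum>j\<in>UNIV. (\<Sum>m\<in>UNIV. of_real (lorentz_of B $ m $ q) * adjugate (pauli m) $ i $ j) *
      (\<Sum>k\<in>UNIV. cnj (B $ i $ k) * X k) * (\<Sum>l\<in>UNIV. B $ j $ l * Y l))"
    by (rule sum_form_swap)
  also have "\<dots> = (\<Sum>k\<in>UNIV. \<Sum>l\<in>UNIV. (\<Sum>i\<in>UNIV. \<Sum>j\<in>UNIV.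
      adjugate (B ** pauli q ** adjoint_matrix B) $ i $ j * cnj (B $ i $ k) * B $ j $ l) * X k * Y l)"
    unfolding e by (simp add: sum_2 algebra_simps)
  also have "\<dots> = (\<Sum>k\<in>UNIV. \<Sum>l\<in>UNIV. adjugate (pauli q) $ k $ l * X k * Y l)"
    unfolding adjugate_congruence[OF assms] ..
  finally show ?thesis by simp
qed

context spin_manifold
begin

text \<open>The basic fields are definite descriptions of a common value over all chiral frames around a point. These are the
  expressions for one of the frames.\<close>

definition gamma_form :: "'m set \<Rightarrow> (2 \<Rightarrow> 'm \<Rightarrow> 'e) \<Rightarrow> 'm \<Rightarrow> ('e \<times> ('e \<Rightarrow> complex) \<Rightarrow> complex) \<Rightarrow>
    'e \<times> ('e \<Rightarrow> complex) \<Rightarrow> 'm tvec \<Rightarrow> complex" where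
  "gamma_form U \<Psi> p \<xi> w u = (\<Sum>a\<in>UNIV. \<Sum>b\<in>UNIV. \<Sum>m\<in>UNIV. dirac_gamma_matrix m $ a $ b *
              \<xi> (dirac_frame S \<Psi> a p) * spin_dual D (dirac_frame S \<Psi>) b p w *
              tangent_dual A (assoc SM U \<Psi>) m p u)"

definition infeld_form :: "'m set \<Rightarrow> (2 \<Rightarrow> 'm \<Rightarrow> 'e) \<Rightarrow> 'm \<Rightarrow> ('e \<Rightarrow> complex) \<Rightarrow> ('e \<Rightarrow> complex) \<Rightarrow> 'm tvec \<Rightarrow> complex" where
  "infeld_form U \<Psi> p \<xi> \<eta> u = (\<Sum>i\<in>UNIV. \<Sum>j\<in>UNIV. \<Sum>q\<in>UNIV. pauli q $ i $ j *
            \<xi> (\<Psi> i p) * \<eta> (\<Psi> j p) * tangent_dual A (assoc SM U \<Psi>) q p u)"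

abbreviation functionals_S where "functionals_S p \<equiv> functionals (fibre S p) (vscale S) (\<lambda>c. c)"
abbreviation functionals_D where "functionals_D p \<equiv> functionals (fibre D p) (vscale D) (\<lambda>c. c)"

lemma infeld_form_independent:
  assumes c: "chiral U \<Psi>" "p \<in> U" and c': "chiral U' \<Psi>'" "p \<in> U'" and u: "u \<in> tangent A p"
    and \<xi>: "\<xi> \<in> functionals_S p" and \<eta>: "\<eta> \<in> antifunctionals p"
  shows "infeld_form U' \<Psi>' p \<xi> \<eta> u = infeld_form U \<Psi> p \<xi> \<eta> u"
proof -
  note F = chiral_frame(1)[OF c(1)] c(2) and F' = chiral_frame(1)[OF c'(1)] c'(2)
  let ?B = "spin_transition \<Psi> \<Psi>' p" and ?t = "\<lambda>q. tangent_dual A (assoc SM U' \<Psi>') q p u"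
  have \<xi>': "\<xi> (\<Psi>' i p) = (\<Sum>k\<in>UNIV. ?B $ k $ i * \<xi> (\<Psi> k p))" for i
    using functional_expand[OF F \<xi> frame_in_fibre[OF F'], of i] by (simp add: spin_transition_def mult.commute)
  have \<eta>': "\<eta> (\<Psi>' i p) = (\<Sum>k\<in>UNIV. cnj (?B $ k $ i) * \<eta> (\<Psi> k p))" for i
    using antifunctional_expand[OF F \<eta> frame_in_fibre[OF F'], of i] by (simp add: spin_transition_def mult.commute)
  define w where "w m = (\<Sum>k\<in>UNIV. \<Sum>l\<in>UNIV. pauli m $ k $ l * \<xi> (\<Psi> k p) * \<eta> (\<Psi> l p))" for m
  have "infeld_form U' \<Psi>' p \<xi> \<eta> u = (\<Sum>q\<in>UNIV. (\<Sum>i\<in>UNIV. \<Sum>j\<in>UNIV. pauli q $ i $ j * \<xi> (\<Psi>' i p) * \<eta> (\<Psi>' j p)) * ?t q)"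
    unfolding infeld_form_def by (simp add: sum_2 sum.distrib distrib_right)
  also have "\<dots> = (\<Sum>q\<in>UNIV. (\<Sum>m\<in>UNIV. of_real (lorentz_of ?B $ m $ q) * w m) * ?t q)"
    unfolding \<xi>' \<eta>' pauli_form_change w_def ..
  also have "\<dots> = (\<Sum>m\<in>UNIV. w m * (\<Sum>q\<in>UNIV. of_real (lorentz_of ?B $ m $ q) * ?t q))"
    by (simp add: sum_distrib_left sum_distrib_right mult_ac) (rule sum.swap)
  also have "\<dots> = infeld_form U \<Psi> p \<xi> \<eta> u"
    unfolding infeld_form_def w_def chiral_change(3)[OF c c' u, symmetric] by (simp add: sum_2 sum.distrib distrib_right)
  finally show ?thesis .
qed

text \<open>The upper right block of \<open>\<gamma>\<close> is the Infeld-van der Waerden field; the lower left one is its analogue for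
  adjugates and the conjugate dual spinors.\<close>

lemma gamma_form_eq:
  assumes c: "chiral U \<Psi>" "p \<in> U" and w: "(v, z) \<in> fibre D p"
  shows "gamma_form U \<Psi> p \<xi> (v, z) u =
    infeld_form U \<Psi> p (\<lambda>x. \<xi> (x, 0)) z u +
    (\<Sum>m\<in>UNIV. (\<Sum>i\<in>UNIV. \<Sum>j\<in>UNIV. adjugate (pauli m) $ i $ j * \<xi> (0, cnj \<circ> spin_dual S \<Psi> i p) * spin_dual S \<Psi> j p v) *
       tangent_dual A (assoc SM U \<Psi>) m p u)"
  unfolding gamma_form_def infeld_form_def
  by (subst sum_blocks2)
    (simp add: gamma_blocks spin_dual_D[OF chiral_frame(1)[OF c(1)] c(2) w] sum_2 sum.distrib distrib_right)

lemma gamma_form_independent: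
  assumes c: "chiral U \<Psi>" "p \<in> U" and c': "chiral U' \<Psi>'" "p \<in> U'" and u: "u \<in> tangent A p"
    and \<xi>: "\<xi> \<in> functionals_D p" and w: "w \<in> fibre D p"
  shows "gamma_form U' \<Psi>' p \<xi> w u = gamma_form U \<Psi> p \<xi> w u"
proof -
  note F = chiral_frame(1)[OF c(1)] c(2) and F' = chiral_frame(1)[OF c'(1)] c'(2)
  note DF = dirac_frame_is_frame[OF F(1)] F(2) and DF' = dirac_frame_is_frame[OF F'(1)] F'(2)
  obtain v z where vz: "w = (v, z)" by (cases w)
  have v: "v \<in> fibre S p" and z: "z \<in> antifunctionals p" using w by (auto simp: vz fibre_D)
  let ?B = "spin_transition \<Psi> \<Psi>' p" and ?t = "\<lambda>q. tangent_dual A (assoc SM U' \<Psi>') q p u"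
  have "(\<lambda>x. \<xi> (x, 0)) \<in> functionals_S p"
  proof -
    have "\<xi> (x + y, 0) = \<xi> (x, 0) + \<xi> (y, 0)" "\<xi> (vscale S c x, 0) = c * \<xi> (x, 0)"
      if "x \<in> fibre S p" "y \<in> fibre S p" for x y c
    proof -
      have "(x, 0) \<in> fibre D p" "(y, 0) \<in> fibre D p" using that by (auto simp: fibre_D zero_antifunctional)
      then have "\<xi> ((x, 0) + (y, 0)) = \<xi> (x, 0) + \<xi> (y, 0)" "\<xi> (vscale D c (x, 0)) = c * \<xi> (x, 0)"
        using \<xi> unfolding functionals_def by blast+
      then show "\<xi> (x + y, 0) = \<xi> (x, 0) + \<xi> (y, 0)" "\<xi> (vscale S c x, 0) = c * \<xi> (x, 0)"
        by (simp_all add: vscale_D fscale_zero)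
    qed
    moreover have "\<xi> (x, 0) = 0" if "x \<notin> fibre S p" for x
      using \<xi> that unfolding functionals_def by (auto simp: fibre_D)
    ultimately show ?thesis unfolding functionals_def by auto
  qed
  note 1 = infeld_form_independent[OF c c' u this z]
  have X: "\<xi> (0, cnj \<circ> spin_dual S \<Psi> i p) = (\<Sum>k\<in>UNIV. cnj (?B $ i $ k) * \<xi> (0, cnj \<circ> spin_dual S \<Psi>' k p))" for i
  proof -
    have m: "(0, cnj \<circ> spin_dual S \<Psi> i p) \<in> fibre D p"
      using dirac_frame_in_fibre[OF F, of "lower i"] by simp
    have "spin_dual S \<Psi>' k p 0 = 0" for k using spin_dual_sum[OF F', of k "\<lambda>_. 0"] by simp
    then show ?thesis
      using D.functional_expand[OF DF' \<xi> m]
      by (simp add: sum_blocks spin_dual_D[OF F' m] spin_transition_def mult.commute)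
  qed
  note Y = chiral_change(2)[OF c c' v]
  define r where "r m = (\<Sum>i\<in>UNIV. \<Sum>j\<in>UNIV. adjugate (pauli m) $ i $ j * \<xi> (0, cnj \<circ> spin_dual S \<Psi> i p) * spin_dual S \<Psi> j p v)" for m
  have "(\<Sum>i\<in>UNIV. \<Sum>j\<in>UNIV. adjugate (pauli q) $ i $ j * \<xi> (0, cnj \<circ> spin_dual S \<Psi>' i p) * spin_dual S \<Psi>' j p v) =
      (\<Sum>m\<in>UNIV. of_real (lorentz_of ?B $ m $ q) * r m)" for q
    unfolding r_def X Y by (rule adjugate_form_change[OF chiral_change(1)[OF c c']])
  then have "(\<Sum>q\<in>UNIV. (\<Sum>i\<in>UNIV. \<Sum>j\<in>UNIV. adjugate (pauli q) $ i $ j * \<xi> (0, cnj \<circ> spin_dual S \<Psi>' i p) * spin_dual S \<Psi>' j p v) * ?t q) =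
      (\<Sum>q\<in>UNIV. (\<Sum>m\<in>UNIV. of_real (lorentz_of ?B $ m $ q) * r m) * ?t q)"
    by simp
  also have "\<dots> = (\<Sum>m\<in>UNIV. r m * (\<Sum>q\<in>UNIV. of_real (lorentz_of ?B $ m $ q) * ?t q))"
    by (simp add: sum_distrib_left sum_distrib_right mult_ac) (rule sum.swap)
  finally show ?thesis
    unfolding vz gamma_form_eq[OF c w[unfolded vz]] gamma_form_eq[OF c' w[unfolded vz]] 1
    by (simp add: r_def chiral_change(3)[OF c c' u])
qed

definition metric_form :: "(2 \<Rightarrow> 'm \<Rightarrow> 'e) \<Rightarrow> 'm \<Rightarrow> 'e \<times> ('e \<Rightarrow> complex) \<Rightarrow> 'e \<times> ('e \<Rightarrow> complex) \<Rightarrow> complex" where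
  "metric_form \<Psi> p w w' = (\<Sum>a\<in>UNIV. \<Sum>b\<in>UNIV. dirac_metric_matrix $ a $ b *
              spin_dual D (dirac_frame S \<Psi>) a p w * spin_dual D (dirac_frame S \<Psi>) b p w')"

lemma metric_form_eq:
  assumes c: "chiral U \<Psi>" "p \<in> U" and w: "(v, z) \<in> fibre D p" "(v', z') \<in> fibre D p"
  shows "metric_form \<Psi> p (v, z) (v', z') = d p v v' - (z (\<Psi> 1 p) * z' (\<Psi> 2 p) - z (\<Psi> 2 p) * z' (\<Psi> 1 p))"
proof -
  note F = chiral_frame(1)[OF c(1)] c(2)
  have v: "v \<in> fibre S p" "v' \<in> fibre S p" using w by (auto simp: fibre_D)
  show ?thesis
    unfolding metric_form_def d_frame[OF F v] chiral_frame(2)[OF c]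
    by (subst sum_blocks2)
      (simp only: metric_blocks spin_dual_D[OF F w(1)] spin_dual_D[OF F w(2)] sum_2 symplectic_simps, simp)
qed

text \<open>On the second summand the form changes by the conjugate of \<open>det B = 1\<close>.\<close>

lemma metric_form_independent:
  assumes c: "chiral U \<Psi>" "p \<in> U" and c': "chiral U' \<Psi>'" "p \<in> U'" and w: "w \<in> fibre D p" "w' \<in> fibre D p"
  shows "metric_form \<Psi>' p w w' = metric_form \<Psi> p w w'"
proof -
  note F = chiral_frame(1)[OF c(1)] c(2) and F' = chiral_frame(1)[OF c'(1)] c'(2)
  obtain v z v' z' where vz: "w = (v, z)" "w' = (v', z')" by (cases w, cases w')
  have z: "z \<in> antifunctionals p" "z' \<in> antifunctionals p" using w by (auto simp: vz fibre_D)
  let ?B = "spin_transition \<Psi> \<Psi>' p"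
  have Z: "y (\<Psi>' i p) = (\<Sum>k\<in>UNIV. cnj (?B $ k $ i) * y (\<Psi> k p))" if "y \<in> antifunctionals p" for y i
    using antifunctional_expand[OF F that frame_in_fibre[OF F'], of i] by (simp add: spin_transition_def mult.commute)
  have "cnj (det ?B) = 1" by (simp add: chiral_change(1)[OF c c'])
  then have dB: "cnj (?B $ 1 $ 1) * cnj (?B $ 2 $ 2) - cnj (?B $ 1 $ 2) * cnj (?B $ 2 $ 1) = 1"
    by (simp add: det_2)
  have "z (\<Psi>' 1 p) * z' (\<Psi>' 2 p) - z (\<Psi>' 2 p) * z' (\<Psi>' 1 p) =
     (cnj (?B $ 1 $ 1) * cnj (?B $ 2 $ 2) - cnj (?B $ 1 $ 2) * cnj (?B $ 2 $ 1)) *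
     (z (\<Psi> 1 p) * z' (\<Psi> 2 p) - z (\<Psi> 2 p) * z' (\<Psi> 1 p))"
    unfolding Z[OF z(1)] Z[OF z(2)] sum_2 by algebra
  then show ?thesis
    unfolding vz metric_form_eq[OF c w[unfolded vz]] metric_form_eq[OF c' w[unfolded vz]] dB by simp
qed

text \<open>By independence of the frame, the definite descriptions of the basic fields have the value computed in any one
  chiral frame.\<close>

lemma infeld_vdw_value:
  assumes c: "chiral U \<Psi>" "p \<in> U" and a: "\<xi> \<in> functionals_S p" "\<eta> \<in> antifunctionals p" "u \<in> tangent A p"
  shows "infeld_vdw A SM p [\<xi>] v [\<eta>] w \<theta> [u] = infeld_form U \<Psi> p \<xi> \<eta> u"
proof -
  have "infeld_vdw A SM p [\<xi>] v [\<eta>] w \<theta> [u] = (THE z. \<forall>U \<Psi>. chiral U \<Psi> \<and> p \<in> U \<longrightarrow> z = infeld_form U \<Psi> p \<xi> \<eta> u)"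
    by (simp add: infeld_vdw_def infeld_form_def)
  also have "\<dots> = infeld_form U \<Psi> p \<xi> \<eta> u"
    by (rule the_common_value[where P="\<lambda>U \<Psi>. chiral U \<Psi> \<and> p \<in> U"]) (use c in blast, elim conjE, rule infeld_form_independent[OF c _ _ a(3,1,2)])
  finally show ?thesis .
qed

lemma dirac_gamma_value:
  assumes c: "chiral U \<Psi>" "p \<in> U" and a: "\<xi> \<in> functionals_D p" "x \<in> fibre D p" "u \<in> tangent A p"
  shows "dirac_gamma A SM p [\<xi>] [x] \<eta> w \<theta> [u] = gamma_form U \<Psi> p \<xi> x u"
proof -
  have "dirac_gamma A SM p [\<xi>] [x] \<eta> w \<theta> [u] = (THE z. \<forall>U \<Psi>. chiral U \<Psi> \<and> p \<in> U \<longrightarrow> z = gamma_form U \<Psi> p \<xi> x u)"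
    by (simp add: dirac_gamma_def gamma_form_def Let_def)
  also have "\<dots> = gamma_form U \<Psi> p \<xi> x u"
    by (rule the_common_value[where P="\<lambda>U \<Psi>. chiral U \<Psi> \<and> p \<in> U"]) (use c in blast, elim conjE, rule gamma_form_independent[OF c _ _ a(3,1,2)])
  finally show ?thesis .
qed

lemma dirac_metric_value:
  assumes c: "chiral U \<Psi>" "p \<in> U" and a: "x \<in> fibre D p" "y \<in> fibre D p"
  shows "dirac_metric A SM p \<xi> [x, y] \<eta> w \<theta> u = metric_form \<Psi> p x y"
proof -
  have "dirac_metric A SM p \<xi> [x, y] \<eta> w \<theta> u = (THE z. \<forall>U \<Psi>. chiral U \<Psi> \<and> p \<in> U \<longrightarrow> z = metric_form \<Psi> p x y)"
    by (simp add: dirac_metric_def metric_form_def Let_def)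
  also have "\<dots> = metric_form \<Psi> p x y"
    by (rule the_common_value[where P="\<lambda>U \<Psi>. chiral U \<Psi> \<and> p \<in> U"]) (use c in blast, elim conjE, rule metric_form_independent[OF c _ _ a])
  finally show ?thesis .
qed


lemma chiral_frame_pair: "chiral U \<Psi> \<Longrightarrow> frame_pair A S (U, assoc SM U \<Psi>, \<Psi>)"
  using chiral_frame(1,3) by (simp add: frame_pair_def)

lemma spin_dual_zero:
  assumes "bundle_frame A S U \<Psi>" "p \<in> U"
  shows "spin_dual S \<Psi> k p 0 = 0"
  using spin_dual_sum[OF assms, of k "\<lambda>_. 0"] by simp

lemma d_zero: "v \<in> fibre S p \<Longrightarrow> d p v 0 = 0" "v \<in> fibre S p \<Longrightarrow> d p 0 v = 0"
  using d_scale_left[of v p v 0] d_scale_right[of v p v 0] by simp_all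

context
  fixes U \<Upsilon> \<Psi> q
  assumes F: "frame_pair A S (U,\<Upsilon>,\<Psi>)" and q: "q \<in> U"
begin

lemma dirac_frame_members:
  "(\<Psi> k q, 0) \<in> fibre D q" "(0, cnj \<circ> spin_dual S \<Psi> k q) \<in> fibre D q"
  using dirac_frame_in_fibre[OF frame_pairD(2)[OF F] q, of "upper k"]
    dirac_frame_in_fibre[OF frame_pairD(2)[OF F] q, of "lower k"] by simp_all

lemma dirac_metric_components:
  "components A D (U,\<Upsilon>,dirac_frame S \<Psi>) (dirac_metric A SM) [] [upper i, upper j] [] [] [] [] q =
     components A S (U,\<Upsilon>,\<Psi>) (bilinear_field d) [] [i, j] [] [] [] [] q" (is ?g1)
  "components A D (U,\<Upsilon>,dirac_frame S \<Psi>) (dirac_metric A SM) [] [upper i, lower j] [] [] [] [] q = 0" (is ?g2)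
  "components A D (U,\<Upsilon>,dirac_frame S \<Psi>) (dirac_metric A SM) [] [lower i, upper j] [] [] [] [] q = 0" (is ?g3)
proof -
  obtain U0 \<Psi>0 where c: "chiral U0 \<Psi>0" "q \<in> U0" using chiral_at .
  note m = dirac_frame_members and f = frame_in_fibre[OF frame_pairD(2)[OF F] q]
  show ?g1 ?g2 ?g3
    by (simp_all add: components_def bilinear_field_def dirac_metric_value[OF c] metric_form_eq[OF c] m d_zero f)
qed

text \<open>In any Dirac frame the block structure of \<open>\<gamma>\<close> is the same as in associated frames, and the upper right
  block has the components of \<open>G\<close>. Together with
  the relation between the diagonal blocks of the connection, this makes \<open>\<nabla>G = 0\<close> a part of \<open>\<nabla>\<gamma> = 0\<close> in every frame.\<close>

lemma dirac_gamma_components: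
  "components A D (U,\<Upsilon>,dirac_frame S \<Psi>) (dirac_gamma A SM) [upper i] [lower j] [] [] [] [m] q =
     components A S (U,\<Upsilon>,\<Psi>) (infeld_vdw A SM) [i] [] [j] [] [] [m] q" (is ?g1)
  "components A D (U,\<Upsilon>,dirac_frame S \<Psi>) (dirac_gamma A SM) [upper i] [upper j] [] [] [] [m] q = 0" (is ?g2)
  "components A D (U,\<Upsilon>,dirac_frame S \<Psi>) (dirac_gamma A SM) [lower i] [lower j] [] [] [] [m] q = 0" (is ?g3)
proof -
  obtain U0 \<Psi>0 where c: "chiral U0 \<Psi>0" "q \<in> U0" using chiral_at .
  note B = frame_pairD(2)[OF F] q and B0 = chiral_frame(1)[OF c(1)] c(2)
  note DB = dirac_frame_is_frame[OF B(1)] q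
  note mem = dirac_frame_members and f = frame_in_fibre[OF B]
  have u: "\<Upsilon> m q \<in> tangent A q" by (rule tangent_frame_tangent[OF frame_pairD(1)[OF F] q])
  have m0: "(\<Psi>0 k q, 0) \<in> fibre D q" "(0, cnj \<circ> spin_dual S \<Psi>0 k q) \<in> fibre D q" for k
    using dirac_frame_in_fibre[OF B0, of "upper k"] dirac_frame_in_fibre[OF B0, of "lower k"] by simp_all
  note fn = D.spin_dual_functional[OF DB]
  note gv = dirac_gamma_value[OF c fn _ u] and ge = gamma_form_eq[OF c]
  note sd = spin_dual_D[OF B]
  show ?g1
    by (simp add: components_def gv mem ge spin_dual_zero[OF B0]
        infeld_vdw_value[OF c spin_dual_functional[OF B] conj_spin_dual_antifunctional[OF B] u]
        infeld_form_def sd m0)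
  show ?g2
    by (simp add: components_def gv mem ge infeld_form_def sd m0 spin_dual_zero[OF B])
  show ?g3
    by (simp add: components_def gv mem ge infeld_form_def sd m0 spin_dual_zero[OF B0])
qed

end

lemma canonical_components:
  assumes c: "chiral U \<Psi>" and q: "q \<in> U"
  shows "components A D (U,assoc SM U \<Psi>,dirac_frame S \<Psi>) (dirac_metric A SM) [] [a, b] [] [] [] [] q = dirac_metric_matrix $ a $ b" (is ?g1)
    "components A D (U,assoc SM U \<Psi>,dirac_frame S \<Psi>) (dirac_gamma A SM) [a] [b] [] [] [] [m] q = dirac_gamma_matrix m $ a $ b" (is ?g2)
proof -
  note B = chiral_frame(1)[OF c] q
  note DB = dirac_frame_is_frame[OF B(1)] q and T = chiral_frame(3)[OF c] q
  have delta: "(if P then 1 else 0) * x = (if P then x else 0)" "x * (if P then 1 else 0) = (if P then x else 0)" for P and x :: complex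
    by auto
  show ?g1
    by (simp add: components_def dirac_metric_value[OF c q D.frame_in_fibre[OF DB] D.frame_in_fibre[OF DB]]
        metric_form_def D.spin_dual_frame[OF DB] delta sum_if cong: if_cong)
  show ?g2
    by (simp add: components_def gamma_form_def D.spin_dual_frame[OF DB] tangent_dual_eq tcoord_frame[OF T]
        dirac_gamma_value[OF c q D.spin_dual_functional[OF DB] D.frame_in_fibre[OF DB] tangent_frame_tangent[OF T]]
        if_distrib[of complex_of_real] delta sum_if cong: if_cong)
qed

end

lemma sum_lessThan_2: "(\<Sum>s<2. f s) = f 0 + f (Suc 0)" for f :: "nat \<Rightarrow> 'a::comm_monoid_add"
  by (simp add: numeral_2_eq_2)

section \<open>Metric connections of the Dirac bundle\<close>

locale dirac_metric_connection = spin_manifold M SM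
  for M :: "'m::{t2_space,second_countable_topology} spacetime"
    and SM :: "('m, 'e::ab_group_add) chiral" +
  fixes C :: "('m, 'e \<times> ('e \<Rightarrow> complex), 4) connection"
  assumes metric_connection: "metric_connection_DM M SM C"
begin

lemma spinor_connection_C: "spinor_connection A D C"
  and real_connection_C: "real_connection A D C"
  and parallel_metric: "parallel A D C (0,2,0,0,0,0) (dirac_metric A SM)"
  and parallel_gamma: "parallel A D C (1,1,0,0,0,1) (dirac_gamma A SM)"
  using metric_connection unfolding metric_connection_DM_def Let_def by auto

lemma parallel_metric_components:
  assumes F: "frame_pair A D (U,\<Upsilon>,\<Psi>)" and p: "p \<in> U"
  defines "x \<equiv> components A D (U,\<Upsilon>,\<Psi>) (dirac_metric A SM)"
  shows "lie (\<Upsilon> r p) (x [] [i, j] [] [] [] []) =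
    (\<Sum>w\<in>UNIV. conA C (U,\<Upsilon>,\<Psi>) w r i p * x [] [w, j] [] [] [] [] p) +
    (\<Sum>w\<in>UNIV. conA C (U,\<Upsilon>,\<Psi>) w r j p * x [] [i, w] [] [] [] [] p)"
proof -
  have "nabla C (U,\<Upsilon>,\<Psi>) x r [] [i, j] [] [] [] [] p = 0"
    using parallel_metric F p unfolding parallel_def x_def by (simp add: has_type_def)
  then show ?thesis by (simp add: nabla_def sum_lessThan_2 algebra_simps)
qed

lemma parallel_gamma_components:
  assumes F: "frame_pair A D (U,\<Upsilon>,\<Psi>)" and p: "p \<in> U"
  defines "x \<equiv> components A D (U,\<Upsilon>,\<Psi>) (dirac_gamma A SM)"
  shows "lie (\<Upsilon> r p) (x [i] [j] [] [] [] [m]) + (\<Sum>v\<in>UNIV. conA C (U,\<Upsilon>,\<Psi>) i r v p * x [v] [j] [] [] [] [m] p)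
    - (\<Sum>w\<in>UNIV. conA C (U,\<Upsilon>,\<Psi>) w r j p * x [i] [w] [] [] [] [m] p)
    - (\<Sum>w\<in>UNIV. conG C (U,\<Upsilon>,\<Psi>) w r m p * x [i] [j] [] [] [] [w] p) = 0"
proof -
  have "nabla C (U,\<Upsilon>,\<Psi>) x r [i] [j] [] [] [] [m] p = 0"
    using parallel_gamma F p unfolding parallel_def x_def by (simp add: has_type_def)
  then show ?thesis by (simp add: nabla_def)
qed

lemma canonical_connection:
  assumes c: "chiral U \<Psi>" and p: "p \<in> U"
  defines "F \<equiv> (U, assoc SM U \<Psi>, dirac_frame S \<Psi>)"
  shows "conA C F (upper k) r (lower l) p = 0" (is ?g1) "conA C F (lower k) r (upper l) p = 0" (is ?g2)
    "conA C F (lower k) r (lower l) p = - cnj (conA C F (upper l) r (upper k) p)" (is ?g3)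
    "(\<Sum>w\<in>UNIV. conG C F w r m p * of_real (minkowski w n)) + (\<Sum>w\<in>UNIV. conG C F w r n p * of_real (minkowski m w)) = 0" (is ?g4)
proof -
  have FD: "frame_pair A D (U, assoc SM U \<Psi>, dirac_frame S \<Psi>)"
    by (rule dirac_frame_pair[OF chiral_frame_pair[OF c]])
  have U: "open U" using D.frame_pairD(3)[OF FD] .
  have t: "assoc SM U \<Psi> r p \<in> tangent A p" by (rule tangent_frame_tangent[OF chiral_frame(3)[OF c] p])
  have zero: "lie (assoc SM U \<Psi> r p) f = 0" if "\<And>q. q \<in> U \<Longrightarrow> f q = z" for f z
    using lie_local[OF t U p, of f "\<lambda>_. z"] that lie_const[OF t] by simp
  have 1: "(\<Sum>w\<in>UNIV. conA C F w r i p * dirac_metric_matrix $ w $ j) + (\<Sum>w\<in>UNIV. conA C F w r j p * dirac_metric_matrix $ i $ w) = 0" for i j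
    using parallel_metric_components[OF FD p, of r i j] zero[OF canonical_components(1)[OF c]]
    by (simp add: canonical_components[OF c p] F_def)
  have 2: "(\<Sum>v\<in>UNIV. conA C F i r v p * dirac_gamma_matrix m $ v $ j) - (\<Sum>w\<in>UNIV. conA C F w r j p * dirac_gamma_matrix m $ i $ w)
        - (\<Sum>w\<in>UNIV. conG C F w r m p * dirac_gamma_matrix w $ i $ j) = 0" for i j m
    using parallel_gamma_components[OF FD p, of r i j m] zero[OF canonical_components(2)[OF c]]
    by (simp add: canonical_components[OF c p] F_def)
  have 3: "cnj (conG C F w r m p) = conG C F w r m p" for w m
    using D.real_connection_components(2)[OF real_connection_C FD p] by (simp add: F_def)
  note a = dirac_connection_algebra[of "\<lambda>i j. conA C F i r j p" "\<lambda>w m. conG C F w r m p", OF 1 2 3]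
  show ?g1 ?g2 ?g3 ?g4
    by (fact a)+
qed

text \<open>The relations between the blocks persist in all Dirac frames built from frames of \<open>SM\<close>, with any tangent
  frame. The transition matrices are block diagonal with blocks \<open>Q\<close> and \<open>(Q\<^sup>-\<^sup>1)\<^sup>\<dagger>\<close>, and the inhomogeneous terms
  \<open>Q L(Q\<^sup>-\<^sup>1)\<close> and \<open>(Q\<^sup>-\<^sup>1)\<^sup>\<dagger> L(Q\<^sup>\<dagger>)\<close> satisfy the relation \<open>N = - P\<^sup>\<dagger>\<close> as well.\<close>

lemma connection_blocks:
  assumes F: "frame_pair A S (U,\<Upsilon>,\<Psi>)" and p: "p \<in> U"
  shows "conA C (U,\<Upsilon>,dirac_frame S \<Psi>) (upper k) r (lower j) p = 0"
    and "conA C (U,\<Upsilon>,dirac_frame S \<Psi>) (lower k) r (upper j) p = 0"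
    and "conA C (U,\<Upsilon>,dirac_frame S \<Psi>) (lower k) r (lower j) p =
      - cnj (conA C (U,\<Upsilon>,dirac_frame S \<Psi>) (upper j) r (upper k) p)"
proof -
  obtain U0 \<Psi>0 where c: "chiral U0 \<Psi>0" "p \<in> U0" using chiral_at .
  let ?F = "(U,\<Upsilon>,dirac_frame S \<Psi>)" and ?G = "(U0,assoc SM U0 \<Psi>0,dirac_frame S \<Psi>0)"
  note B = frame_pairD(2)[OF F] and B0 = chiral_frame(1)[OF c(1)]
  have FD: "frame_pair A D ?F" by (rule dirac_frame_pair[OF F])
  have F0: "frame_pair A D ?G"
    by (rule dirac_frame_pair[OF chiral_frame_pair[OF c(1)]])
  let ?T = "D.tangent_transition (assoc SM U0 \<Psi>0) \<Upsilon>"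
  let ?Q = "D.spin_transition (dirac_frame S \<Psi>) (dirac_frame S \<Psi>0)"
  let ?R = "D.spin_transition (dirac_frame S \<Psi>0) (dirac_frame S \<Psi>)"
  let ?q = "spin_transition \<Psi> \<Psi>0" and ?r = "spin_transition \<Psi>0 \<Psi>"
  define a where "a i j = (\<Sum>c\<in>UNIV. of_real (?T p $ c $ r) * conA C ?G i c j p)" for i j
  have a0: "a (upper k) (lower l) = 0" "a (lower k) (upper l) = 0" "a (lower k) (lower l) = - cnj (a (upper l) (upper k))" for k l
    using canonical_connection[OF c] by (simp_all add: a_def sum_negf)
  have t: "\<Upsilon> r p \<in> tangent A p" by (rule tangent_frame_tangent[OF frame_pairD(1)[OF F] p])
  have o: "open (U \<inter> U0)" "p \<in> U \<inter> U0" using frame_pairD(3)[OF F] B0 p c by (auto simp: bundle_frame_def)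
  note Q = dirac_spin_transition[OF B p B0 c(2)] and R = dirac_spin_transition[OF B0 c(2) B p]
  have Rq: "?R q $ upper k $ upper l = ?r q $ k $ l" "?R q $ lower k $ lower l = cnj (?q q $ l $ k)"
    "?R q $ upper k $ lower l = 0" "?R q $ lower k $ upper l = 0" if "q \<in> U \<inter> U0" for q k l
    using dirac_spin_transition[OF B0 _ B, of q] that by auto
  have dR: "lie (\<Upsilon> r p) (\<lambda>q. ?R q $ upper k $ upper l) = lie (\<Upsilon> r p) (\<lambda>q. ?r q $ k $ l)"
    "lie (\<Upsilon> r p) (\<lambda>q. ?R q $ lower k $ lower l) = cnj (lie (\<Upsilon> r p) (\<lambda>q. ?q q $ l $ k))"
    "lie (\<Upsilon> r p) (\<lambda>q. ?R q $ upper k $ lower l) = 0"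
    "lie (\<Upsilon> r p) (\<lambda>q. ?R q $ lower k $ upper l) = 0" for k l
    using lie_local[OF t o, of "\<lambda>q. ?R q $ upper k $ upper l" "\<lambda>q. ?r q $ k $ l"]
      lie_local[OF t o, of "\<lambda>q. ?R q $ lower k $ lower l" "\<lambda>q. cnj (?q q $ l $ k)"]
      lie_local[OF t o, of "\<lambda>q. ?R q $ upper k $ lower l" "\<lambda>q. 0"]
      lie_local[OF t o, of "\<lambda>q. ?R q $ lower k $ upper l" "\<lambda>q. 0"]
    by (simp_all add: Rq lie_cnj[OF t] lie_const[OF t])
  have law: "conA C ?F k r j p = (\<Sum>x\<in>UNIV. \<Sum>y\<in>UNIV. ?Q p $ k $ x * ?R p $ y $ j * a x y) +
      (\<Sum>x\<in>UNIV. ?Q p $ k $ x * lie (\<Upsilon> r p) (\<lambda>q. ?R q $ x $ j))" for k j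
    using D.connection_lawD[OF spinor_connection_C FD F0 p c(2)]
    unfolding D.connection_law_def a_def by (simp add: sum_distrib_left mult_ac)
  show "conA C ?F (upper k) r (lower j) p = 0" "conA C ?F (lower k) r (upper j) p = 0"
    unfolding law by (simp_all add: sum_blocks Q R a0 dR)
  have N: "conA C ?F (lower k) r (lower j) p =
     - (\<Sum>x\<in>UNIV. \<Sum>y\<in>UNIV. cnj (?r p $ x $ k) * cnj (?q p $ j $ y) * cnj (a (upper y) (upper x))) +
     (\<Sum>x\<in>UNIV. cnj (?r p $ x $ k) * cnj (lie (\<Upsilon> r p) (\<lambda>q. ?q q $ j $ x)))"
    unfolding law by (simp add: sum_blocks Q R a0 dR sum_negf)
  have P: "conA C ?F (upper j) r (upper k) p =
     (\<Sum>x\<in>UNIV. \<Sum>y\<in>UNIV. ?q p $ j $ x * ?r p $ y $ k * a (upper x) (upper y)) +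
     (\<Sum>x\<in>UNIV. ?q p $ j $ x * lie (\<Upsilon> r p) (\<lambda>q. ?r q $ x $ k))"
    unfolding law by (simp add: sum_blocks Q R a0 dR)
  have df: "differentiable_at p (\<lambda>q. ?q q $ j $ x)" "differentiable_at p (\<lambda>q. ?r q $ x $ k)" for x
    using smooth_spin_transition[OF B B0, of j x] smooth_spin_transition[OF B0 B, of x k] p c(2)
    by (auto intro: smooth_imp_differentiable_at)
  \<comment> \<open>differentiate the relation between the two mutually inverse transition matrices\<close>
  have "(\<Sum>x\<in>UNIV. lie (\<Upsilon> r p) (\<lambda>q. ?q q $ j $ x) * ?r p $ x $ k + ?q p $ j $ x * lie (\<Upsilon> r p) (\<lambda>q. ?r q $ x $ k)) = 0"
  proof -
    have "(\<Sum>x\<in>UNIV. lie (\<Upsilon> r p) (\<lambda>q. ?q q $ j $ x) * ?r p $ x $ k + ?q p $ j $ x * lie (\<Upsilon> r p) (\<lambda>q. ?r q $ x $ k)) =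
        lie (\<Upsilon> r p) (\<lambda>q. \<Sum>x\<in>UNIV. ?q q $ j $ x * ?r q $ x $ k)"
      by (subst lie_sum[OF t]) (auto intro: differentiable_at_mult df simp: lie_mult[OF t df])
    also have "\<dots> = lie (\<Upsilon> r p) (\<lambda>q. mat 1 $ j $ k)"
    proof (rule lie_local[OF t o])
      fix q assume "q \<in> U \<inter> U0"
      then have "?q q ** ?r q = mat 1" using spin_transition_inverse[OF B _ B0, of q] by simp
      then show "(\<Sum>x\<in>UNIV. ?q q $ j $ x * ?r q $ x $ k) = mat 1 $ j $ k"
        by (metis (no_types, lifting) matrix_matrix_mult_def sum.cong vec_lambda_beta)
    qed
    finally show ?thesis by (simp add: lie_const[OF t])
  qed
  then have e: "(\<Sum>x\<in>UNIV. ?r p $ x $ k * lie (\<Upsilon> r p) (\<lambda>q. ?q q $ j $ x)) =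
      - (\<Sum>x\<in>UNIV. ?q p $ j $ x * lie (\<Upsilon> r p) (\<lambda>q. ?r q $ x $ k))"
    by (simp add: sum.distrib mult.commute add_eq_0_iff2)
  have "(\<Sum>x\<in>UNIV. cnj (?r p $ x $ k) * cnj (lie (\<Upsilon> r p) (\<lambda>q. ?q q $ j $ x))) =
      - cnj (\<Sum>x\<in>UNIV. ?q p $ j $ x * lie (\<Upsilon> r p) (\<lambda>q. ?r q $ x $ k))"
    using arg_cong[OF e, of cnj] by simp
  moreover have "(\<Sum>x\<in>UNIV. \<Sum>y\<in>UNIV. cnj (?r p $ x $ k) * cnj (?q p $ j $ y) * cnj (a (upper y) (upper x))) =
      cnj (\<Sum>x\<in>UNIV. \<Sum>y\<in>UNIV. ?q p $ j $ x * ?r p $ y $ k * a (upper x) (upper y))"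
    by (subst sum.swap) (simp add: mult_ac)
  ultimately show "conA C ?F (lower k) r (lower j) p = - cnj (conA C ?F (upper j) r (upper k) p)"
    unfolding N P by simp
qed

end

section \<open>The chiral part of a connection\<close>

text \<open>The connection of \<open>SM\<close> read off from the Dirac frames. Setting the barred components to the
  conjugates of the unbarred ones builds in reality.\<close>

definition chiral_part ::
  "('m, 'e::ab_group_add, 2) vbundle \<Rightarrow> ('m, 'e \<times> ('e \<Rightarrow> complex), 4) connection \<Rightarrow> ('m, 'e, 2) connection" where
  "chiral_part S C =
     \<lparr> conG = (\<lambda>(U,\<Upsilon>,\<Psi>). conG C (U,\<Upsilon>,dirac_frame S \<Psi>)),
       conA = (\<lambda>(U,\<Upsilon>,\<Psi>) k i j. conA C (U,\<Upsilon>,dirac_frame S \<Psi>) (upper k) i (upper j)),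
       conB = (\<lambda>(U,\<Upsilon>,\<Psi>) k i j p. cnj (conA C (U,\<Upsilon>,dirac_frame S \<Psi>) (upper k) i (upper j) p)) \<rparr>"

lemma chiral_part_simps [simp]:
  "conG (chiral_part S C) (U,\<Upsilon>,\<Psi>) = conG C (U,\<Upsilon>,dirac_frame S \<Psi>)"
  "conA (chiral_part S C) (U,\<Upsilon>,\<Psi>) k i j = conA C (U,\<Upsilon>,dirac_frame S \<Psi>) (upper k) i (upper j)"
  "conB (chiral_part S C) (U,\<Upsilon>,\<Psi>) k i j p = cnj (conA C (U,\<Upsilon>,dirac_frame S \<Psi>) (upper k) i (upper j) p)"
  by (simp_all add: chiral_part_def)

context dirac_metric_connection
begin

abbreviation C0 where "C0 \<equiv> chiral_part S C"

text \<open>The law for block diagonal transition matrices, restricted to the upper block, is the law for \<open>SM\<close>.\<close>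

lemma chiral_part_law:
  assumes F: "frame_pair A S (U,\<Upsilon>,\<Psi>)" and F': "frame_pair A S (U',\<Upsilon>',\<Psi>')" and p: "p \<in> U" "p \<in> U'"
  shows "connection_law C0 \<Upsilon> (U,\<Upsilon>,\<Psi>) (U',\<Upsilon>',\<Psi>') (tangent_transition \<Upsilon> \<Upsilon>') (tangent_transition \<Upsilon>' \<Upsilon>)
          (spin_transition \<Psi> \<Psi>') (spin_transition \<Psi>' \<Psi>) p"
proof -
  let ?F = "(U,\<Upsilon>,dirac_frame S \<Psi>)" and ?G = "(U',\<Upsilon>',dirac_frame S \<Psi>')"
  let ?Q = "D.spin_transition (dirac_frame S \<Psi>) (dirac_frame S \<Psi>')"
  let ?R = "D.spin_transition (dirac_frame S \<Psi>') (dirac_frame S \<Psi>)"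
  let ?T = "tangent_transition \<Upsilon>' \<Upsilon>"
  note B = frame_pairD(2)[OF F] and B' = frame_pairD(2)[OF F']
  have law: "D.connection_law C \<Upsilon> ?F ?G (tangent_transition \<Upsilon> \<Upsilon>') ?T ?Q ?R p"
    using D.connection_lawD[OF spinor_connection_C dirac_frame_pair[OF F] dirac_frame_pair[OF F'] p] .
  have G: "conG C ?F k i j p =
              (\<Sum>a\<in>UNIV. \<Sum>b\<in>UNIV. \<Sum>c\<in>UNIV.
                 of_real (tangent_transition \<Upsilon> \<Upsilon>' p $ k $ a) * of_real (?T p $ b $ j) * of_real (?T p $ c $ i) *
                 conG C ?G a c b p) +
              (\<Sum>a\<in>UNIV. of_real (tangent_transition \<Upsilon> \<Upsilon>' p $ k $ a) * of_real (\<Upsilon> i p (\<lambda>q. ?T q $ a $ j)))" for k i j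
    using law unfolding D.connection_law_def by blast
  have law: "conA C ?F k i j p = (\<Sum>a\<in>UNIV. \<Sum>b\<in>UNIV. \<Sum>c\<in>UNIV.
                 ?Q p $ k $ a * ?R p $ b $ j * of_real (?T p $ c $ i) * conA C ?G a c b p) +
              (\<Sum>a\<in>UNIV. ?Q p $ k $ a * lie (\<Upsilon> i p) (\<lambda>q. ?R q $ a $ j))" for k i j
    using law unfolding D.connection_law_def by blast
  note Q = dirac_spin_transition[OF B p(1) B' p(2)] and R = dirac_spin_transition[OF B' p(2) B p(1)]
  have t: "\<Upsilon> i p \<in> tangent A p" for i by (rule tangent_frame_tangent[OF frame_pairD(1)[OF F] p(1)])
  have o: "open (U \<inter> U')" "p \<in> U \<inter> U'" using frame_pairD(3)[OF F] frame_pairD(3)[OF F'] p by auto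
  have dR: "lie (\<Upsilon> i p) (\<lambda>q. ?R q $ upper a $ upper j) = lie (\<Upsilon> i p) (\<lambda>q. spin_transition \<Psi>' \<Psi> q $ a $ j)" for i a j
    by (rule lie_local[OF t o]) (use dirac_spin_transition[OF B' _ B] in auto)
  have P: "conA C ?F (upper k) i (upper j) p =
     (\<Sum>a\<in>UNIV. \<Sum>b\<in>UNIV. \<Sum>c\<in>UNIV. spin_transition \<Psi> \<Psi>' p $ k $ a * spin_transition \<Psi>' \<Psi> p $ b $ j *
        of_real (?T p $ c $ i) * conA C ?G (upper a) c (upper b) p) +
     (\<Sum>a\<in>UNIV. spin_transition \<Psi> \<Psi>' p $ k $ a * lie (\<Upsilon> i p) (\<lambda>q. spin_transition \<Psi>' \<Psi> q $ a $ j))" for k i j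
    unfolding law by (subst sum_blocks2, subst sum_blocks) (simp add: Q R dR)
  show ?thesis
    unfolding connection_law_def using G P by simp
qed

lemma spinor_connection_chiral_part: "spinor_connection A S C0"
proof -
  have "smooth_fun A U (conG C0 (U,\<Upsilon>,\<Psi>) k i j)" "smooth_fun A U (conA C0 (U,\<Upsilon>,\<Psi>) k' i j')"
    "smooth_fun A U (conB C0 (U,\<Upsilon>,\<Psi>) k' i j')"
    if F: "frame_pair A S (U,\<Upsilon>,\<Psi>)" for U \<Upsilon> \<Psi> k i j k' j'
  proof -
    have s: "smooth_fun A U (conG C (U,\<Upsilon>,dirac_frame S \<Psi>) k i j)"
      "smooth_fun A U (conA C (U,\<Upsilon>,dirac_frame S \<Psi>) (upper k') i (upper j'))"
      using spinor_connection_C dirac_frame_pair[OF F] unfolding D.spinor_connection_iff by blast+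
    then show "smooth_fun A U (conG C0 (U,\<Upsilon>,\<Psi>) k i j)" "smooth_fun A U (conA C0 (U,\<Upsilon>,\<Psi>) k' i j')" by simp_all
    show "smooth_fun A U (conB C0 (U,\<Upsilon>,\<Psi>) k' i j')"
      using smooth_cnj[OF frame_pairD(3)[OF F] s(2)] by (simp add: chiral_part_def)
  qed
  then show ?thesis
    unfolding spinor_connection_iff by (intro conjI allI impI ballI) (auto intro: chiral_part_law)
qed

lemma real_connection_chiral_part: "real_connection A S C0"
  by (rule real_connectionI) (simp_all add: D.real_connection_components(2)[OF real_connection_C dirac_frame_pair])

text \<open>The components of \<open>\<nabla>d\<close> for \<open>SM\<close> are upper block components of \<open>\<nabla>d\<close> for \<open>DM\<close>: the mixed blocks of
  the latter \<open>d\<close> vanish, which kills the contributions of the lower indices.\<close>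

lemma parallel_spin_metric: "parallel A S C0 (0,2,0,0,0,0) (bilinear_field d)"
  unfolding parallel_def
proof (intro allI impI ballI)
  fix U \<Upsilon> \<Psi> p r and i j i' j' :: "2 list" and h k :: "4 list"
  assume F: "frame_pair A S (U,\<Upsilon>,\<Psi>)" and p: "p \<in> U" and "has_type (0,2,0,0,0,0) i j i' j' h k"
  then obtain a b where l: "i = []" "j = [a, b]" "i' = []" "j' = []" "h = []" "k = []"
    by (auto simp: has_type_def numeral_2_eq_2 Suc_length_conv length_Suc_conv)
  let ?x = "components A S (U,\<Upsilon>,\<Psi>) (bilinear_field d)" and ?y = "components A D (U,\<Upsilon>,dirac_frame S \<Psi>) (dirac_metric A SM)"
  have t: "\<Upsilon> r p \<in> tangent A p" by (rule tangent_frame_tangent[OF frame_pairD(1)[OF F] p])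
  have "lie (\<Upsilon> r p) (?x [] [a, b] [] [] [] []) = lie (\<Upsilon> r p) (?y [] [upper a, upper b] [] [] [] [])"
    by (rule lie_local[OF t frame_pairD(3)[OF F] p]) (simp add: dirac_metric_components(1)[OF F])
  then show "nabla C0 (U,\<Upsilon>,\<Psi>) ?x r i j i' j' h k p = 0"
    using parallel_metric_components[OF dirac_frame_pair[OF F] p, of r "upper a" "upper b"]
    by (simp add: l nabla_def sum_lessThan_2 sum_blocks dirac_metric_components[OF F p])
qed

text \<open>In the upper right block of \<open>\<nabla>\<gamma>\<close> the lower index is differentiated with \<open>N = - P\<^sup>\<dagger>\<close>, which amounts to the
  barred components of the chiral part.\<close>

lemma parallel_infeld_vdw: "parallel A S C0 (1,0,1,0,0,1) (infeld_vdw A SM)"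
  unfolding parallel_def
proof (intro allI impI ballI)
  fix U \<Upsilon> \<Psi> p r and i j i' j' :: "2 list" and h k :: "4 list"
  assume F: "frame_pair A S (U,\<Upsilon>,\<Psi>)" and p: "p \<in> U" and "has_type (1,0,1,0,0,1) i j i' j' h k"
  then obtain a b m where l: "i = [a]" "j = []" "i' = [b]" "j' = []" "h = []" "k = [m]"
    by (auto simp: has_type_def Suc_length_conv)
  let ?x = "components A S (U,\<Upsilon>,\<Psi>) (infeld_vdw A SM)" and ?y = "components A D (U,\<Upsilon>,dirac_frame S \<Psi>) (dirac_gamma A SM)"
  have t: "\<Upsilon> r p \<in> tangent A p" by (rule tangent_frame_tangent[OF frame_pairD(1)[OF F] p])
  have "lie (\<Upsilon> r p) (?x [a] [] [b] [] [] [m]) = lie (\<Upsilon> r p) (?y [upper a] [lower b] [] [] [] [m])"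
    by (rule lie_local[OF t frame_pairD(3)[OF F] p]) (simp add: dirac_gamma_components(1)[OF F])
  then show "nabla C0 (U,\<Upsilon>,\<Psi>) ?x r i j i' j' h k p = 0"
    using parallel_gamma_components[OF dirac_frame_pair[OF F] p, of r "upper a" "lower b" m]
    by (simp add: l nabla_def sum_blocks dirac_gamma_components[OF F p] connection_blocks(3)[OF F p] sum_negf)
qed

lemma metric_bilinear:
  assumes "u \<in> tangent A p" "v \<in> tangent A p"
  shows "metric M p u v = metric M p v u"
    "w \<in> tangent A p \<Longrightarrow> metric M p (u + v) w = metric M p u w + metric M p v w"
    "metric M p (fscale c u) v = c * metric M p u v"
proof -
  have "\<forall>p. \<forall>u\<in>tangent A p. \<forall>v\<in>tangent A p. metric M p u v = metric M p v u \<and>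
        (\<forall>w\<in>tangent A p. metric M p (u + v) w = metric M p u w + metric M p v w) \<and>
        (\<forall>c. metric M p (fscale c u) v = c * metric M p u v)"
    using space_time unfolding space_time_def lorentz_metric_def by (elim conjE)
  then show "metric M p u v = metric M p v u"
    "w \<in> tangent A p \<Longrightarrow> metric M p (u + v) w = metric M p u w + metric M p v w"
    "metric M p (fscale c u) v = c * metric M p u v" using assms by blast+
qed

lemma metric_expand:
  assumes T: "tangent_frame A U \<Upsilon>" "q \<in> U" and v: "v \<in> tangent A q" and w: "w \<in> tangent A q"
  shows "metric M q v w = (\<Sum>a\<in>UNIV. \<Sum>b\<in>UNIV. tcoord \<Upsilon> a q v * tcoord \<Upsilon> b q w * metric M q (\<Upsilon> a q) (\<Upsilon> b q))"
proof -
  note f = tangent_frame_tangent[OF T]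
  have z: "metric M q 0 x = 0" if "x \<in> tangent A q" for x
    using metric_bilinear(3)[OF that that, of 0] by (simp add: fscale_def zero_fun_def)
  have l: "metric M q (\<Sum>a\<in>I. fscale (c a) (\<Upsilon> a q)) x = (\<Sum>a\<in>I. c a * metric M q (\<Upsilon> a q) x)"
    if x: "x \<in> tangent A q" and "finite I" for I c x
    using that(2)
  proof (induction I rule: finite_induct)
    case empty
    show ?case by (simp only: sum.empty z[OF x])
  next
    case (insert a I)
    have "metric M q (fscale (c a) (\<Upsilon> a q) + (\<Sum>a\<in>I. fscale (c a) (\<Upsilon> a q))) x =
        metric M q (fscale (c a) (\<Upsilon> a q)) x + metric M q (\<Sum>a\<in>I. fscale (c a) (\<Upsilon> a q)) x"
      by (rule metric_bilinear(2)[OF tangent_scale[OF f] tangent_sum[OF tangent_scale[OF f]] x])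
    then show ?case
      by (simp only: sum.insert[OF insert.hyps] insert.IH metric_bilinear(3)[OF f x])
  qed
  have 1: "metric M q v x = (\<Sum>a\<in>UNIV. tcoord \<Upsilon> a q v * metric M q (\<Upsilon> a q) x)" if x: "x \<in> tangent A q" for x
    using l[OF x, of UNIV "\<lambda>a. tcoord \<Upsilon> a q v"] tcoord_expand[OF T v] by simp
  have 2: "metric M q (\<Upsilon> a q) w = (\<Sum>b\<in>UNIV. tcoord \<Upsilon> b q w * metric M q (\<Upsilon> a q) (\<Upsilon> b q))" for a
    using l[OF f[of a], of UNIV "\<lambda>a. tcoord \<Upsilon> a q w"] tcoord_expand[OF T w]
    by (simp add: metric_bilinear(1)[OF f w] metric_bilinear(1)[OF f f])
  show ?thesis unfolding 1[OF w] 2 by (simp add: sum_distrib_left mult_ac)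
qed

text \<open>In an associated frame \<open>\<nabla>g = 0\<close> is the skewness of \<open>\<Gamma>\<close> with respect to the Minkowski metric. In another tangent frame,
  differentiating the transition matrices in the components of \<open>g\<close> produces exactly what the inhomogeneous
  term of the law for \<open>\<Gamma>\<close> subtracts.\<close>

lemma parallel_metric_field: "parallel A S C0 (0,0,0,0,0,2) (metric_field M)"
  unfolding parallel_def
proof (intro allI impI ballI)
  fix U \<Upsilon> \<Psi> p r and i j i' j' :: "2 list" and h k :: "4 list"
  assume F: "frame_pair A S (U,\<Upsilon>,\<Psi>)" and p: "p \<in> U" and "has_type (0,0,0,0,0,2) i j i' j' h k"
  then obtain m n where l: "i = []" "j = []" "i' = []" "j' = []" "h = []" "k = [m, n]"
    by (auto simp: has_type_def numeral_2_eq_2 Suc_length_conv length_Suc_conv)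
  obtain V \<Theta> where c: "chiral V \<Theta>" "p \<in> V" using chiral_at .
  define Y where "Y = assoc SM V \<Theta>"
  have F0: "frame_pair A S (V,Y,\<Theta>)" unfolding Y_def by (rule chiral_frame_pair[OF c(1)])
  note T = frame_pairD(1)[OF F] and T0 = frame_pairD(1)[OF F0]
  have ts: "\<Upsilon> a p \<in> tangent A p" for a by (rule tangent_frame_tangent[OF T p])
  have o: "open (U \<inter> V)" "p \<in> U \<inter> V" using frame_pairD(3)[OF F] frame_pairD(3)[OF F0] p c by auto
  let ?S = "tangent_transition \<Upsilon> Y" and ?T = "tangent_transition Y \<Upsilon>"
  \<comment> \<open>In terms of matrices, \<open>\<Gamma>\<^sub>r = s g0 t + s dt\<close> with \<open>t = s\<^sup>-\<^sup>1\<close>, and the metric has the matrix \<open>t\<^sup>T e t\<close>.\<close>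
  define t :: "complex^4^4" where "t = (\<chi> a b. of_real (?T p $ a $ b))"
  define s :: "complex^4^4" where "s = (\<chi> a b. of_real (?S p $ a $ b))"
  define dt :: "complex^4^4" where "dt = (\<chi> a b. of_real (\<Upsilon> r p (\<lambda>q. ?T q $ a $ b)))"
  define e :: "complex^4^4" where "e = (\<chi> a b. of_real (minkowski a b))"
  define g0 :: "complex^4^4" where "g0 = (\<chi> a b. \<Sum>c\<in>UNIV. of_real (?T p $ c $ r) * conG C0 (V,Y,\<Theta>) a c b p)"
  define g :: "complex^4^4" where "g = (\<chi> a b. conG C0 (U,\<Upsilon>,\<Psi>) a r b p)"
  have st: "t ** s = mat 1"
  proof -
    have "?T p ** ?S p = mat 1" by (rule tangent_transition_inverse[OF T0 c(2) T p])
    then have "of_real ((?T p ** ?S p) $ a $ b) = (of_real (mat 1 $ a $ b) :: complex)" for a b by simp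
    then show ?thesis by (simp add: vec_eq_iff t_def s_def matrix_matrix_mult_def mat_def if_distrib cong: if_cong)
  qed
  have g: "g = s ** (g0 ** t) + s ** dt"
  proof -
    have "conG C0 (U,\<Upsilon>,\<Psi>) a r b p = (s ** (g0 ** t) + s ** dt) $ a $ b" for a b
    proof -
      have "conG C0 (U,\<Upsilon>,\<Psi>) a r b p = (\<Sum>a'\<in>UNIV. \<Sum>b'\<in>UNIV. \<Sum>c\<in>UNIV.
                 of_real (?S p $ a $ a') * of_real (?T p $ b' $ b) * of_real (?T p $ c $ r) * conG C0 (V,Y,\<Theta>) a' c b' p) +
              (\<Sum>a'\<in>UNIV. of_real (?S p $ a $ a') * of_real (\<Upsilon> r p (\<lambda>q. ?T q $ a' $ b)))"
        using chiral_part_law[OF F F0 p c(2)] unfolding connection_law_def by blast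
      then show ?thesis
        by (simp add: matrix_matrix_mult_def s_def g0_def t_def dt_def sum_distrib_left sum_distrib_right mult_ac)
    qed
    then show ?thesis by (simp add: g_def vec_eq_iff)
  qed
  have skew: "e ** g0 + transpose g0 ** e = 0"
  proof -
    have "(\<Sum>w\<in>UNIV. conG C0 (V,Y,\<Theta>) w c m p * of_real (minkowski w n)) + (\<Sum>w\<in>UNIV. conG C0 (V,Y,\<Theta>) w c n p * of_real (minkowski m w)) = 0" for c m n
      using canonical_connection(4)[OF c, of c m n] by (simp add: Y_def)
    then have "(\<Sum>c\<in>UNIV. of_real (?T p $ c $ r) * ((\<Sum>w\<in>UNIV. conG C0 (V,Y,\<Theta>) w c m p * of_real (minkowski w n)) +
        (\<Sum>w\<in>UNIV. conG C0 (V,Y,\<Theta>) w c n p * of_real (minkowski m w)))) = 0" for m n by simp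
    moreover have "(e ** g0 + transpose g0 ** e) $ m $ n =
      (\<Sum>c\<in>UNIV. of_real (?T p $ c $ r) * ((\<Sum>w\<in>UNIV. conG C0 (V,Y,\<Theta>) w c m p * of_real (minkowski w n)) +
        (\<Sum>w\<in>UNIV. conG C0 (V,Y,\<Theta>) w c n p * of_real (minkowski m w))))" for m n
    proof -
      have 1: "(e ** g0) $ m $ n = (\<Sum>c\<in>UNIV. of_real (?T p $ c $ r) * (\<Sum>w\<in>UNIV. conG C0 (V,Y,\<Theta>) w c n p * of_real (minkowski m w)))"
        by (simp add: e_def g0_def matrix_matrix_mult_def sum_distrib_left mult_ac del: chiral_part_simps) (rule sum.swap)
      have 2: "(transpose g0 ** e) $ m $ n = (\<Sum>c\<in>UNIV. of_real (?T p $ c $ r) * (\<Sum>w\<in>UNIV. conG C0 (V,Y,\<Theta>) w c m p * of_real (minkowski w n)))"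
        by (simp add: e_def g0_def matrix_matrix_mult_def transpose_def sum_distrib_left sum_distrib_right mult_ac del: chiral_part_simps) (rule sum.swap)
      show ?thesis unfolding vector_add_component 1 2 by (simp add: distrib_left sum.distrib del: chiral_part_simps)
    qed
    ultimately show ?thesis by (simp add: vec_eq_iff)
  qed
  have gq: "of_real (metric M q (\<Upsilon> m q) (\<Upsilon> n q)) =
      (\<Sum>a\<in>UNIV. \<Sum>b\<in>UNIV. of_real (minkowski a b) * (of_real (?T q $ a $ m) * complex_of_real (?T q $ b $ n)))"
    if q: "q \<in> U \<inter> V" for q m n
  proof -
    have "metric M q (\<Upsilon> m q) (\<Upsilon> n q) = (\<Sum>a\<in>UNIV. \<Sum>b\<in>UNIV. minkowski a b * (?T q $ a $ m * ?T q $ b $ n))"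
      using metric_expand[OF T0 _ tangent_frame_tangent[OF T] tangent_frame_tangent[OF T], of q m n]
        chiral_frame(4)[OF c(1), of q] q
      by (simp add: tangent_transition_def Y_def mult_ac)
    then show ?thesis by simp
  qed
  have quad: "(\<Sum>a\<in>UNIV. \<Sum>b\<in>UNIV. e $ a $ b * (x $ a $ m * y $ b $ n)) = (transpose x ** e ** y) $ m $ n"
    for x y :: "complex^4^4" and m n
  proof -
    have "(transpose x ** e ** y) $ m $ n = (\<Sum>b\<in>UNIV. \<Sum>a\<in>UNIV. e $ a $ b * (x $ a $ m * y $ b $ n))"
      by (simp add: matrix_matrix_mult_def transpose_def sum_distrib_left sum_distrib_right mult_ac)
    then show ?thesis by (subst sum.swap) simp
  qed
  have gp: "complex_of_real (metric M p (\<Upsilon> m p) (\<Upsilon> n p)) = (transpose t ** e ** t) $ m $ n" for m n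
    unfolding gq[OF o(2)] quad[symmetric] by (simp add: t_def e_def)
  have dT: "differentiable_at p (\<lambda>q. complex_of_real (?T q $ a $ b))" for a b
  proof -
    have "smooth_fun A (V \<inter> U) (\<lambda>q. tcoord Y a q (\<Upsilon> b q))"
      using smooth_tcoord[OF T0, of U "\<Upsilon> b"] T by (simp add: tangent_frame_def)
    then have "smooth_fun A (V \<inter> U) (\<lambda>q. complex_of_real (?T q $ a $ b))"
      using o(1) by (intro smooth_of_real) (auto simp: tangent_transition_def Int_commute)
    then show ?thesis by (rule smooth_imp_differentiable_at) (use o in auto)
  qed
  have dg: "lie (\<Upsilon> r p) (\<lambda>q. of_real (metric M q (\<Upsilon> m q) (\<Upsilon> n q))) = (transpose dt ** e ** t + transpose t ** e ** dt) $ m $ n" for m n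
  proof -
    have "lie (\<Upsilon> r p) (\<lambda>q. of_real (metric M q (\<Upsilon> m q) (\<Upsilon> n q))) =
      lie (\<Upsilon> r p) (\<lambda>q. \<Sum>a\<in>UNIV. \<Sum>b\<in>UNIV. of_real (minkowski a b) * (of_real (?T q $ a $ m) * of_real (?T q $ b $ n)))"
      by (rule lie_local[OF ts o]) (rule gq)
    also have "\<dots> = (\<Sum>a\<in>UNIV. \<Sum>b\<in>UNIV. of_real (minkowski a b) * (dt $ a $ m * t $ b $ n + t $ a $ m * dt $ b $ n))"
    proof -
      have d2: "differentiable_at p (\<lambda>q. of_real (minkowski a b) * (of_real (?T q $ a $ m) * complex_of_real (?T q $ b $ n)))" for a b
        by (intro differentiable_at_mult differentiable_at_const dT)
      show ?thesis
        by (simp add: lie_sum[OF ts] differentiable_at_sum d2 lie_mult[OF ts differentiable_at_const differentiable_at_mult[OF dT dT]]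
            lie_const[OF ts] lie_mult[OF ts dT dT] lie_of_real[OF ts] dt_def t_def)
    qed
    also have "\<dots> = (transpose dt ** e ** t + transpose t ** e ** dt) $ m $ n"
    proof -
      show ?thesis
        unfolding vector_add_component quad[symmetric] by (simp add: e_def distrib_left sum.distrib)
    qed
    finally show ?thesis .
  qed
  define G where "G = transpose t ** e ** t"
  have "G ** g = transpose t ** e ** ((t ** s) ** (g0 ** t)) + transpose t ** e ** ((t ** s) ** dt)"
    unfolding G_def g by (simp add: matrix_add_ldistrib matrix_mul_assoc)
  then have 1: "G ** g = transpose t ** (e ** g0) ** t + transpose t ** e ** dt"
    by (simp add: st matrix_mul_assoc)
  have te: "transpose e = e" by (simp add: e_def transpose_def minkowski_def vec_eq_iff)
  have tadd: "transpose (x + y) = transpose x + transpose y" for x y :: "complex^4^4"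
    by (simp add: transpose_def vec_eq_iff)
  have "transpose g ** G = transpose (G ** g)"
    by (simp add: G_def matrix_transpose_mul te matrix_mul_assoc)
  then have 2: "transpose g ** G = transpose t ** (transpose g0 ** e) ** t + transpose dt ** e ** t"
    by (simp only: 1 tadd matrix_transpose_mul te transpose_transpose matrix_mul_assoc)
  have rdistrib: "(x + y) ** z = x ** z + y ** z" for x y z :: "complex^4^4"
    by (simp add: matrix_matrix_mult_def vec_eq_iff distrib_right sum.distrib)
  have "G ** g + transpose g ** G = transpose t ** (e ** g0 + transpose g0 ** e) ** t + (transpose dt ** e ** t + transpose t ** e ** dt)"
    unfolding 1 2 by (simp add: matrix_add_ldistrib rdistrib)
  then have "(transpose dt ** e ** t + transpose t ** e ** dt) $ m $ n = (G ** g + transpose g ** G) $ m $ n"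
    unfolding skew by (simp add: matrix_matrix_mult_def vec_eq_iff)
  also have "\<dots> = (\<Sum>w\<in>UNIV. conG C0 (U,\<Upsilon>,\<Psi>) w r m p * of_real (metric M p (\<Upsilon> w p) (\<Upsilon> n p))) +
     (\<Sum>w\<in>UNIV. conG C0 (U,\<Upsilon>,\<Psi>) w r n p * of_real (metric M p (\<Upsilon> m p) (\<Upsilon> w p)))"
  proof -
    have mm: "(x ** y) $ m $ n = (\<Sum>w\<in>UNIV. x $ m $ w * y $ w $ n)" for x y :: "complex^4^4"
      by (simp add: matrix_matrix_mult_def)
    have "(G ** g + transpose g ** G) $ m $ n = (\<Sum>w\<in>UNIV. g $ w $ m * G $ w $ n) + (\<Sum>w\<in>UNIV. g $ w $ n * G $ m $ w)"
      unfolding vector_add_component mm by (simp add: transpose_def mult.commute)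
    then show ?thesis by (simp only: gp G_def[symmetric]) (simp add: g_def)
  qed
  finally show "nabla C0 (U,\<Upsilon>,\<Psi>) (components A S (U,\<Upsilon>,\<Psi>) (metric_field M)) r i j i' j' h k p = 0"
    using dg[of m n] by (simp add: l nabla_def sum_lessThan_2 components_def metric_field_def)
qed

lemma metric_connection_chiral_part: "metric_connection_SM M SM C0"
  unfolding metric_connection_SM_def
  using spinor_connection_chiral_part real_connection_chiral_part parallel_spin_metric parallel_infeld_vdw
    parallel_metric_field by blast


section \<open>Extension and uniqueness\<close>

lemma smooth_section_upper:
  assumes s: "smooth_section A S W s" and W: "open W"
  shows "smooth_section A D W (\<lambda>q. (s q, 0))"
  unfolding smooth_section_D_iff[OF W]
proof (intro conjI ballI allI impI)
  show "(s p, 0) \<in> fibre D p" if "p \<in> W" for p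
    using s that by (simp add: fibre_D zero_antifunctional smooth_section_def)
  fix V \<Phi> a assume t: "(V,\<Phi>) \<in> trivs S"
  show "smooth_fun A (W \<inter> V) (\<lambda>p. dirac_triv \<Phi> p (s p, 0) $ a)"
    using W open_triv[OF t] smooth_nth[OF _ smooth_section_triv[OF s t]]
    by (cases a rule: upper_lower_cases) (auto simp: dirac_triv_nth smooth_const)
qed

lemma smooth_section_parts:
  assumes w: "smooth_section A D W w" and W: "open W"
  shows "smooth_section A S W (\<lambda>q. fst (w q))" (is ?g1) "smooth_section A D W (\<lambda>q. (0, snd (w q)))" (is ?g2)
proof -
  have m: "fst (w p) \<in> fibre S p \<and> snd (w p) \<in> antifunctionals p" if "p \<in> W" for p
    using w that unfolding smooth_section_def fibre_D by (auto simp: mem_Times_iff)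
  have sm: "smooth_fun A (W \<inter> V) (\<lambda>p. dirac_triv \<Phi> p (fst (w p), snd (w p)) $ a)" if "(V,\<Phi>) \<in> trivs S" for V \<Phi> a
    using w that unfolding smooth_section_D_iff[OF W] by simp
  show ?g1
    unfolding smooth_section_def
  proof (intro conjI ballI, goal_cases)
    case (1 p) then show ?case using m by blast
  next
    case (2 x)
    obtain V \<Phi> where x: "x = (V,\<Phi>)" by (cases x)
    then have t: "(V,\<Phi>) \<in> trivs S" using 2 by simp
    have "smooth_fun A (W \<inter> V) (\<lambda>p. \<Phi> p (fst (w p)))"
    proof (rule smooth_vec)
      show "open (W \<inter> V)" using W open_triv[OF t] by blast
      show "smooth_fun A (W \<inter> V) (\<lambda>p. \<Phi> p (fst (w p)) $ k)" for k
        using sm[OF t, of "upper k"] by (simp only: dirac_triv_nth)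
    qed
    then show ?case by (simp add: x)
  qed
  show ?g2
    unfolding smooth_section_D_iff[OF W]
  proof (intro conjI ballI allI impI)
    show "(0, snd (w p)) \<in> fibre D p" if "p \<in> W" for p
      using m[OF that] by (simp add: fibre_D fibre_zero)
    fix V \<Phi> a assume t: "(V,\<Phi>) \<in> trivs S"
    have o: "open (W \<inter> V)" using W open_triv[OF t] by auto
    have z: "\<Phi> p 0 = 0" if "p \<in> V" for p
      using coordinate_space.\<Phi>_sum[OF triv_coordinates[OF t that], of "{}" "\<lambda>_. 0" "\<lambda>_. 0"] by simp
    have s0: "smooth_fun A (W \<inter> V) (\<lambda>p. \<Phi> p 0 $ l)" for l
      using smooth_fun_cong[OF o, of "\<lambda>p. \<Phi> p 0 $ l" "\<lambda>p. 0"] z smooth_const[of "W \<inter> V" 0] by simp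
    have sl: "smooth_fun A (W \<inter> V) (\<lambda>p. snd (w p) (inv_into (fibre S p) (\<Phi> p) (axis k 1)))" for k
      using sm[OF t, of "lower k"] by (simp only: dirac_triv_nth)
    show "smooth_fun A (W \<inter> V) (\<lambda>p. dirac_triv \<Phi> p (0, snd (w p)) $ a)"
      by (cases a rule: upper_lower_cases) (simp_all add: dirac_triv_nth s0 sl)
  qed
qed

text \<open>The relation \<open>N = - P\<^sup>\<dagger>\<close> turns the second component into the covariant derivative of an antilinear functional.\<close>

lemma nabla_section_dirac_frame:
  assumes F: "frame_pair A S (U,\<Upsilon>,\<Psi>)" and p: "p \<in> U"
    and w: "\<And>q. q \<in> U \<Longrightarrow> (s q, z q) \<in> fibre D q"
  shows "nabla_section A D C (U,\<Upsilon>,dirac_frame S \<Psi>) r (\<lambda>q. (s q, z q)) p =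
    ((\<Sum>k\<in>UNIV. vscale S (lie (\<Upsilon> r p) (\<lambda>q. spin_dual S \<Psi> k q (s q)) +
        (\<Sum>v\<in>UNIV. conA C0 (U,\<Upsilon>,\<Psi>) k r v p * spin_dual S \<Psi> v p (s p))) (\<Psi> k p)),
     (\<Sum>k\<in>UNIV. fscale (lie (\<Upsilon> r p) (\<lambda>q. z q (\<Psi> k q)) -
        (\<Sum>v\<in>UNIV. conB C0 (U,\<Upsilon>,\<Psi>) v r k p * z p (\<Psi> v p))) (cnj \<circ> spin_dual S \<Psi> k p)))"
proof -
  note B = frame_pairD(2)[OF F] and U = frame_pairD(3)[OF F]
  have t: "\<Upsilon> r p \<in> tangent A p" by (rule tangent_frame_tangent[OF frame_pairD(1)[OF F] p])
  have l: "lie (\<Upsilon> r p) (\<lambda>q. spin_dual D (dirac_frame S \<Psi>) (upper k) q (s q, z q)) = lie (\<Upsilon> r p) (\<lambda>q. spin_dual S \<Psi> k q (s q))"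
    "lie (\<Upsilon> r p) (\<lambda>q. spin_dual D (dirac_frame S \<Psi>) (lower k) q (s q, z q)) = lie (\<Upsilon> r p) (\<lambda>q. z q (\<Psi> k q))" for k
    by (rule lie_local[OF t U p], simp add: spin_dual_D[OF B _ w])+
  show ?thesis
    unfolding nabla_section_def prod.case D.nabla_vector_component dirac_frame_sum
    by (simp add: l sum_blocks spin_dual_D[OF B p w[OF p]] connection_blocks[OF F p] sum_negf)
qed

lemma extension_chiral_part: "extension A S C0 C"
  unfolding extension_def Let_def
proof (intro allI impI ballI conjI)
  fix U \<Upsilon> \<Psi> \<Psi>' p
  assume FF: "frame_pair A S (U,\<Upsilon>,\<Psi>) \<and> frame_pair A D (U,\<Upsilon>,\<Psi>')" and p: "p \<in> U"
  then have F: "frame_pair A S (U,\<Upsilon>,\<Psi>)" and F': "frame_pair A D (U,\<Upsilon>,\<Psi>')" by auto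
  note FD = dirac_frame_pair[OF F] and B = frame_pairD(2)[OF F]
  show "conG C (U,\<Upsilon>,\<Psi>') k i j p = conG C0 (U,\<Upsilon>,\<Psi>) k i j p" for k i j
    using D.conG_spin_frame_change[OF spinor_connection_C F' FD p p] by simp
  have t: "\<Upsilon> r p \<in> tangent A p" for r by (rule tangent_frame_tangent[OF frame_pairD(1)[OF F] p])
  have zero: "lie (\<Upsilon> r p) f = 0" if "\<And>q. q \<in> U \<Longrightarrow> f q = 0" for f r
    using lie_local[OF t frame_pairD(3)[OF F] p, of f "\<lambda>_. 0"] that lie_const[OF t] by simp
  show "nabla_section A D C (U,\<Upsilon>,\<Psi>') r (\<lambda>q. (s q, 0)) p = (nabla_section A S C0 (U,\<Upsilon>,\<Psi>) r s p, 0)"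
    if s: "smooth_section A S UNIV s" for s r
  proof -
    have sD: "smooth_section A D UNIV (\<lambda>q. (s q, 0))" by (rule smooth_section_upper[OF s open_UNIV])
    have "nabla_section A D C (U,\<Upsilon>,\<Psi>') r (\<lambda>q. (s q, 0)) p = nabla_section A D C (U,\<Upsilon>,dirac_frame S \<Psi>) r (\<lambda>q. (s q, 0)) p"
      by (rule D.nabla_section_frame_change[OF spinor_connection_C F' FD p p sD]) auto
    also have "\<dots> = (nabla_section A S C0 (U,\<Upsilon>,\<Psi>) r s p, 0)"
    proof (subst nabla_section_dirac_frame[OF F p])
      show "(s q, 0) \<in> fibre D q" for q using sD by (simp add: smooth_section_def)
    qed (simp add: nabla_section_def nabla_vector_component zero fscale_def zero_fun_def del: chiral_part_simps)
    finally show ?thesis .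
  qed
  show "nabla_section A D C (U,\<Upsilon>,\<Psi>') r (\<lambda>q. (0, z q)) p = (0, nabla_conj_cosection A S C0 (U,\<Upsilon>,\<Psi>) r z p)"
    if z: "smooth_section A D UNIV (\<lambda>q. (0, z q))" for z r
  proof -
    have "nabla_section A D C (U,\<Upsilon>,\<Psi>') r (\<lambda>q. (0, z q)) p = nabla_section A D C (U,\<Upsilon>,dirac_frame S \<Psi>) r (\<lambda>q. (0, z q)) p"
      by (rule D.nabla_section_frame_change[OF spinor_connection_C F' FD p p z]) auto
    also have "\<dots> = (0, nabla_conj_cosection A S C0 (U,\<Upsilon>,\<Psi>) r z p)"
    proof (subst nabla_section_dirac_frame[OF F p])
      show "(0, z q) \<in> fibre D q" for q using z by (simp add: smooth_section_def)
    qed (simp add: nabla_conj_cosection_def nabla_def components_def conj_covector_field_def zero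
          spin_dual_zero[OF B] p del: chiral_part_simps)
    finally show ?thesis .
  qed
qed

text \<open>An extension prescribes \<open>\<Gamma>\<close> and the derivatives of all global sections. Cut-off frame fields among these determine
  \<open>A\<close>, and reality the barred components.\<close>

lemma extension_unique:
  assumes C': "metric_connection_DM M SM C'" and E: "extension A S B C" and E': "extension A S B C'"
  shows "same_connection A D C' C"
  unfolding same_connection_def
proof (intro allI impI ballI)
  fix U \<Upsilon> \<Psi> p
  assume F: "frame_pair A D (U,\<Upsilon>,\<Psi>)" and p: "p \<in> U"
  interpret C': dirac_metric_connection M SM C' by unfold_locales (rule C')
  obtain V \<Theta> where c: "chiral V \<Theta>" "p \<in> V" using chiral_at .
  \<comment> \<open>the extension condition presupposes a frame of \<open>SM\<close>, which may exist on a smaller domain only\<close>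
  define W where "W = U \<inter> V"
  have V: "bundle_frame A S V \<Theta>" by (rule chiral_frame(1)[OF c(1)])
  have W: "open W" "W \<subseteq> U" "W \<subseteq> V" "p \<in> W"
    using D.frame_pairD(3)[OF F] V c(2) p by (auto simp: W_def bundle_frame_def)
  have FW: "frame_pair A D (W,\<Upsilon>,\<Psi>)" by (rule D.frame_pair_subset[OF F W(1,2)])
  have FS: "frame_pair A S (W,\<Upsilon>,\<Theta>)"
    using D.frame_pairD(1)[OF FW] bundle_frame_subset[OF V W(1,3)] by (simp add: frame_pair_def)
  note BW = D.frame_pairD(2)[OF FW] W(4)
  have G: "conG C' (U,\<Upsilon>,\<Psi>) k i j p = conG C (U,\<Upsilon>,\<Psi>) k i j p" for k i j
  proof -
    have "conG C' (W,\<Upsilon>,\<Psi>) k i j p = conG C (W,\<Upsilon>,\<Psi>) k i j p"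
      using E E' FW FS W(4) unfolding extension_def Let_def by metis
    then show ?thesis
      using D.conG_spin_frame_change[OF spinor_connection_C F FW p W(4)]
        D.conG_spin_frame_change[OF C'.spinor_connection_C F FW p W(4)] by simp
  qed
  have A: "conA C' (U,\<Upsilon>,\<Psi>) k i j p = conA C (U,\<Upsilon>,\<Psi>) k i j p" for k i j
  proof -
    have sj: "smooth_section A D U (\<Psi> j)" using D.frame_pairD(2)[OF F] by (simp add: bundle_frame_def)
    obtain b :: "'m \<Rightarrow> real" and w where w: "b p \<noteq> 0" "smooth_section A D UNIV w"
      "\<And>q. q \<in> U \<Longrightarrow> w q = vscale D (of_real (b q)) (\<Psi> j q)"
      by (rule D.cut_off_section[OF D.frame_pairD(3)[OF F] sj p]) blast
    define s where "s q = fst (w q)" for q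
    define z where "z q = snd (w q)" for q
    have s: "smooth_section A S UNIV s" and z: "smooth_section A D UNIV (\<lambda>q. (0, z q))"
      using smooth_section_parts[OF w(2) open_UNIV] by (simp_all add: s_def[abs_def] z_def)
    note sD = smooth_section_upper[OF s open_UNIV]
    have eq: "nabla_section A D C' (W,\<Upsilon>,\<Psi>) i (\<lambda>q. (s q, 0)) p = nabla_section A D C (W,\<Upsilon>,\<Psi>) i (\<lambda>q. (s q, 0)) p"
      "nabla_section A D C' (W,\<Upsilon>,\<Psi>) i (\<lambda>q. (0, z q)) p = nabla_section A D C (W,\<Upsilon>,\<Psi>) i (\<lambda>q. (0, z q)) p"
    proof -
      have e: "(\<forall>s r. smooth_section A S UNIV s \<longrightarrow>
          nabla_section A D X (W,\<Upsilon>,\<Psi>) r (\<lambda>q. (s q, 0)) p = (nabla_section A S B (W,\<Upsilon>,\<Theta>) r s p, 0)) \<and>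
        (\<forall>z r. smooth_section A D UNIV (\<lambda>q. (0, z q)) \<longrightarrow>
          nabla_section A D X (W,\<Upsilon>,\<Psi>) r (\<lambda>q. (0, z q)) p = (0, nabla_conj_cosection A S B (W,\<Upsilon>,\<Theta>) r z p))"
        if X: "extension A S B X" for X
        using X[unfolded extension_def Let_def, rule_format, OF conjI[OF FS FW] W(4)] by blast
      show "nabla_section A D C' (W,\<Upsilon>,\<Psi>) i (\<lambda>q. (s q, 0)) p = nabla_section A D C (W,\<Upsilon>,\<Psi>) i (\<lambda>q. (s q, 0)) p"
        using e[OF E] e[OF E'] s by simp
      show "nabla_section A D C' (W,\<Upsilon>,\<Psi>) i (\<lambda>q. (0, z q)) p = nabla_section A D C (W,\<Upsilon>,\<Psi>) i (\<lambda>q. (0, z q)) p"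
        using e[OF E] e[OF E'] z by simp
    qed
    have test: "(\<Sum>v\<in>UNIV. conA C' (W,\<Upsilon>,\<Psi>) k i v p * spin_dual D \<Psi> v p (y p)) =
        (\<Sum>v\<in>UNIV. conA C (W,\<Upsilon>,\<Psi>) k i v p * spin_dual D \<Psi> v p (y p))"
      if "nabla_section A D C' (W,\<Upsilon>,\<Psi>) i y p = nabla_section A D C (W,\<Upsilon>,\<Psi>) i y p" for y
      using arg_cong[OF that, of "spin_dual D \<Psi> k p"]
      unfolding nabla_section_def prod.case D.nabla_vector_component D.spin_dual_sum[OF BW] by simp
    \<comment> \<open>the extension condition covers sections of each summand, and the covariant derivative is additive\<close>
    have e: "w p = (s p, 0) + (0, z p)" by (simp add: s_def z_def)
    have m: "(s p, 0) \<in> fibre D p" "(0, z p) \<in> fibre D p" using sD z by (auto simp: smooth_section_def)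
    have "spin_dual D \<Psi> v p (w p) = spin_dual D \<Psi> v p (s p, 0) + spin_dual D \<Psi> v p (0, z p)" for v
      unfolding e by (rule D.spin_dual_add[OF BW m])
    then have "(\<Sum>v\<in>UNIV. conA C' (W,\<Upsilon>,\<Psi>) k i v p * spin_dual D \<Psi> v p (w p)) =
        (\<Sum>v\<in>UNIV. conA C (W,\<Upsilon>,\<Psi>) k i v p * spin_dual D \<Psi> v p (w p))"
      using test[OF eq(1)] test[OF eq(2)] by (simp add: distrib_left sum.distrib)
    moreover have "spin_dual D \<Psi> v p (w p) = (if v = j then of_real (b p) else 0)" for v
      using W(2,4) by (simp add: w(3) D.spin_dual_scale[OF BW] D.frame_in_fibre[OF BW] D.spin_dual_frame[OF BW] subset_iff)
    ultimately have "conA C' (W,\<Upsilon>,\<Psi>) k i j p = conA C (W,\<Upsilon>,\<Psi>) k i j p"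
      using w(1) by (simp add: if_distrib cong: if_cong)
    then show ?thesis
      using D.conA_restrict[OF spinor_connection_C F W(1,2,4)] D.conA_restrict[OF C'.spinor_connection_C F W(1,2,4)] by simp
  qed
  have "conB C' (U,\<Upsilon>,\<Psi>) k i j p = conB C (U,\<Upsilon>,\<Psi>) k i j p" for k i j
    using A D.real_connection_components(1)[OF real_connection_C F p]
      D.real_connection_components(1)[OF C'.real_connection_C F p] by simp
  then show "(\<forall>k i j. conG C' (U,\<Upsilon>,\<Psi>) k i j p = conG C (U,\<Upsilon>,\<Psi>) k i j p) \<and>
     (\<forall>k i j. conA C' (U,\<Upsilon>,\<Psi>) k i j p = conA C (U,\<Upsilon>,\<Psi>) k i j p) \<and>
     (\<forall>k i j. conB C' (U,\<Upsilon>,\<Psi>) k i j p = conB C (U,\<Upsilon>,\<Psi>) k i j p)"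
    using G A by blast
qed

end

theorem theorem8p1:
  fixes M :: "'m::{t2_space,second_countable_topology} spacetime"
    and SM :: "('m, 'e::ab_group_add) chiral"
    and C :: "('m, 'e \<times> ('e \<Rightarrow> complex), 4) connection"
  assumes "space_time M"
    and "spinor_bundle M SM"
    and "metric_connection_DM M SM C"
  shows "\<exists>C0. metric_connection_SM M SM C0 \<and> extension (atlas M) (sbundle SM) C0 C \<and>
           (\<forall>C'. metric_connection_DM M SM C' \<and> extension (atlas M) (sbundle SM) C0 C' \<longrightarrow>
              same_connection (atlas M) (dirac_bundle (sbundle SM)) C' C)"
proof -
  interpret dirac_metric_connection M SM C
    by unfold_locales (rule assms)+
  show ?thesis
    using metric_connection_chiral_part extension_chiral_part extension_unique[OF _ extension_chiral_part] by blast
qed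

end
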